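(* Let $s\in(0,1)$ and assume $p>\frac{2}{2-s}$. Let $\Omega\subset\mathbb{H}^N$ be open and let $f\in C(\Omega)$. Let $K$ be a kernel satisfying the ellipticity, symmetry, left-translation invariance and continuity assumptions listed in the context, with associated operator $\mathcal{L}$. Let $u\in L^\infty(\mathbb{H}^N)$. (a) If $u$ is a viscosity subsolution of $\mathcal{L}u=f$ in $\Omega$, then $u$ is a weak subsolution of $\mathcal{L}u=f$ in $\Omega$. (b) If $u$ is a viscosity supersolution of $\mathcal{L}u=f$ in $\Omega$, then $u$ is a weak supersolution of $\mathcal{L}u=f$ in $\Omega$. (c) If $u$ is a viscosity solution of $\mathcal{L}u=f$ in $\Omega$, then $u$ is a weak solution of $\mathcal{L}u=f$ in $\Omega$.
   Context: **Heisenberg group.** $\mathbb{H}^N$ is $\mathbb{R}^{2N+1}$ with points $\xi=(z,t)=(x,y,t)$, $x,y\in\mathbb{R}^N$, $t\in\mathbb{R}$, and group law $\xi\circ\xi'=(x+x',y+y',t+t'+2\langle x',y\rangle-2\langle x,y'\rangle)$; thus $\xi^{-1}=-\xi$. Homogeneous dimension $Q=2N+2$. Homogeneous norm: $|\xi|_{\mathbb{H}^N}=(|z|^4+t^2)^{1/4}$; $(\xi,\eta)\mapsto|\eta^{-1}\circ\xi|_{\mathbb{H}^N}$ is a metric, $B(\xi_0,R)=B_R(\xi_0)=\{\xi:|\xi_0^{-1}\circ\xi|_{\mathbb{H}^N}<R\}$. Integration is with respect to Lebesgue (Haar) measure. **Kernel and operator.** $p>1$, $s\in(0,1)$, $0<\lambda\le\Lambda$.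 $K$ is a positive function defined off the diagonal of $\mathbb{H}^N\times\mathbb{H}^N$ with $\lambda|\eta^{-1}\circ\xi|_{\mathbb{H}^N}^{-Q-sp}\le K(\xi,\eta)\le\Lambda|\eta^{-1}\circ\xi|_{\mathbb{H}^N}^{-Q-sp}$ for $\xi\ne\eta$; $K(\xi,\eta)=K(\eta,\xi)$; $K(\xi_0\circ\xi,\xi_0\circ\eta)=K(\xi,\eta)$ for all $\xi_0$; and $\xi\mapsto K(\xi,\eta)$ is continuous away from $\xi=\eta$. The operator is $$\mathcal{L}u(\xi)=2\,\mathrm{P.V.}\int_{\mathbb{H}^N}|u(\xi)-u(\eta)|^{p-2}(u(\xi)-u(\eta))K(\xi,\eta)\,d\eta=2\lim_{\varepsilon\to0}\int_{\mathbb{H}^N\setminus B(\xi,\varepsilon)}(\cdots)\,d\eta .$$ **Function spaces.** $W^{s,p}(U)=\{u\in L^p(U):\int_U\int_U\frac{|u(\xi)-u(\eta)|^p}{|\eta^{-1}\circ\xi|_{\mathbb{H}^N}^{Q+sp}}\,d\xi\,d\eta<\infty\}$; $W^{s,p}_{\mathrm{loc}}(\Omega)$ is its local version. $L^{m}_{\gamma}(\mathbb{H}^N)=\{v\in L^m_{\mathrm{loc}}(\mathbb{H}^N):\int_{\mathbb{H}^N}\frac{|v(\eta)|^m}{1+|\eta|_{\mathbb{H}^N}^{Q+\gamma}}\,d\eta<\infty\}$. **Weak solutions.** For $f\in L^p_{\mathrm{loc}}(\Omega)$, a function $u\in W^{s,p}_{\mathrm{loc}}(\Omega)\cap L^{p-1}_{sp}(\mathbb{H}^N)$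 is a weak supersolution (subsolution) of $\mathcal{L}u=f$ in $\Omega$ if $$\iint_{\mathbb{H}^N\times\mathbb{H}^N}|u(\xi)-u(\eta)|^{p-2}(u(\xi)-u(\eta))(\phi(\xi)-\phi(\eta))K(\xi,\eta)\,d\eta\,d\xi\ \ge(\le)\ \int f\phi\,d\xi$$ for all non-negative $\phi\in C_0^\infty(\Omega)$. A weak solution is both a weak sub- and supersolution. **Viscosity solutions (for $p>\frac{2}{2-s}$).** $u:\mathbb{H}^N\to[-\infty,\infty]$ is a viscosity supersolution (subsolution) of $\mathcal{L}u=f$ in $\Omega$ if: 1. $u<+\infty$ ($u>-\infty$) a.e. in $\mathbb{H}^N$ and $u>-\infty$ ($u<+\infty$) a.e. in $\Omega$; 2. $u$ is lower (upper) semicontinuous in $\Omega$; 3. whenever $\phi\in C^2(B_r(\xi_0))\cap L^{p-1}_{sp}(\mathbb{H}^N)$ for some $B_r(\xi_0)\subset\Omega$, $\phi(\xi_0)=u(\xi_0)$ and $\phi\le u$ ($\phi\ge u$) in $\mathbb{H}^N$, then $\mathcal{L}\phi_r(\xi_0)\ge(\le)f(\xi_0)$, where $\phi_r=\phi$ in $B_r(\xi_0)$ and $\phi_r=u$ elsewhere; 4. $u_-$ (respectively $u_+$) belongs to $L^{p-1}_{sp}(\mathbb{H}^N)$. A viscosity solution is both a viscosity sub- and supersolution. (For $p\le\frac{2}{2-s}$ the definition restricts the test functions in item 3; that range is not used here.) *)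

theory Defs
  imports "HOL-Analysis.Analysis"
begin

section \<open>The Heisenberg group\<close>

text \<open>Points are triples \<open>(x, y, t)\<close> with \<open>x, y \<in> \<real>\<^sup>N\<close>, where \<open>N = CARD('n)\<close>. The group inverse
  is \<open>- \<xi>\<close> and the Haar measure is Lebesgue measure on this Euclidean space.\<close>

type_synonym 'n heis = "(real^'n) \<times> (real^'n) \<times> real"

definition hmult :: "'n::finite heis \<Rightarrow> 'n heis \<Rightarrow> 'n heis" (infixl \<open>\<diamondop>\<close> 70) where
  "\<xi> \<diamondop> \<xi>' = (case \<xi> of (x, y, t) \<Rightarrow> case \<xi>' of (x', y', t') \<Rightarrow>
     (x + x', y + y', t + t' + 2 * (x' \<bullet> y) - 2 * (x \<bullet> y')))"

definition hom_dim :: "'n::finite itself \<Rightarrow> real" where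
  "hom_dim _ = 2 * real CARD('n) + 2"

definition hnorm :: "'n::finite heis \<Rightarrow> real" where
  "hnorm \<xi> = (case \<xi> of (x, y, t) \<Rightarrow> root 4 (norm (x, y) ^ 4 + t\<^sup>2))"

definition hball :: "'n::finite heis \<Rightarrow> real \<Rightarrow> 'n heis set" where
  "hball \<xi>0 R = {\<xi>. hnorm ((- \<xi>0) \<diamondop> \<xi>) < R}"

section \<open>Function spaces\<close>

text \<open>\<open>C\<^sup>k(S)\<close>, for open \<open>S\<close>, in the Euclidean sense.\<close>

primrec Ck_on :: "nat \<Rightarrow> 'a::euclidean_space set \<Rightarrow> ('a \<Rightarrow> real) \<Rightarrow> bool" where
  "Ck_on 0 S g \<longleftrightarrow> continuous_on S g"
| "Ck_on (Suc k) S g \<longleftrightarrow> (\<forall>x\<in>S. g differentiable (at x)) \<and>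
     (\<forall>b\<in>Basis. Ck_on k S (\<lambda>x. frechet_derivative g (at x) b))"

definition test_functions :: "'a::euclidean_space set \<Rightarrow> ('a \<Rightarrow> real) set" where
  "test_functions \<Omega> = {\<phi>. (\<forall>k. Ck_on k UNIV \<phi>) \<and>
     compact (closure {x. \<phi> x \<noteq> 0}) \<and> closure {x. \<phi> x \<noteq> 0} \<subseteq> \<Omega>}"

definition Linfty :: "('a::euclidean_space \<Rightarrow> real) set" where
  "Linfty = {u. u \<in> borel_measurable lebesgue \<and> (\<exists>C. AE x in lebesgue. \<bar>u x\<bar> \<le> C)}"

definition Lp_on :: "real \<Rightarrow> 'a::euclidean_space set \<Rightarrow> ('a \<Rightarrow> real) set" where
  "Lp_on m U = {u. set_borel_measurable lebesgue U u \<and>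
     (\<integral>\<^sup>+x\<in>U. ennreal (\<bar>u x\<bar> powr m) \<partial>lebesgue) < \<infinity>}"

definition Wsp_on :: "real \<Rightarrow> real \<Rightarrow> 'n::finite heis set \<Rightarrow> ('n heis \<Rightarrow> real) set" where
  "Wsp_on s p U = {u. u \<in> Lp_on p U \<and>
     (\<integral>\<^sup>+\<xi>\<in>U. (\<integral>\<^sup>+\<eta>\<in>U. ennreal (\<bar>u \<xi> - u \<eta>\<bar> powr p /
        hnorm ((- \<eta>) \<diamondop> \<xi>) powr (hom_dim TYPE('n) + s * p)) \<partial>lebesgue) \<partial>lebesgue) < \<infinity>}"

definition Wsp_loc :: "real \<Rightarrow> real \<Rightarrow> 'n::finite heis set \<Rightarrow> ('n heis \<Rightarrow> real) set" where
  "Wsp_loc s p \<Omega> = {u. \<forall>U. open U \<and> compact (closure U) \<and> closure U \<subseteq> \<Omega> \<longrightarrow> u \<in> Wsp_on s p U}"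

definition Lweighted :: "real \<Rightarrow> real \<Rightarrow> ('n::finite heis \<Rightarrow> real) set" where
  "Lweighted m \<gamma> = {v. (\<forall>C. compact C \<longrightarrow> v \<in> Lp_on m C) \<and>
     (\<integral>\<^sup>+\<eta>. ennreal (\<bar>v \<eta>\<bar> powr m / (1 + hnorm \<eta> powr (hom_dim TYPE('n) + \<gamma>))) \<partial>lebesgue) < \<infinity>}"

text \<open>The same space for extended-real-valued functions; its members are finite almost everywhere.\<close>

definition Lweighted_ext :: "real \<Rightarrow> real \<Rightarrow> ('n::finite heis \<Rightarrow> ereal) set" where
  "Lweighted_ext m \<gamma> = {v. (AE \<eta> in lebesgue. \<bar>v \<eta>\<bar> \<noteq> \<infinity>) \<and>
     (\<lambda>\<eta>. real_of_ereal (v \<eta>)) \<in> Lweighted m \<gamma>}"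

section \<open>Kernel and operator\<close>

definition nonlocal_kernel ::
    "real \<Rightarrow> real \<Rightarrow> real \<Rightarrow> real \<Rightarrow> ('n::finite heis \<Rightarrow> 'n heis \<Rightarrow> real) \<Rightarrow> bool" where
  "nonlocal_kernel s p lam Lam K \<longleftrightarrow>
     (\<forall>\<xi> \<eta>. \<xi> \<noteq> \<eta> \<longrightarrow>
        0 < K \<xi> \<eta> \<and>
        lam * hnorm ((- \<eta>) \<diamondop> \<xi>) powr (- hom_dim TYPE('n) - s * p) \<le> K \<xi> \<eta> \<and>
        K \<xi> \<eta> \<le> Lam * hnorm ((- \<eta>) \<diamondop> \<xi>) powr (- hom_dim TYPE('n) - s * p) \<and>
        K \<xi> \<eta> = K \<eta> \<xi> \<and>
        (\<forall>\<xi>0. K (\<xi>0 \<diamondop> \<xi>) (\<xi>0 \<diamondop> \<eta>) = K \<xi> \<eta>)) \<and>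
     (\<forall>\<eta>. continuous_on (- {\<eta>}) (\<lambda>\<xi>. K \<xi> \<eta>))"

definition signed_pow :: "real \<Rightarrow> real \<Rightarrow> real" where
  "signed_pow p a = \<bar>a\<bar> powr (p - 2) * a"

text \<open>The Lebesgue integral with values in \<open>[-\<infinity>, \<infinity>]\<close>, meaningful whenever the positive or the
  negative part of \<open>g\<close> has finite integral.\<close>

definition ext_integral :: "'a measure \<Rightarrow> ('a \<Rightarrow> real) \<Rightarrow> ereal" where
  "ext_integral M g =
     enn2ereal (\<integral>\<^sup>+x. ennreal (g x) \<partial>M) - enn2ereal (\<integral>\<^sup>+x. ennreal (- g x) \<partial>M)"

text \<open>The operator acts on extended-real-valued functions that are finite almost everywhere and
  finite at the point of evaluation; the junk value of \<^const>\<open>real_of_ereal\<close> at \<open>\<plusminus>\<infinity>\<close> then only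
  affects a null set of \<open>\<eta>\<close>.\<close>

definition nonlocal_op ::
    "real \<Rightarrow> ('n::finite heis \<Rightarrow> 'n heis \<Rightarrow> real) \<Rightarrow> ('n heis \<Rightarrow> ereal) \<Rightarrow> 'n heis \<Rightarrow> ereal" where
  "nonlocal_op p K v \<xi> = 2 * Lim (at_right 0) (\<lambda>\<epsilon>. ext_integral lebesgue (\<lambda>\<eta>.
     indicator (- hball \<xi> \<epsilon>) \<eta> *
       (signed_pow p (real_of_ereal (v \<xi>) - real_of_ereal (v \<eta>)) * K \<xi> \<eta>)))"

section \<open>Weak solutions\<close>

definition weak_form ::
    "real \<Rightarrow> ('n::finite heis \<Rightarrow> 'n heis \<Rightarrow> real) \<Rightarrow> ('n heis \<Rightarrow> real) \<Rightarrow> ('n heis \<Rightarrow> real) \<Rightarrow> real" where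
  "weak_form p K u \<phi> =
     (\<integral>(\<xi>, \<eta>). signed_pow p (u \<xi> - u \<eta>) * (\<phi> \<xi> - \<phi> \<eta>) * K \<xi> \<eta> \<partial>lebesgue)"

definition weak_supersolution ::
    "real \<Rightarrow> real \<Rightarrow> ('n::finite heis \<Rightarrow> 'n heis \<Rightarrow> real) \<Rightarrow> ('n heis \<Rightarrow> real) \<Rightarrow> 'n heis set \<Rightarrow>
     ('n heis \<Rightarrow> real) \<Rightarrow> bool" where
  "weak_supersolution s p K f \<Omega> u \<longleftrightarrow>
     u \<in> Wsp_loc s p \<Omega> \<and> u \<in> Lweighted (p - 1) (s * p) \<and>
     (\<forall>\<phi>\<in>test_functions \<Omega>. (\<forall>\<xi>. 0 \<le> \<phi> \<xi>) \<longrightarrow>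
        weak_form p K u \<phi> \<ge> (LINT \<xi>:\<Omega>|lebesgue. f \<xi> * \<phi> \<xi>))"

definition weak_subsolution ::
    "real \<Rightarrow> real \<Rightarrow> ('n::finite heis \<Rightarrow> 'n heis \<Rightarrow> real) \<Rightarrow> ('n heis \<Rightarrow> real) \<Rightarrow> 'n heis set \<Rightarrow>
     ('n heis \<Rightarrow> real) \<Rightarrow> bool" where
  "weak_subsolution s p K f \<Omega> u \<longleftrightarrow>
     u \<in> Wsp_loc s p \<Omega> \<and> u \<in> Lweighted (p - 1) (s * p) \<and>
     (\<forall>\<phi>\<in>test_functions \<Omega>. (\<forall>\<xi>. 0 \<le> \<phi> \<xi>) \<longrightarrow>
        weak_form p K u \<phi> \<le> (LINT \<xi>:\<Omega>|lebesgue. f \<xi> * \<phi> \<xi>))"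

definition weak_solution ::
    "real \<Rightarrow> real \<Rightarrow> ('n::finite heis \<Rightarrow> 'n heis \<Rightarrow> real) \<Rightarrow> ('n heis \<Rightarrow> real) \<Rightarrow> 'n heis set \<Rightarrow>
     ('n heis \<Rightarrow> real) \<Rightarrow> bool" where
  "weak_solution s p K f \<Omega> u \<longleftrightarrow>
     weak_subsolution s p K f \<Omega> u \<and> weak_supersolution s p K f \<Omega> u"

section \<open>Viscosity solutions, for \<open>p > 2 / (2 - s)\<close>\<close>

definition lsc_on :: "'a::topological_space set \<Rightarrow> ('a \<Rightarrow> ereal) \<Rightarrow> bool" where
  "lsc_on S u \<longleftrightarrow> (\<forall>a. openin (top_of_set S) {x\<in>S. a < u x})"

definition usc_on :: "'a::topological_space set \<Rightarrow> ('a \<Rightarrow> ereal) \<Rightarrow> bool" where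
  "usc_on S u \<longleftrightarrow> (\<forall>a. openin (top_of_set S) {x\<in>S. u x < a})"

text \<open>A viscosity test function is real-valued and \<open>C\<^sup>2\<close> on the ball, but may be infinite on a null
  set elsewhere: if it had to be finite everywhere, a single point with \<open>u = -\<infinity>\<close> outside \<open>\<Omega>\<close> would
  leave no test functions below \<open>u\<close>.\<close>

definition C2_Lweighted ::
    "real \<Rightarrow> real \<Rightarrow> 'n::finite heis \<Rightarrow> real \<Rightarrow> ('n heis \<Rightarrow> ereal) set" where
  "C2_Lweighted s p \<xi>0 r = {\<phi>. (\<forall>\<xi>\<in>hball \<xi>0 r. \<bar>\<phi> \<xi>\<bar> \<noteq> \<infinity>) \<and>
     Ck_on 2 (hball \<xi>0 r) (\<lambda>\<xi>. real_of_ereal (\<phi> \<xi>)) \<and> \<phi> \<in> Lweighted_ext (p - 1) (s * p)}"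

definition glue :: "'n::finite heis \<Rightarrow> real \<Rightarrow> ('n heis \<Rightarrow> ereal) \<Rightarrow> ('n heis \<Rightarrow> ereal) \<Rightarrow> 'n heis \<Rightarrow> ereal"
  where "glue \<xi>0 r \<phi> u \<xi> = (if \<xi> \<in> hball \<xi>0 r then \<phi> \<xi> else u \<xi>)"

definition viscosity_supersolution ::
    "real \<Rightarrow> real \<Rightarrow> ('n::finite heis \<Rightarrow> 'n heis \<Rightarrow> real) \<Rightarrow> ('n heis \<Rightarrow> real) \<Rightarrow> 'n heis set \<Rightarrow>
     ('n heis \<Rightarrow> ereal) \<Rightarrow> bool" where
  "viscosity_supersolution s p K f \<Omega> u \<longleftrightarrow>
     (AE \<xi> in lebesgue. u \<xi> < \<infinity>) \<and> (AE \<xi> in lebesgue. \<xi> \<in> \<Omega> \<longrightarrow> - \<infinity> < u \<xi>) \<and>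
     lsc_on \<Omega> u \<and>
     (\<forall>\<xi>0 r \<phi>. 0 < r \<and> hball \<xi>0 r \<subseteq> \<Omega> \<and> \<phi> \<in> C2_Lweighted s p \<xi>0 r \<and>
        \<phi> \<xi>0 = u \<xi>0 \<and> (\<forall>\<xi>. \<phi> \<xi> \<le> u \<xi>) \<longrightarrow>
        nonlocal_op p K (glue \<xi>0 r \<phi> u) \<xi>0 \<ge> ereal (f \<xi>0)) \<and>
     (\<lambda>\<xi>. max (- u \<xi>) 0) \<in> Lweighted_ext (p - 1) (s * p)"

definition viscosity_subsolution ::
    "real \<Rightarrow> real \<Rightarrow> ('n::finite heis \<Rightarrow> 'n heis \<Rightarrow> real) \<Rightarrow> ('n heis \<Rightarrow> real) \<Rightarrow> 'n heis set \<Rightarrow>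
     ('n heis \<Rightarrow> ereal) \<Rightarrow> bool" where
  "viscosity_subsolution s p K f \<Omega> u \<longleftrightarrow>
     (AE \<xi> in lebesgue. - \<infinity> < u \<xi>) \<and> (AE \<xi> in lebesgue. \<xi> \<in> \<Omega> \<longrightarrow> u \<xi> < \<infinity>) \<and>
     usc_on \<Omega> u \<and>
     (\<forall>\<xi>0 r \<phi>. 0 < r \<and> hball \<xi>0 r \<subseteq> \<Omega> \<and> \<phi> \<in> C2_Lweighted s p \<xi>0 r \<and>
        \<phi> \<xi>0 = u \<xi>0 \<and> (\<forall>\<xi>. u \<xi> \<le> \<phi> \<xi>) \<longrightarrow>
        nonlocal_op p K (glue \<xi>0 r \<phi> u) \<xi>0 \<le> ereal (f \<xi>0)) \<and>
     (\<lambda>\<xi>. max (u \<xi>) 0) \<in> Lweighted_ext (p - 1) (s * p)"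

definition viscosity_solution ::
    "real \<Rightarrow> real \<Rightarrow> ('n::finite heis \<Rightarrow> 'n heis \<Rightarrow> real) \<Rightarrow> ('n heis \<Rightarrow> real) \<Rightarrow> 'n heis set \<Rightarrow>
     ('n heis \<Rightarrow> ereal) \<Rightarrow> bool" where
  "viscosity_solution s p K f \<Omega> u \<longleftrightarrow>
     viscosity_subsolution s p K f \<Omega> u \<and> viscosity_supersolution s p K f \<Omega> u"

end

theory Submission
  imports Defs
begin

text \<open>By the symmetry \<open>u \<mapsto> -u\<close> only supersolutions matter. Regularise \<open>u\<close> near a compact subset of
  \<open>\<Omega>\<close> by the inf-convolution \<open>w(\<xi>) = inf\<^sub>h (u(h \<diamondop> \<xi>) + n |h|\<^sup>2)\<close> along left translations, with the
  Euclidean norm \<open>|h|\<close>. If the infimum at \<open>\<xi>\<close> is attained at \<open>h\<close>, then a paraboloid touches \<open>u\<close> from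
  below at \<open>h \<diamondop> \<xi>\<close>, so the viscosity inequality holds there, and \<open>w(\<xi>) - w(\<eta>) \<ge> u(h \<diamondop> \<xi>) - u(h \<diamondop> \<eta>)\<close>.
  Since the kernel is left-invariant, this yields at every point, without any second-order
  differentiability of \<open>w\<close>, a lower bound for the operator truncated to distances at least \<open>\<tau>\<close>,
  with an error that vanishes as \<open>\<tau> \<rightarrow> 0\<close> and \<open>n \<rightarrow> \<infinity>\<close>. The truncated weak form is absolutely
  convergent, so this bound can be tested with any bounded function: the test function
  \<open>\<zeta>\<^sup>p (M - w)\<close> gives a Caccioppoli estimate uniform in \<open>n\<close> and \<open>\<tau>\<close>, hence the \<open>W\<^sup>s\<^sup>p\<close>-regularity of
  \<open>u\<close> by Fatou's lemma, and Young's inequality then allows passage to the limit in the weak form.\<close>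

section \<open>Geometry of the Heisenberg group\<close>

text \<open>The operator sees increments as right factors \<open>x \<diamondop> g\<close>, and these
  commute with translation on the left: the translation \<open>h\<close> used at \<open>x\<close> is
  also admissible at \<open>x \<diamondop> g\<close>, as long as one stays in the compact set, and
  it pays the same penalty there. The penalty is Euclidean because translations are affine maps. It
  is therefore a quadratic polynomial, and its symmetric second differences along \<open>g\<close>
  and \<open>- g\<close> are of order two in the homogeneous norm. After the nonlinearity they are
  of order min(p, 2p-2). The hypothesis p > 2/(2-s) says that this exceeds sp, so the small ball
  contributes little to the principal value, uniformly over bounded sets of touching points and
  centres. The limits are ordered: \<open>n\<close> fixes the opening of the paraboloids, and the
  admissible \<tau> depends on it. A further obstacle is that \<open>u\<close> is only Lebesgue
  measurable and bounded almost everywhere, while touching is a pointwise notion. The argument runs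
  on a bounded Borel function that agrees with \<open>u\<close> at every point of the compact
  set.\<close>

lemma hmult_simps [simp]:
  "((x, y, t) :: 'n::finite heis) \<diamondop> (x', y', t') =
     (x + x', y + y', t + t' + 2 * (x' \<bullet> y) - 2 * (x \<bullet> y'))"
  by (simp add: hmult_def)

lemma hmult_assoc: "(a \<diamondop> b) \<diamondop> c = a \<diamondop> (b \<diamondop> (c :: 'n::finite heis))"
  by (cases a; cases b; cases c) (simp add: algebra_simps)

lemma hmult_zero [simp]: "0 \<diamondop> a = a" "a \<diamondop> 0 = (a :: 'n::finite heis)"
  by (cases a; simp add: zero_prod_def)+

lemma hmult_neg [simp]: "(- a) \<diamondop> a = 0" "a \<diamondop> (- a) = (0 :: 'n::finite heis)"
  by (cases a; simp add: zero_prod_def inner_commute)+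

lemma hmult_neg_cancel [simp]:
  "(- a) \<diamondop> (a \<diamondop> b) = b" "a \<diamondop> ((- a) \<diamondop> b) = (b :: 'n::finite heis)"
  by (simp_all flip: hmult_assoc)

lemma neg_hmult: "- (a \<diamondop> b) = (- b) \<diamondop> (- a :: 'n::finite heis)"
  by (cases a; cases b) (simp add: inner_commute algebra_simps)

lemma neg_hmult_eq_0_iff: "(- a) \<diamondop> b = 0 \<longleftrightarrow> a = (b :: 'n::finite heis)"
  by (metis hmult_neg_cancel(2) hmult_zero(2) hmult_neg(1))

lemma hnorm_nonneg [simp]: "0 \<le> hnorm a"
  by (cases a) (simp add: hnorm_def)

lemma hnorm_pow4: "hnorm (x, y, t) ^ 4 = norm (x, y) ^ 4 + t\<^sup>2"
  by (simp add: hnorm_def)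

lemma hnorm_neg [simp]: "hnorm (- a) = hnorm a"
proof (cases a)
  case (fields x y t)
  have "norm (- x, - y) = norm (x, y)" by (simp add: norm_Pair)
  then show ?thesis using fields by (simp add: hnorm_def)
qed

lemma hnorm_eq_0_iff [simp]: "hnorm a = 0 \<longleftrightarrow> a = 0"
proof (cases a)
  case (fields x y t)
  have "norm (x, y) ^ 4 + t\<^sup>2 = 0 \<longleftrightarrow> norm (x, y) ^ 4 = 0 \<and> t\<^sup>2 = 0"
    by (intro add_nonneg_eq_0_iff) auto
  then show ?thesis using fields by (simp add: hnorm_def zero_prod_def)
qed

lemma hnorm_pos_iff [simp]: "0 < hnorm a \<longleftrightarrow> a \<noteq> 0"
  by (metis hnorm_eq_0_iff hnorm_nonneg less_le)

lemma hnorm_zero [simp]: "hnorm 0 = 0"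
  by simp

lemma continuous_hnorm [continuous_intros]:
  "continuous_on S f \<Longrightarrow> continuous_on S (\<lambda>x. hnorm (f x :: 'n::finite heis))"
proof -
  have "hnorm = (\<lambda>a :: 'n heis. root 4 (norm (fst a, fst (snd a)) ^ 4 + (snd (snd a))\<^sup>2))"
    by (auto simp: hnorm_def fun_eq_iff split: prod.splits)
  moreover have "continuous_on UNIV (\<lambda>a :: 'n heis. root 4 (norm (fst a, fst (snd a)) ^ 4 + (snd (snd a))\<^sup>2))"
    by (intro continuous_intros)
  ultimately have "continuous_on UNIV (hnorm :: 'n heis \<Rightarrow> real)" by (simp only:)
  then show "continuous_on S f \<Longrightarrow> ?thesis"
    by (rule continuous_on_compose2) auto
qed

lemma hnorm_measurable [measurable]: "hnorm \<in> borel_measurable borel"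
  by (intro borel_measurable_continuous_onI continuous_intros)

lemma hmult_alt: "a \<diamondop> b = (fst a + fst b, fst (snd a) + fst (snd b),
    snd (snd a) + snd (snd b) + 2 * (fst b \<bullet> fst (snd a)) - 2 * (fst a \<bullet> fst (snd b)))"
  by (cases a; cases b) simp

lemma continuous_hmult [continuous_intros]:
  "continuous_on S f \<Longrightarrow> continuous_on S g \<Longrightarrow> continuous_on S (\<lambda>x. f x \<diamondop> (g x :: 'n::finite heis))"
  unfolding hmult_alt by (intro continuous_intros)

lemma hmult_measurable [measurable]:
  assumes [measurable]: "f \<in> borel_measurable M" "g \<in> borel_measurable M"
  shows "(\<lambda>x. f x \<diamondop> (g x :: 'n::finite heis)) \<in> borel_measurable M"
proof -
  have "(\<lambda>z. fst z \<diamondop> (snd z :: 'n heis)) \<in> borel_measurable borel"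
    by (intro borel_measurable_continuous_onI continuous_intros)
  then have "(\<lambda>z. fst z \<diamondop> (snd z :: 'n heis)) \<in> borel \<Otimes>\<^sub>M borel \<rightarrow>\<^sub>M borel"
    unfolding borel_prod .
  from measurable_compose[OF _ this, of "\<lambda>x. (f x, g x)" M] show ?thesis by simp
qed

lemma norm_fst_le_hnorm: "norm (x, y) \<le> hnorm (x, y, t)"
proof -
  have "norm (x, y) ^ 4 \<le> hnorm (x, y, t) ^ 4"
    by (simp add: hnorm_pow4)
  then show ?thesis by (simp add: power_mono_iff)
qed


text \<open>The last coordinate is of order \<open>hnorm a ^ 2\<close>, which is below
  \<open>hnorm a\<close> in the unit ball. Through this bound Euclidean Lipschitz estimates become
  estimates in the homogeneous norm near the identity.\<close>

lemma norm_le_hnorm: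
  assumes "hnorm a \<le> 1" shows "norm a \<le> 2 * hnorm a"
proof (cases a)
  case (fields x y t)
  have "t\<^sup>2 \<le> (hnorm a ^ 2)\<^sup>2"
    using hnorm_pow4[of x y t] fields by (simp flip: power_mult)
  then have "\<bar>t\<bar> \<le> hnorm a ^ 2"
    by (metis abs_le_square_iff abs_of_nonneg zero_le_power2)
  also have "\<dots> \<le> hnorm a"
    using assms by (simp add: power2_eq_square mult_left_le)
  finally have t: "\<bar>t\<bar> \<le> hnorm a" .
  have "norm a = norm ((x, y), t)"
    by (simp add: fields norm_Pair power2_eq_square add.assoc)
  also have "\<dots> \<le> norm (x, y) + norm t"
    by (rule norm_Pair_le)
  finally show ?thesis using norm_fst_le_hnorm[of x y t] t fields by simp
qed

text \<open>Both products differ from \<open>a + g\<close> by the bilinear term \<open>c\<close> in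
  the last coordinate, up to sign. Each of its two inner products is at most
  \<open>norm a * norm g\<close>, and the coefficients 2 add up to 4.\<close>

lemma norm_hmult_diff_le:
  "norm (a \<diamondop> g - a) \<le> (1 + 4 * norm a) * norm g"
  "norm (g \<diamondop> a - a) \<le> (1 + 4 * norm a) * norm (g :: 'n::finite heis)"
proof -
  obtain x y t where a: "a = (x, y, t)" by (cases a)
  obtain x' y' t' where g: "g = (x', y', t')" by (cases g)
  define c where "c = 2 * (x' \<bullet> y) - 2 * (x \<bullet> y')"
  have n: "norm x \<le> norm a" "norm y \<le> norm a" "norm x' \<le> norm g" "norm y' \<le> norm g"
    unfolding a g by (metis norm_fst_le norm_snd_le order_trans)+
  have "\<bar>x' \<bullet> y\<bar> \<le> norm a * norm g" "\<bar>x \<bullet> y'\<bar> \<le> norm a * norm g"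
    using order_trans[OF Cauchy_Schwarz_ineq2 mult_mono, of x' "norm g" y "norm a"]
      order_trans[OF Cauchy_Schwarz_ineq2 mult_mono, of x "norm a" y' "norm g"] n
    by (simp_all add: mult.commute)
  then have c: "norm (0::real^'n, 0::real^'n, c) \<le> 4 * norm a * norm g"
    unfolding c_def norm_Pair by simp
  have "a \<diamondop> g - a = g + (0, 0, c)" "g \<diamondop> a - a = g - (0, 0, c)"
    by (simp_all add: a g c_def inner_commute)
  then have "norm (a \<diamondop> g - a) \<le> norm g + norm (0::real^'n, 0::real^'n, c)"
    "norm (g \<diamondop> a - a) \<le> norm g + norm (0::real^'n, 0::real^'n, c)"
    by (metis norm_triangle_ineq norm_triangle_ineq4)+
  then show "norm (a \<diamondop> g - a) \<le> (1 + 4 * norm a) * norm g"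
    "norm (g \<diamondop> a - a) \<le> (1 + 4 * norm a) * norm g"
    using c by (simp_all add: algebra_simps)
qed

section \<open>Invariance of Lebesgue measure under the group operations\<close>

lemma nn_integral_lborel_add:
  assumes [measurable]: "F \<in> borel_measurable borel"
  shows "(\<integral>\<^sup>+x. F (c + x) \<partial>lborel) = (\<integral>\<^sup>+x. F x \<partial>(lborel :: 'a::euclidean_space measure))"
  using nn_integral_distr[of "(+) c" lborel borel F] by (simp add: lborel_distr_plus)

lemma nn_integral_lborel_neg:
  assumes [measurable]: "F \<in> borel_measurable borel"
  shows "(\<integral>\<^sup>+x. F (- x) \<partial>lborel) = (\<integral>\<^sup>+x. F x \<partial>(lborel :: 'a::euclidean_space measure))"
proof -
  have "(lborel :: 'a measure) = distr lborel borel (\<lambda>x. - x)"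
    using lborel_affine_euclidean[of "\<lambda>_. -1" "0::'a"] 
    by (simp add: euclidean_representation sum_negf density_1 cong: distr_cong)
  then show ?thesis
    using nn_integral_distr[of "\<lambda>x. - x" lborel borel F] by simp
qed

lemma nn_integral_lborel_pair:
  assumes "F \<in> borel_measurable borel"
  shows "(\<integral>\<^sup>+z. F z \<partial>(lborel :: ('a::euclidean_space \<times> 'b::euclidean_space) measure)) =
    (\<integral>\<^sup>+x. \<integral>\<^sup>+y. F (x, y) \<partial>lborel \<partial>lborel)"
  using lborel.nn_integral_fst[of F "lborel :: 'a measure"] assms
  by (simp add: lborel_prod flip: borel_prod)

text \<open>By Tonelli, the shift of the last coordinate depends on the outer variables only, so it
  is a plain translation in the innermost integral. The other two coordinates are then translated by
  constants.\<close>

lemma nn_integral_hmult: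
  assumes [measurable]: "F \<in> borel_measurable borel"
  shows "(\<integral>\<^sup>+g. F (a \<diamondop> g) \<partial>lborel) = (\<integral>\<^sup>+g. F g \<partial>(lborel :: 'n::finite heis measure))"
proof -
  obtain x y t where a: "a = (x, y, t)" by (cases a)
  have F[measurable]: "F \<in> borel_measurable (borel \<Otimes>\<^sub>M borel \<Otimes>\<^sub>M borel)"
    by (simp add: borel_prod)
  have "(\<integral>\<^sup>+g. F (a \<diamondop> g) \<partial>lborel) =
    (\<integral>\<^sup>+x'. \<integral>\<^sup>+y'. \<integral>\<^sup>+t'. F (x + x', y + y', (t + 2 * (x' \<bullet> y) - 2 * (x \<bullet> y')) + t') \<partial>lborel \<partial>lborel \<partial>lborel)"
    by (simp add: nn_integral_lborel_pair a algebra_simps)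
  also have "\<dots> = (\<integral>\<^sup>+x'. \<integral>\<^sup>+y'. \<integral>\<^sup>+t'. F (x + x', y + y', t') \<partial>lborel \<partial>lborel \<partial>lborel)"
    by (subst nn_integral_lborel_add) auto
  also have "\<dots> = (\<integral>\<^sup>+x'. \<integral>\<^sup>+y'. \<integral>\<^sup>+t'. F (x + x', y', t') \<partial>lborel \<partial>lborel \<partial>lborel)"
    by (subst nn_integral_lborel_add[where F="\<lambda>y'. \<integral>\<^sup>+t'. F (x + _, y', t') \<partial>lborel"]) auto
  also have "\<dots> = (\<integral>\<^sup>+x'. \<integral>\<^sup>+y'. \<integral>\<^sup>+t'. F (x', y', t') \<partial>lborel \<partial>lborel \<partial>lborel)"
    by (rule nn_integral_lborel_add) simp
  also have "\<dots> = (\<integral>\<^sup>+g. F g \<partial>lborel)"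
    by (simp add: nn_integral_lborel_pair)
  finally show ?thesis .
qed

lemma lborel_distr_hmult: "distr lborel borel ((\<diamondop>) a) = (lborel :: 'n::finite heis measure)"
proof (rule measure_eqI)
  fix A assume "A \<in> sets (distr lborel borel ((\<diamondop>) a))"
  then have [measurable]: "A \<in> sets borel" by simp
  show "emeasure (distr lborel borel ((\<diamondop>) a)) A = emeasure lborel A"
    using nn_integral_hmult[of "indicator A" a] nn_integral_distr[of "(\<diamondop>) a" lborel borel "indicator A"]
    by simp
qed simp

lemma lborel_distr_neg: "distr lborel borel uminus = (lborel :: 'a::euclidean_space measure)"
proof (rule measure_eqI)
  fix A assume "A \<in> sets (distr lborel borel (uminus :: 'a \<Rightarrow> 'a))"
  then have [measurable]: "A \<in> sets borel" by simp
  show "emeasure (distr lborel borel uminus) A = emeasure lborel A"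
    using nn_integral_lborel_neg[of "indicator A"] nn_integral_distr[of uminus lborel borel "indicator A"]
    by simp
qed simp

lemma
  fixes F :: "'n::finite heis \<Rightarrow> real"
  assumes [measurable]: "F \<in> borel_measurable borel"
  shows integrable_hmult_iff: "integrable lborel (\<lambda>g. F (a \<diamondop> g)) \<longleftrightarrow> integrable lborel F"
    and integral_hmult: "(\<integral>g. F (a \<diamondop> g) \<partial>lborel) = (\<integral>g. F g \<partial>lborel)"
    and integrable_neg_iff: "integrable lborel (\<lambda>g. F (- g)) \<longleftrightarrow> integrable lborel F"
    and integral_neg: "(\<integral>g. F (- g) \<partial>lborel) = (\<integral>g. F g \<partial>lborel)"
  using integrable_distr_eq[of "(\<diamondop>) a" lborel borel F] integral_distr[of "(\<diamondop>) a" lborel borel F]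
    integrable_distr_eq[of uminus lborel borel F] integral_distr[of uminus lborel borel F]
  by (simp_all add: lborel_distr_hmult lborel_distr_neg)

section \<open>Integrability of powers of the homogeneous norm\<close>

lemma emeasure_lborel_Times:
  "A \<in> sets borel \<Longrightarrow> B \<in> sets borel \<Longrightarrow>
    emeasure (lborel :: ('a::euclidean_space \<times> 'b::euclidean_space) measure) (A \<times> B) =
    emeasure lborel A * emeasure lborel B"
  unfolding lborel_prod[symmetric] by (intro lborel.emeasure_pair_measure_Times) auto

lemma term_le_suminf: "(f k :: ennreal) \<le> (\<Sum>k. f k)"
  using sum_le_suminf[of f "{k}"] by simp

text \<open>The ball lies in a box with radii \<open>R\<close>, \<open>R\<close> and
  \<open>R\<^sup>2\<close>. The quadratic vertical radius accounts for the summand 2 in the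
  homogeneous dimension.\<close>

lemma emeasure_hnorm_le:
  obtains C where "0 \<le> C"
    "\<And>R. 0 < R \<Longrightarrow> emeasure lborel {g :: 'n::finite heis. hnorm g \<le> R} \<le> ennreal (C * R powr hom_dim TYPE('n))"
proof
  define V where "V = unit_ball_vol (real CARD('n))"
  have V: "0 \<le> V" by (simp add: V_def)
  show "0 \<le> 2 * V\<^sup>2" by simp
  fix R :: real assume R: "0 < R"
  have "{g :: 'n heis. hnorm g \<le> R} \<subseteq> cball 0 R \<times> (cball 0 R \<times> cball 0 (R\<^sup>2))"
  proof safe
    fix x y :: "real^'n" and t :: real assume h: "hnorm (x, y, t) \<le> R"
    have "norm (x, y) \<le> R" using norm_fst_le_hnorm h by (rule order_trans)
    then show "x \<in> cball 0 R" "y \<in> cball 0 R"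
      using norm_fst_le[of x y] norm_snd_le[of y x] by simp_all
    have "t\<^sup>2 \<le> hnorm (x, y, t) ^ 4" by (simp add: hnorm_pow4)
    also have "\<dots> \<le> R ^ 4" using h by (intro power_mono) auto
    finally have "t\<^sup>2 \<le> (R\<^sup>2)\<^sup>2" by (simp flip: power_mult)
    then have "\<bar>t\<bar> \<le> \<bar>R\<^sup>2\<bar>" by (simp only: abs_le_square_iff)
    then show "t \<in> cball 0 (R\<^sup>2)" by simp
  qed
  then have "emeasure lborel {g :: 'n heis. hnorm g \<le> R} \<le>
      emeasure lborel (cball 0 R \<times> (cball 0 R \<times> cball 0 (R\<^sup>2)) :: 'n heis set)"
    by (intro emeasure_mono) (auto intro!: borel_closed closed_Times)
  also have "\<dots> = emeasure lborel (cball (0::real^'n) R) *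
      (emeasure lborel (cball (0::real^'n) R) * emeasure lborel (cball (0::real) (R\<^sup>2)))"
    by (simp add: emeasure_lborel_Times borel_closed closed_Times)
  also have "\<dots> = ennreal (V * R ^ CARD('n)) * (ennreal (V * R ^ CARD('n)) * ennreal (2 * R\<^sup>2))"
    using R by (simp add: emeasure_cball V_def unit_ball_vol_1)
  also have "\<dots> = ennreal (2 * V\<^sup>2 * R ^ (2 * CARD('n) + 2))"
  proof -
    have "R ^ (2 * CARD('n) + 2) = R ^ CARD('n) * R ^ CARD('n) * R\<^sup>2"
      by (simp only: power_add mult_2)
    then have "2 * V\<^sup>2 * R ^ (2 * CARD('n) + 2) = (V * R ^ CARD('n)) * ((V * R ^ CARD('n)) * (2 * R\<^sup>2))"
      by (simp only: power2_eq_square mult_ac)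
    moreover have "0 \<le> V * R ^ CARD('n)" "0 \<le> 2 * R\<^sup>2" using R V by simp_all
    ultimately show ?thesis by (simp only: ennreal_mult mult_nonneg_nonneg)
  qed
  also have "R ^ (2 * CARD('n) + 2) = R powr hom_dim TYPE('n)"
  proof -
    have "hom_dim TYPE('n) = real (2 * CARD('n) + 2)" by (simp add: hom_dim_def)
    then show ?thesis using R by (simp only: powr_realpow)
  qed
  finally show "emeasure lborel {g :: 'n heis. hnorm g \<le> R} \<le> ennreal (2 * V\<^sup>2 * R powr hom_dim TYPE('n))" .
qed

lemma hom_dim_pos: "0 < hom_dim TYPE('n::finite)"
  by (simp add: hom_dim_def add_pos_nonneg)

lemma suminf_powr_finite:
  assumes "0 < c" "0 \<le> A"
  shows "(\<Sum>k. ennreal (A * 2 powr (- real k * c))) < \<infinity>"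
proof -
  have "(2::real) powr (- real k * c) = (2 powr (-c)) ^ k" for k
    by (simp add: powr_power mult.commute)
  moreover have "(2::real) powr (-c) < 1"
    using assms powr_less_mono[of "-c" 0 "2::real"] by simp
  ultimately have "summable (\<lambda>k. A * 2 powr (- real k * c))"
    by (simp add: summable_geometric)
  then have "(\<Sum>k. ennreal (A * 2 powr (- real k * c))) \<noteq> top"
    by (rule ennreal_suminf_neq_top) (use assms in simp)
  then show ?thesis unfolding infinity_ennreal_def less_top .
qed

lemma nn_integral_indicator_suminf:
  assumes [measurable]: "\<And>k. A k \<in> sets M" and "\<And>k. emeasure M (A k) * c k \<le> d k"
  shows "(\<integral>\<^sup>+x. (\<Sum>k::nat. c k * indicator (A k) x) \<partial>M) \<le> (\<Sum>k. d k)"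
  using assms(2) by (subst nn_integral_suminf) (auto intro!: suminf_le simp: nn_integral_cmult mult.commute)

text \<open>Dyadic decomposition. Near the identity the weight contributes order \<open>b\<close>,
  more than the excess \<open>a\<close> of the singularity; far away the excess \<open>a\<close>
  itself gives convergence. Shells are replaced by full balls, which is harmless for an upper
  bound.\<close>

lemma nn_integral_hnorm_finite:
  assumes "0 < a" "a < b"
  shows "(\<integral>\<^sup>+g. ennreal (min 1 (hnorm g) powr b * hnorm g powr (- hom_dim TYPE('n) - a))
    \<partial>(lborel :: 'n::finite heis measure)) < \<infinity>" (is "(\<integral>\<^sup>+g. ?F g \<partial>_) < \<infinity>")
proof -
  define Q where "Q = hom_dim TYPE('n)"
  have Q: "0 < Q" by (simp add: Q_def hom_dim_pos)
  obtain C where C: "0 \<le> C"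
    "\<And>R. 0 < R \<Longrightarrow> emeasure lborel {g :: 'n heis. hnorm g \<le> R} \<le> ennreal (C * R powr Q)"
    using emeasure_hnorm_le[where 'n='n] unfolding Q_def by blast
  define A where "A k = {g :: 'n heis. hnorm g \<le> 2 powr (- real k)}" for k
  define B where "B k = {g :: 'n heis. hnorm g \<le> 2 powr (real k + 1)}" for k
  \<comment> \<open>\<open>c k\<close> bounds the integrand for \<open>hnorm g\<close> between
    \<open>2 powr (- (k + 1))\<close> and \<open>2 powr (- k)\<close>, and \<open>d k\<close> bounds
    it between \<open>2 powr k\<close> and \<open>2 powr (k + 1)\<close>. Times the volumes they
    leave the geometric terms \<open>2 powr (- k * (b - a))\<close> and
    \<open>2 powr (- k * a)\<close>.\<close>
  define c where "c k = ennreal (2 powr (- real k * b + (real k + 1) * (Q + a)))" for k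
  define d where "d k = ennreal (2 powr (- real k * (Q + a)))" for k
  have [measurable]: "A k \<in> sets borel" "B k \<in> sets borel" for k
    unfolding A_def B_def by measurable
  have Ac: "emeasure lborel (A k) * c k \<le> ennreal ((C * 2 powr (Q + a)) * 2 powr (- real k * (b - a)))" for k
  proof -
    have "emeasure lborel (A k) * c k \<le> ennreal (C * (2 powr (- real k)) powr Q) * c k"
      unfolding A_def by (intro mult_right_mono C) auto
    also have "\<dots> = ennreal (C * (2 powr (- real k)) powr Q * 2 powr (- real k * b + (real k + 1) * (Q + a)))"
      unfolding c_def using C(1) by (simp add: ennreal_mult)
    also have "C * (2 powr (- real k)) powr Q * 2 powr (- real k * b + (real k + 1) * (Q + a))
       = C * 2 powr (Q + a) * 2 powr (- real k * (b - a))"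
      by (simp add: powr_powr powr_add[symmetric] algebra_simps)
    finally show ?thesis .
  qed
  have Bd: "emeasure lborel (B k) * d k \<le> ennreal ((C * 2 powr Q) * 2 powr (- real k * a))" for k
  proof -
    have "emeasure lborel (B k) * d k \<le> ennreal (C * (2 powr (real k + 1)) powr Q) * d k"
      unfolding B_def by (intro mult_right_mono C) auto
    also have "\<dots> = ennreal (C * (2 powr (real k + 1)) powr Q * 2 powr (- real k * (Q + a)))"
      unfolding d_def using C(1) by (simp add: ennreal_mult)
    also have "C * (2 powr (real k + 1)) powr Q * 2 powr (- real k * (Q + a))
       = C * 2 powr Q * 2 powr (- real k * a)"
      by (simp add: powr_powr powr_add[symmetric] algebra_simps)
    finally show ?thesis .
  qed
  have le: "?F g \<le> (\<Sum>k. c k * indicator (A k) g) + (\<Sum>k. d k * indicator (B k) g)" for g :: "'n heis"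
  proof -
    define x where "x = hnorm g"
    consider "x = 0" | "0 < x" "x \<le> 1" | "1 < x" using hnorm_nonneg[of g] unfolding x_def by linarith
    then show ?thesis
    proof cases
      \<comment> \<open>At the identity the integrand is 0, because \<open>0 powr _\<close> is
        0.\<close>
      case 1 then show ?thesis by (simp add: x_def)
    next
      case 2
      define k where "k = nat \<lfloor>- log 2 x\<rfloor>"
      have "0 \<le> - log 2 x" using 2 by simp
      then have k: "real k \<le> - log 2 x" "- log 2 x < real k + 1"
        unfolding k_def by linarith+
      have xk: "x \<le> 2 powr (- real k)" "2 powr (- (real k + 1)) \<le> x"
        using k 2 powr_le_iff[of 2 x] le_powr_iff  
        by (simp_all add: le_powr_iff powr_le_iff less_imp_le)
      have "?F g = ennreal (x powr b * x powr (- Q - a))"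
        using 2 by (simp add: x_def Q_def min_def)
      also have "\<dots> \<le> ennreal ((2 powr (- real k)) powr b * (2 powr (- (real k + 1))) powr (- Q - a))"
        using xk 2 Q assms by (intro ennreal_leI mult_mono powr_mono2 powr_mono2') auto
      also have "\<dots> = c k * indicator (A k) g"
        using xk by (simp add: c_def A_def x_def powr_powr algebra_simps flip: powr_add)
      also have "\<dots> \<le> (\<Sum>k. c k * indicator (A k) g)"
        by (rule term_le_suminf[of "\<lambda>k. c k * indicator (A k) g"])
      finally show ?thesis by (rule order_trans) simp
    next
      case 3
      define k where "k = nat \<lfloor>log 2 x\<rfloor>"
      have "0 \<le> log 2 x" using 3 by simp
      then have k: "real k \<le> log 2 x" "log 2 x < real k + 1"
        unfolding k_def by linarith+
      have xk: "2 powr (real k) \<le> x" "x \<le> 2 powr (real k + 1)"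
        using k 3 by (simp_all add: le_powr_iff powr_le_iff less_imp_le)
      have "?F g = ennreal (x powr (- Q - a))"
        using 3 by (simp add: x_def Q_def min_def)
      also have "\<dots> \<le> ennreal ((2 powr (real k)) powr (- Q - a))"
        using xk 3 Q assms by (intro ennreal_leI powr_mono2') auto
      also have "\<dots> = d k * indicator (B k) g"
        using xk by (simp add: d_def B_def x_def powr_powr algebra_simps)
      also have "\<dots> \<le> (\<Sum>k. d k * indicator (B k) g)"
        by (rule term_le_suminf[of "\<lambda>k. d k * indicator (B k) g"])
      finally show ?thesis by (rule order_trans) simp
    qed
  qed
  have "(\<integral>\<^sup>+g. ?F g \<partial>lborel) \<le> (\<integral>\<^sup>+g. (\<Sum>k. c k * indicator (A k) g) + (\<Sum>k. d k * indicator (B k) g) \<partial>lborel)"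
    by (intro nn_integral_mono le)
  also have "\<dots> = (\<integral>\<^sup>+g. (\<Sum>k. c k * indicator (A k) g) \<partial>lborel) + (\<integral>\<^sup>+g. (\<Sum>k. d k * indicator (B k) g) \<partial>lborel)"
    by (intro nn_integral_add) measurable
  also have "\<dots> \<le> (\<Sum>k. ennreal ((C * 2 powr (Q + a)) * 2 powr (- real k * (b - a)))) +
      (\<Sum>k. ennreal ((C * 2 powr Q) * 2 powr (- real k * a)))"
    using Ac Bd by (intro add_mono nn_integral_indicator_suminf) auto
  also have "\<dots> < \<infinity>"
  proof -
    have "(\<Sum>k. ennreal ((C * 2 powr (Q + a)) * 2 powr (- real k * (b - a)))) < \<infinity>"
      "(\<Sum>k. ennreal ((C * 2 powr Q) * 2 powr (- real k * a))) < \<infinity>"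
      by (rule suminf_powr_finite; use assms C(1) in simp)+
    then show ?thesis unfolding infinity_ennreal_def ennreal_add_less_top by blast
  qed
  finally show ?thesis .
qed

section \<open>The function \<open>a \<mapsto> |a|\<^sup>p\<^sup>-\<^sup>2 a\<close>\<close>

lemma signed_pow_nonneg: "0 \<le> a \<Longrightarrow> signed_pow p a = a powr (p - 1)"
  using powr_add[of a "p - 2" 1] by (cases "a = 0") (auto simp: signed_pow_def)

lemma signed_pow_minus: "signed_pow p (- a) = - signed_pow p a"
  by (simp add: signed_pow_def)

lemma abs_signed_pow: "\<bar>signed_pow p a\<bar> = \<bar>a\<bar> powr (p - 1)"
  using signed_pow_nonneg[of a p] signed_pow_nonneg[of "- a" p]
  by (cases "0 \<le> a") (auto simp: signed_pow_minus simp flip: abs_minus_cancel[of "signed_pow p a"])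

lemma signed_pow_measurable [measurable]: "signed_pow p \<in> borel_measurable borel"
  unfolding signed_pow_def by measurable

lemma signed_pow_eq: "signed_pow p a = sgn a * \<bar>a\<bar> powr (p - 1)"
  using signed_pow_nonneg[of a p] signed_pow_nonneg[of "- a" p]
  by (cases "0 < a"; cases "a = 0") (auto simp: signed_pow_minus)

lemma signed_pow_mult_self: "signed_pow p a * a = \<bar>a\<bar> powr p"
  using powr_add[of "\<bar>a\<bar>" "p - 1" 1]
  by (cases "a = 0") (auto simp: signed_pow_eq sgn_if)

lemma signed_pow_mono:
  assumes "1 < p" "a \<le> b" shows "signed_pow p a \<le> signed_pow p b"
proof -
  consider "0 \<le> a" | "a < 0" "0 \<le> b" | "b < 0" using assms by linarith
  then show ?thesis
  proof cases
    case 1 then show ?thesis using assms by (simp add: signed_pow_nonneg powr_mono2)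
  next
    case 2
    then have "signed_pow p a \<le> 0" "0 \<le> signed_pow p b" by (simp_all add: signed_pow_eq sgn_if)
    then show ?thesis by (rule order_trans)
  next
    case 3 then show ?thesis using assms by (simp add: signed_pow_eq powr_mono2)
  qed
qed

lemma isCont_signed_pow:
  assumes "1 < p" shows "isCont (signed_pow p) a"
proof (cases "a = 0")
  case True
  have "((\<lambda>x. \<bar>x\<bar> powr (p - 1)) \<longlongrightarrow> \<bar>0\<bar> powr (p - 1)) (at (0::real))"
    using assms by (intro tendsto_powr2 tendsto_intros) auto
  then have "(signed_pow p \<longlongrightarrow> 0) (at 0)"
    by (subst tendsto_rabs_zero_iff[symmetric]) (simp add: abs_signed_pow)
  then show ?thesis using True by (simp add: isCont_def signed_pow_def)
next
  case False
  then show ?thesis unfolding signed_pow_def by (intro continuous_intros) auto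
qed

lemma abs_signed_pow_le: "1 < p \<Longrightarrow> \<bar>a\<bar> \<le> M \<Longrightarrow> \<bar>signed_pow p a\<bar> \<le> M powr (p - 1)"
  by (simp add: abs_signed_pow powr_mono2)

text \<open>Mean value theorem. The cases \<open>a = 0\<close> and \<open>a = b\<close> are separate
  because the derivative of the power needs a positive base and the theorem a proper
  interval.\<close>

lemma powr_diff_le:
  fixes a b q :: real
  assumes "0 \<le> a" "a \<le> b" "1 \<le> q"
  shows "b powr q - a powr q \<le> q * b powr (q - 1) * (b - a)"
proof (cases "a = 0 \<or> a = b")
  case True
  have "b powr q = b powr (q - 1) * b" using powr_add[of b "q - 1" 1] assms by (cases "b = 0") auto
  moreover have "1 * (b powr (q - 1) * b) \<le> q * (b powr (q - 1) * b)"
    using assms by (intro mult_right_mono) auto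
  ultimately show ?thesis using True by (auto simp: mult.assoc)
next
  case False
  then have ab: "0 < a" "a < b" using assms by auto
  have "\<exists>z>a. z < b \<and> b powr q - a powr q = (b - a) * (q * z powr (q - 1))"
    using ab by (intro MVT2) (auto intro!: derivative_eq_intros simp: powr_diff divide_simps)
  then obtain z where z: "a < z" "z < b" "b powr q - a powr q = (b - a) * (q * z powr (q - 1))"
    by blast
  have "(b - a) * (q * z powr (q - 1)) \<le> (b - a) * (q * b powr (q - 1))"
    using z ab assms by (intro mult_left_mono powr_mono2) auto
  then show ?thesis using z(3) by (simp add: mult_ac)
qed

text \<open>One factor \<open>x + y\<close> is split off and distributed. Since \<open>q - 1\<close>
  is not positive, the remaining factor \<open>(x + y) powr (q - 1)\<close> is at most
  \<open>x powr (q - 1)\<close> and \<open>y powr (q - 1)\<close>.\<close>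

lemma powr_add_le:
  fixes x y q :: real
  assumes "0 \<le> x" "0 \<le> y" "0 < q" "q \<le> 1"
  shows "(x + y) powr q \<le> x powr q + y powr q"
proof (cases "x = 0 \<or> y = 0")
  case False
  then have xy: "0 < x" "0 < y" using assms by auto
  have *: "z * (x + y) powr (q - 1) \<le> z powr q" if "0 < z" "z \<le> x + y" for z
  proof -
    have "z * (x + y) powr (q - 1) \<le> z * z powr (q - 1)"
      using that assms by (intro mult_left_mono powr_mono2') auto
    also have "\<dots> = z powr q" using powr_add[of z "q - 1" 1] that by (simp add: mult.commute)
    finally show ?thesis .
  qed
  have "(x + y) powr q = x * (x + y) powr (q - 1) + y * (x + y) powr (q - 1)"
    using powr_add[of "x + y" "q - 1" 1] xy by (simp add: algebra_simps)
  then show ?thesis using *[of x] *[of y] xy by simp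
qed (use assms in auto)

text \<open>For p \<ge> 2 the derivative on the interval is of size \<open>L powr (p - 2)\<close>.
  For p < 2 the derivative is singular at 0, and subadditivity of powers gives Hoelder continuity of
  exponent \<open>p - 1\<close> instead.\<close>

lemma signed_pow_diff_le:
  assumes "1 < p" "\<bar>a\<bar> \<le> L" "\<bar>b\<bar> \<le> L"
  shows "2 \<le> p \<Longrightarrow> \<bar>signed_pow p a - signed_pow p b\<bar> \<le> p * L powr (p - 2) * \<bar>a - b\<bar>"
    and "p < 2 \<Longrightarrow> \<bar>signed_pow p a - signed_pow p b\<bar> \<le> 2 * \<bar>a - b\<bar> powr (p - 1)"
proof -
  \<comment> \<open>Symmetry and oddness reduce both estimates to ordered nonnegative arguments or
    to arguments of opposite sign.\<close>
  have split: "P a b" if sym: "\<And>a b. P a b \<Longrightarrow> P b a" and neg: "\<And>a b. P a b \<Longrightarrow> P (- a) (- b)"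
    and pos: "\<And>a b. 0 \<le> a \<Longrightarrow> a \<le> b \<Longrightarrow> b \<le> L \<Longrightarrow> P a b"
    and opp: "\<And>a b. a \<le> 0 \<Longrightarrow> 0 \<le> b \<Longrightarrow> \<bar>a\<bar> \<le> L \<Longrightarrow> b \<le> L \<Longrightarrow> P a b" for P :: "real \<Rightarrow> real \<Rightarrow> bool"
  proof -
    have *: "P a b" if "a \<le> b" "\<bar>a\<bar> \<le> L" "\<bar>b\<bar> \<le> L" for a b
    proof -
      consider "0 \<le> a" | "a \<le> 0" "0 \<le> b" | "b \<le> 0" using that by linarith
      then show ?thesis
      proof cases
        case 3
        then have "P (- b) (- a)" using that by (intro pos) auto
        then show ?thesis using neg sym by fastforce
      qed (use that pos opp in auto)
    qed
    show ?thesis using *[of a b] *[of b a] sym assms by (cases "a \<le> b") auto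
  qed
  show "\<bar>signed_pow p a - signed_pow p b\<bar> \<le> p * L powr (p - 2) * \<bar>a - b\<bar>" if p: "2 \<le> p"
  proof (rule split)
    fix a b :: real assume ab: "0 \<le> a" "a \<le> b" "b \<le> L"
    have "b powr (p - 1) - a powr (p - 1) \<le> (p - 1) * b powr (p - 2) * (b - a)"
      using powr_diff_le[of a b "p - 1"] ab p by simp
    also have "\<dots> \<le> p * L powr (p - 2) * (b - a)"
      using ab p order_trans[of 0 a b] by (intro mult_right_mono mult_mono powr_mono2) auto
    moreover have "a powr (p - 1) \<le> b powr (p - 1)" using ab p by (intro powr_mono2) auto
    ultimately show "\<bar>signed_pow p a - signed_pow p b\<bar> \<le> p * L powr (p - 2) * \<bar>a - b\<bar>"
      using ab by (simp add: signed_pow_nonneg abs_if)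
  next
    fix a b :: real assume ab: "a \<le> 0" "0 \<le> b" "\<bar>a\<bar> \<le> L" "b \<le> L"
    have le: "\<bar>signed_pow p c\<bar> \<le> L powr (p - 2) * \<bar>c\<bar>" if "\<bar>c\<bar> \<le> L" for c
      using that p by (auto simp: signed_pow_def abs_mult intro!: mult_right_mono powr_mono2)
    have "\<bar>signed_pow p a - signed_pow p b\<bar> \<le> L powr (p - 2) * \<bar>a\<bar> + L powr (p - 2) * \<bar>b\<bar>"
      using le[of a] le[of b] ab by linarith
    also have "\<dots> = 1 * L powr (p - 2) * \<bar>a - b\<bar>" using ab by (simp add: algebra_simps abs_if)
    also have "\<dots> \<le> p * L powr (p - 2) * \<bar>a - b\<bar>"
      using p by (intro mult_right_mono) auto
    finally show "\<bar>signed_pow p a - signed_pow p b\<bar> \<le> p * L powr (p - 2) * \<bar>a - b\<bar>" .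
  qed (simp_all add: signed_pow_minus abs_minus_commute)
  show "\<bar>signed_pow p a - signed_pow p b\<bar> \<le> 2 * \<bar>a - b\<bar> powr (p - 1)" if p: "p < 2"
  proof (rule split)
    fix a b :: real assume ab: "0 \<le> a" "a \<le> b" "b \<le> L"
    have "b powr (p - 1) \<le> (b - a) powr (p - 1) + a powr (p - 1)"
      using powr_add_le[of "b - a" a "p - 1"] ab p assms by simp
    moreover have "a powr (p - 1) \<le> b powr (p - 1)" using ab assms by (intro powr_mono2) auto
    moreover have "0 \<le> (b - a) powr (p - 1)" by simp
    ultimately show "\<bar>signed_pow p a - signed_pow p b\<bar> \<le> 2 * \<bar>a - b\<bar> powr (p - 1)"
      using ab by (simp add: signed_pow_nonneg abs_if)
  next
    fix a b :: real assume ab: "a \<le> 0" "0 \<le> b" "\<bar>a\<bar> \<le> L" "b \<le> L"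
    have "\<bar>signed_pow p a\<bar> \<le> \<bar>a - b\<bar> powr (p - 1)" "\<bar>signed_pow p b\<bar> \<le> \<bar>a - b\<bar> powr (p - 1)"
      using ab assms by (auto simp: abs_signed_pow intro!: powr_mono2)
    then show "\<bar>signed_pow p a - signed_pow p b\<bar> \<le> 2 * \<bar>a - b\<bar> powr (p - 1)" by linarith
  qed (simp_all add: signed_pow_minus abs_minus_commute)
qed

text \<open>Here \<open>a\<close> and \<open>b\<close> are the increments of a smooth function along
  \<open>g\<close> and \<open>- g\<close>: each is of first order, while in the sum the first order
  cancels. Comparing the nonlinearity at \<open>a\<close> and at \<open>- b\<close> gives
  \<rho>^(p-2) \<rho>^2 for p \<ge> 2 and (\<rho>^2)^(p-1) for p < 2; the minimum selects the right
  one.\<close>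

lemma signed_pow_second_difference:
  assumes "1 < p" "0 \<le> L"
  obtains C where "0 \<le> C" "\<And>a b \<rho>. 0 < \<rho> \<Longrightarrow> \<rho> \<le> 1 \<Longrightarrow> \<bar>a\<bar> \<le> L * \<rho> \<Longrightarrow> \<bar>b\<bar> \<le> L * \<rho> \<Longrightarrow> \<bar>a + b\<bar> \<le> L * \<rho>\<^sup>2 \<Longrightarrow>
     \<bar>signed_pow p a + signed_pow p b\<bar> \<le> C * \<rho> powr min p (2 * p - 2)"
proof (cases "2 \<le> p")
  case True
  show ?thesis
  proof
    show "0 \<le> p * L powr (p - 2) * L" using assms by simp
    fix a b \<rho> :: real
    assume \<rho>: "0 < \<rho>" "\<rho> \<le> 1" and ab: "\<bar>a\<bar> \<le> L * \<rho>" "\<bar>b\<bar> \<le> L * \<rho>" "\<bar>a + b\<bar> \<le> L * \<rho>\<^sup>2"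
    have "\<bar>signed_pow p a + signed_pow p b\<bar> \<le> p * (L * \<rho>) powr (p - 2) * \<bar>a + b\<bar>"
      using signed_pow_diff_le(1)[of p a "L * \<rho>" "- b"] assms ab True by (simp add: signed_pow_minus)
    also have "\<dots> \<le> p * (L * \<rho>) powr (p - 2) * (L * \<rho>\<^sup>2)"
      using ab assms by (intro mult_left_mono) auto
    also have "\<dots> = p * L powr (p - 2) * L * (\<rho> powr (p - 2) * \<rho> powr 2)"
      using \<rho> assms by (simp add: powr_mult powr_realpow[of \<rho> 2, simplified])
    also have "\<rho> powr (p - 2) * \<rho> powr 2 = \<rho> powr min p (2 * p - 2)"
      using True by (simp add: min_def flip: powr_add)
    finally show "\<bar>signed_pow p a + signed_pow p b\<bar> \<le> p * L powr (p - 2) * L * \<rho> powr min p (2 * p - 2)" .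
  qed
next
  case False
  show ?thesis
  proof
    show "0 \<le> 2 * L powr (p - 1)" by simp
    fix a b \<rho> :: real
    assume \<rho>: "0 < \<rho>" "\<rho> \<le> 1" and ab: "\<bar>a\<bar> \<le> L * \<rho>" "\<bar>b\<bar> \<le> L * \<rho>" "\<bar>a + b\<bar> \<le> L * \<rho>\<^sup>2"
    have "\<bar>signed_pow p a + signed_pow p b\<bar> \<le> 2 * \<bar>a + b\<bar> powr (p - 1)"
      using signed_pow_diff_le(2)[of p a "L * \<rho>" "- b"] assms ab False by (simp add: signed_pow_minus)
    also have "\<dots> \<le> 2 * (L * \<rho>\<^sup>2) powr (p - 1)"
      using ab assms by (intro mult_left_mono powr_mono2) auto
    also have "\<dots> = 2 * L powr (p - 1) * \<rho> powr min p (2 * p - 2)"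
      using \<rho> assms False powr_powr[of \<rho> 2 "p - 1"]
      by (simp add: powr_mult powr_realpow[of \<rho> 2, simplified] min_def algebra_simps)
    finally show "\<bar>signed_pow p a + signed_pow p b\<bar> \<le> 2 * L powr (p - 1) * \<rho> powr min p (2 * p - 2)" .
  qed
qed

text \<open>If \<open>y \<le> e * x\<close>, the first term alone suffices; otherwise
  \<open>x\<close> is below \<open>y / e\<close> and the second term does.\<close>

lemma powr_mult_le_young:
  fixes x y e p :: real
  assumes "0 \<le> x" "0 \<le> y" "0 < e" "1 < p"
  shows "x powr (p - 1) * y \<le> e * x powr p + e powr (1 - p) * y powr p"
proof (cases "y \<le> e * x")
  case True
  have "x powr (p - 1) * y \<le> x powr (p - 1) * (e * x)"
    using True by (intro mult_left_mono) auto
  also have "\<dots> = e * x powr p"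
    using powr_add[of x "p - 1" 1] assms by (cases "x = 0") auto
  finally show ?thesis by (smt (verit) mult_nonneg_nonneg powr_ge_zero)
next
  case False
  then have y: "0 < y" "x \<le> y / e" using assms
    by (auto simp: field_simps) (smt (verit) mult_nonneg_nonneg)
  have "x powr (p - 1) * y \<le> (y / e) powr (p - 1) * y"
    using y assms by (intro mult_right_mono powr_mono2) auto
  also have "\<dots> = e powr (1 - p) * y powr p"
    using powr_add[of y "p - 1" 1] y assms by (simp add: powr_divide powr_minus_divide[of e "p - 1", simplified])
  finally show ?thesis using assms by (smt (verit) mult_nonneg_nonneg powr_ge_zero)
qed

text \<open>The algebraic core of the energy estimate: testing with
  \<open>a * \<alpha> powr p\<close> controls the localised increments up to the increments of the
  cutoff. With \<open>b \<le> a\<close> by symmetry, the signs are favourable when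
  \<open>\<beta> \<le> \<alpha>\<close>. Otherwise the loss is proportional to
  \<open>\<beta> powr p - \<alpha> powr p\<close>, which the mean value bound and Young's inequality
  absorb.\<close>

lemma caccioppoli_pointwise:
  fixes a b \<alpha> \<beta> p :: real
  assumes p: "1 < p" and "0 \<le> a" "0 \<le> b" "0 \<le> \<alpha>" "0 \<le> \<beta>"
  shows "\<bar>a - b\<bar> powr p * (max \<alpha> \<beta>) powr p \<le>
     2 * (signed_pow p (a - b) * (a * \<alpha> powr p - b * \<beta> powr p))
     + 2 * (2 * p) powr (p - 1) * p * (max a b) powr p * \<bar>\<alpha> - \<beta>\<bar> powr p"
proof -
  let ?G = "\<lambda>a b \<alpha> \<beta>. \<bar>a - b\<bar> powr p * (max \<alpha> \<beta>) powr p \<le>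
     2 * (signed_pow p (a - b) * (a * \<alpha> powr p - b * \<beta> powr p))
     + 2 * (2 * p) powr (p - 1) * p * (max a b) powr p * \<bar>\<alpha> - \<beta>\<bar> powr p"
  have main: "?G a b \<alpha> \<beta>" if ab: "b \<le> a" and nn: "0 \<le> a" "0 \<le> b" "0 \<le> \<alpha>" "0 \<le> \<beta>" for a b \<alpha> \<beta>
  proof -
    define d where "d = a - b"
    have d: "0 \<le> d" using ab by (simp add: d_def)
    have Jd: "signed_pow p d * d = d powr p" using d signed_pow_mult_self[of p d] by simp
    have J: "signed_pow p d = d powr (p - 1)" using d by (simp add: signed_pow_nonneg)
    show ?thesis
    proof (cases "\<beta> \<le> \<alpha>")
      case True
      have "d * \<alpha> powr p \<le> a * \<alpha> powr p - b * \<beta> powr p"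
        using True nn p by (simp add: d_def algebra_simps mult_left_mono powr_mono2)
      then have "d powr p * \<alpha> powr p \<le> signed_pow p d * (a * \<alpha> powr p - b * \<beta> powr p)"
        unfolding Jd[symmetric] mult.assoc by (intro mult_left_mono) (auto simp: J)
      moreover have "0 \<le> d powr p * \<alpha> powr p" by simp
      moreover have "0 \<le> 2 * (2 * p) powr (p - 1) * p * (max a b) powr p * \<bar>\<alpha> - \<beta>\<bar> powr p" using p by simp
      ultimately have "d powr p * \<alpha> powr p \<le> 2 * (signed_pow p d * (a * \<alpha> powr p - b * \<beta> powr p)) +
          2 * (2 * p) powr (p - 1) * p * (max a b) powr p * \<bar>\<alpha> - \<beta>\<bar> powr p" by linarith
      then show ?thesis using True d by (simp only: max_absorb1 d_def[symmetric] abs_of_nonneg)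
    next
      case False
      then have fb: "\<alpha> \<le> \<beta>" by simp
      define X where "X = d * \<beta>" define Y where "Y = a * (\<beta> - \<alpha>)"
      have XY: "0 \<le> X" "0 \<le> Y" using d fb nn by (auto simp: X_def Y_def)
      have "signed_pow p d * (a * \<alpha> powr p - b * \<beta> powr p) =
          d powr p * \<beta> powr p - a * d powr (p - 1) * (\<beta> powr p - \<alpha> powr p)"
        unfolding Jd[symmetric] J by (simp add: d_def algebra_simps)
      also have "\<dots> \<ge> d powr p * \<beta> powr p - a * d powr (p - 1) * (p * \<beta> powr (p - 1) * (\<beta> - \<alpha>))"
        using fb nn p by (intro diff_left_mono mult_left_mono powr_diff_le) auto
      moreover have "a * d powr (p - 1) * (p * \<beta> powr (p - 1) * (\<beta> - \<alpha>)) = p * (X powr (p - 1) * Y)"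
        using d nn by (simp add: X_def Y_def powr_mult)
      moreover have "d powr p * \<beta> powr p = X powr p" using d nn by (simp add: X_def powr_mult)
      \<comment> \<open>The parameter \<open>1 / (2 * p)\<close> makes the absorbed term exactly
        half of \<open>X powr p\<close>. Hence the overall factor 2 and the constant
        \<open>(2 * p) powr (p - 1) * p\<close> in the statement.\<close>
      moreover have "p * (X powr (p - 1) * Y) \<le> p * (1 / (2 * p) * X powr p + (1 / (2 * p)) powr (1 - p) * Y powr p)"
        using powr_mult_le_young[of X Y "1 / (2 * p)" p] XY p by (intro mult_left_mono) auto
      moreover have "p * (1 / (2 * p) * X powr p + (1 / (2 * p)) powr (1 - p) * Y powr p) =
         X powr p / 2 + p * (2 * p) powr (p - 1) * Y powr p"
        using p powr_minus_divide[of "2 * p" "p - 1"] by (simp add: field_simps powr_divide)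
      ultimately have "X powr p / 2 \<le> signed_pow p d * (a * \<alpha> powr p - b * \<beta> powr p)
         + p * (2 * p) powr (p - 1) * Y powr p" by linarith
      moreover have "Y powr p = a powr p * \<bar>\<alpha> - \<beta>\<bar> powr p" using fb nn by (simp add: Y_def powr_mult)
      moreover have "\<bar>a - b\<bar> powr p * (max \<alpha> \<beta>) powr p = X powr p"
        using d nn fb by (simp add: X_def powr_mult max_def d_def)
      ultimately show ?thesis using ab by (simp add: max_def d_def[symmetric] mult_ac)
    qed
  qed
  show ?thesis
  proof (cases "b \<le> a")
    case True then show ?thesis using main assms by blast
  next
    case False
    then have "?G b a \<beta> \<alpha>" using assms by (intro main) auto
    moreover have "signed_pow p (b - a) * (b * \<beta> powr p - a * \<alpha> powr p) =
      signed_pow p (a - b) * (a * \<alpha> powr p - b * \<beta> powr p)"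
      using signed_pow_minus[of p "a - b"] by (simp add: algebra_simps)
    ultimately show ?thesis by (simp add: max.commute abs_minus_commute)
  qed
qed

section \<open>The kernel\<close>

locale heis_kernel =
  fixes s p lam Lam :: real and K :: "'n::finite heis \<Rightarrow> 'n heis \<Rightarrow> real"
  assumes s: "0 < s" "s < 1" and p: "1 < p" "p > 2 / (2 - s)"
    and lam: "0 < lam" "lam \<le> Lam"
    and kernel: "nonlocal_kernel s p lam Lam K"
begin


text \<open>By left invariance \<open>K\<close> depends on the increment
  \<open>(- \<eta>) \<diamondop> \<xi>\<close> alone, and \<open>k\<close> is this profile. Its
  value 0 at the identity replaces the unspecified diagonal values of \<open>K\<close>; sign,
  evenness and both ellipticity bounds then hold everywhere, as \<open>0 powr _\<close> is
  0.\<close>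

definition k :: "'n heis \<Rightarrow> real" where "k g = (if g = 0 then 0 else K g 0)"

lemma K_eq: "\<xi> \<noteq> \<eta> \<Longrightarrow> K \<xi> \<eta> = k ((- \<eta>) \<diamondop> \<xi>)"
proof -
  assume ne: "\<xi> \<noteq> \<eta>"
  then have "K ((- \<eta>) \<diamondop> \<xi>) ((- \<eta>) \<diamondop> \<eta>) = K \<xi> \<eta>"
    using kernel unfolding nonlocal_kernel_def by blast
  moreover have "(- \<eta>) \<diamondop> \<xi> \<noteq> 0" using ne by (simp add: neg_hmult_eq_0_iff)
  ultimately show ?thesis by (simp add: k_def)
qed

lemma k_neg [simp]: "k (- g) = k g"
proof (cases "g = 0")
  case False
  then have "K 0 g = K g 0" using kernel unfolding nonlocal_kernel_def by metis
  then show ?thesis using K_eq[of 0 g] False by (simp add: k_def)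
qed simp

lemma k_nonneg [simp]: "0 \<le> k g"
proof (cases "g = 0")
  case False
  then have "0 < K g 0" using kernel unfolding nonlocal_kernel_def by blast
  then show ?thesis by (simp add: k_def)
qed (simp add: k_def)

lemma k_zero [simp]: "k 0 = 0"
  by (simp add: k_def)

lemma k_le: "k g \<le> Lam * hnorm g powr (- hom_dim TYPE('n) - s * p)"
proof (cases "g = 0")
  case False
  then have "K g 0 \<le> Lam * hnorm ((- 0) \<diamondop> g) powr (- hom_dim TYPE('n) - s * p)"
    using kernel unfolding nonlocal_kernel_def by blast
  then show ?thesis using False by (simp add: k_def)
qed simp

lemma k_ge: "lam * hnorm g powr (- hom_dim TYPE('n) - s * p) \<le> k g"
proof (cases "g = 0")
  case False
  then have "lam * hnorm ((- 0) \<diamondop> g) powr (- hom_dim TYPE('n) - s * p) \<le> K g 0"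
    using kernel unfolding nonlocal_kernel_def by blast
  then show ?thesis using False by (simp add: k_def)
qed simp

lemma continuous_k: "continuous_on (- {0}) k"
proof -
  have "continuous_on (- {0}) (\<lambda>g. K g 0)"
    using kernel unfolding nonlocal_kernel_def by blast
  then show ?thesis by (rule continuous_on_eq) (simp add: k_def)
qed

lemma k_measurable [measurable]: "k \<in> borel_measurable borel"
proof -
  have "(\<lambda>g. if g \<in> - {0} then k g else 0) \<in> borel_measurable borel"
    by (intro borel_measurable_continuous_on_if continuous_k) auto
  moreover have "(\<lambda>g. if g \<in> - {0} then k g else 0) = k" by (auto simp: fun_eq_iff)
  ultimately show ?thesis by simp
qed

lemma sp_pos: "0 < s * p"
  using s p by simp

text \<open>A zero of order \<open>b\<close> above sp compensates the singularity at the identity,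
  and boundedness is enough at infinity.\<close>

lemma integrable_k:
  assumes [measurable]: "F \<in> borel_measurable borel"
    and b: "s * p < b" and F: "\<And>g. \<bar>F g\<bar> \<le> C * min 1 (hnorm g) powr b"
  shows "integrable lborel (\<lambda>g. F g * k g)"
proof (rule integrableI_bounded)
  show "(\<lambda>g. F g * k g) \<in> borel_measurable lborel" by simp
  \<comment> \<open>The sign of \<open>C\<close> is read off from the bound at one point different
    from the identity.\<close>
  have "0 \<le> C * min 1 (hnorm ((1, 1, 1) :: 'n heis)) powr b"
    using F[of "(1, 1, 1)"] abs_ge_zero[of "F (1, 1, 1)"] by (rule order_trans[rotated])
  moreover have "0 < min 1 (hnorm ((1, 1, 1) :: 'n heis)) powr b"
  proof -
    have "0 < hnorm ((1, 1, 1) :: 'n heis)" by (simp add: zero_prod_def)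
    then show ?thesis by (simp add: min_def)
  qed
  ultimately have C: "0 \<le> C" by (simp add: zero_le_mult_iff)
  let ?G = "\<lambda>g :: 'n heis. min 1 (hnorm g) powr b * hnorm g powr (- hom_dim TYPE('n) - s * p)"
  have le: "norm (F g * k g) \<le> (C * Lam) * ?G g" for g
  proof -
    have "norm (F g * k g) = \<bar>F g\<bar> * k g" by (simp add: abs_mult)
    also have "\<dots> \<le> (C * min 1 (hnorm g) powr b) * (Lam * hnorm g powr (- hom_dim TYPE('n) - s * p))"
      using C by (intro mult_mono F k_le) auto
    finally show ?thesis by (simp add: mult_ac)
  qed
  have "(\<integral>\<^sup>+g. ennreal (norm (F g * k g)) \<partial>lborel) \<le> (\<integral>\<^sup>+g. ennreal ((C * Lam) * ?G g) \<partial>lborel)"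
    by (intro nn_integral_mono ennreal_leI le)
  also have "\<dots> = (\<integral>\<^sup>+g. ennreal (C * Lam) * ennreal (?G g) \<partial>lborel)"
    using C lam by (simp add: ennreal_mult)
  also have "\<dots> = ennreal (C * Lam) * (\<integral>\<^sup>+g. ennreal (?G g) \<partial>lborel)"
    by (intro nn_integral_cmult) measurable
  also have "\<dots> < \<infinity>"
    using nn_integral_hnorm_finite[OF sp_pos b, where 'n='n] by (simp add: ennreal_mult_less_top)
  finally show "(\<integral>\<^sup>+g. ennreal (norm (F g * k g)) \<partial>lborel) < \<infinity>" .
qed

text \<open>Away from the identity a bounded function is below a multiple of
  \<open>min 1 (hnorm g) powr (s * p + 1)\<close>, an arbitrary order above sp.\<close>

lemma integrable_k_away:
  assumes [measurable]: "F \<in> borel_measurable borel"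
    and F: "\<And>g. \<bar>F g\<bar> \<le> C" "\<And>g. hnorm g < \<tau> \<Longrightarrow> F g = 0" and \<tau>: "0 < \<tau>"
  shows "integrable lborel (\<lambda>g. F g * k g)"
proof (rule integrable_k)
  fix g
  define m where "m = min 1 \<tau>"
  have m: "0 < m" using \<tau> by (simp add: m_def)
  show "\<bar>F g\<bar> \<le> (C / m powr (s * p + 1)) * min 1 (hnorm g) powr (s * p + 1)"
  proof (cases "hnorm g < \<tau>")
    case True
    moreover have "0 \<le> C" using F(1)[of g] by linarith
    ultimately show ?thesis using F(2) by simp
  next
    case False
    have "C * m powr (s * p + 1) \<le> C * min 1 (hnorm g) powr (s * p + 1)"
      using False m F(1)[of g] sp_pos by (intro mult_left_mono powr_mono2) (auto simp: m_def)
    then have "C \<le> (C / m powr (s * p + 1)) * min 1 (hnorm g) powr (s * p + 1)"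
      using m by (simp add: field_simps)
    then show ?thesis using F(1)[of g] by linarith
  qed
qed auto

lemma small_ball_integral:
  assumes b: "s * p < b" and e: "0 < e"
  obtains r where "0 < r" "(\<integral>g. indicator {g. hnorm g < r} g * min 1 (hnorm g) powr b * k g \<partial>lborel) < e"
proof -
  let ?F = "\<lambda>r g. indicator {g. hnorm g < r} g * min 1 (hnorm g) powr b"
  define r where "r j = inverse (real (Suc j))" for j
  have r0: "r \<longlonglongrightarrow> 0" unfolding r_def by (rule LIMSEQ_inverse_real_of_nat)
  have "(\<lambda>j. \<integral>g. ?F (r j) g * k g \<partial>lborel) \<longlonglongrightarrow> (\<integral>g. 0 \<partial>(lborel :: 'n heis measure))"
  proof (rule integral_dominated_convergence[where w="\<lambda>g. min 1 (hnorm g) powr b * k g"])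
    show "integrable lborel (\<lambda>g. min 1 (hnorm g) powr b * k g)"
      by (rule integrable_k[OF _ b, of _ 1]) auto
    show "AE g in lborel. (\<lambda>j. ?F (r j) g * k g) \<longlonglongrightarrow> 0"
    proof (intro always_eventually allI)
      fix g :: "'n heis"
      show "(\<lambda>j. ?F (r j) g * k g) \<longlonglongrightarrow> 0"
      proof (cases "g = 0")
        case False
        then have "\<forall>\<^sub>F j in sequentially. r j < hnorm g"
          using r0 by (intro order_tendstoD) auto
        then have "\<forall>\<^sub>F j in sequentially. ?F (r j) g * k g = 0"
          by eventually_elim (auto simp: indicator_def)
        then show ?thesis by (rule tendsto_eventually)
      qed simp
    qed
  qed (auto simp: indicator_def)
  then have "\<forall>\<^sub>F j in sequentially. (\<integral>g. ?F (r j) g * k g \<partial>lborel) < e"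
    using e by (intro order_tendstoD) auto
  then obtain j where "(\<integral>g. ?F (r j) g * k g \<partial>lborel) < e"
    by (auto simp: eventually_sequentially)
  moreover have "0 < r j" by (simp add: r_def)
  ultimately show ?thesis using that by blast
qed

end

section \<open>Evaluation of the operator on functions that are smooth near a point\<close>

text \<open>This passes from the extended integral over the completed measure to an ordinary
  integral over \<open>lborel\<close>. Integrability of \<open>H\<close> makes both one-sided
  integrals finite, so the difference of extended reals is never of the form \<infinity> -
  \<infinity>.\<close>

lemma ext_integral_eq:
  assumes H: "integrable lborel H" and eq: "AE x in lebesgue. G x = H x"
  shows "ext_integral lebesgue G = ereal (\<integral>x. H x \<partial>lborel)"
proof -
  have [measurable]: "H \<in> borel_measurable borel" using H by simp
  have *: "(\<integral>\<^sup>+x. ennreal (f (G x)) \<partial>lebesgue) = (\<integral>\<^sup>+x. ennreal (f (H x)) \<partial>lborel)"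
    if [measurable]: "f \<in> borel_measurable borel" for f
  proof -
    have "(\<integral>\<^sup>+x. ennreal (f (G x)) \<partial>lebesgue) = (\<integral>\<^sup>+x. ennreal (f (H x)) \<partial>lebesgue)"
      using eq by (intro nn_integral_cong_AE) auto
    also have "\<dots> = (\<integral>\<^sup>+x. ennreal (f (H x)) \<partial>lborel)"
      by (rule nn_integral_completion) 
    finally show ?thesis .
  qed
  have "(\<integral>\<^sup>+x. ennreal (H x) \<partial>lborel) < top" "(\<integral>\<^sup>+x. ennreal (- H x) \<partial>lborel) < top"
    using H unfolding real_integrable_def by (auto simp: less_top)
  then show ?thesis
    unfolding ext_integral_def real_lebesgue_integral_def[OF H]
    using *[of "\<lambda>x. x"] *[of uminus]
    by (cases "\<integral>\<^sup>+x. ennreal (H x) \<partial>lborel"; cases "\<integral>\<^sup>+x. ennreal (- H x) \<partial>lborel") auto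
qed

context heis_kernel
begin

definition sdiff_exp :: real where "sdiff_exp = min p (2 * p - 2)"

text \<open>The restriction p > 2/(2-s) is 2p - 2 > sp rearranged, and s < 1 gives p > sp.\<close>

lemma sdiff_exp_gt: "s * p < sdiff_exp"
proof -
  have "2 < p * (2 - s)" using p s by (simp add: divide_less_eq)
  moreover have "s * p < p" using s p by simp
  ultimately show ?thesis by (simp add: sdiff_exp_def algebra_simps)
qed

text \<open>The principal value is resolved by folding \<open>g\<close> onto \<open>- g\<close>:
  measure and \<open>k\<close> are even, so on shells only the sum of the two increments counts, and
  its order exceeds that of the singularity. \<open>R\<close> collects the ball of radius
  \<open>r\<close>. \<open>Vb\<close> is a Borel version of \<open>V\<close>, while at the base
  point the true value \<open>V x\<close> is kept, since there the two may differ.\<close>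

lemma nonlocal_op_eq:
  fixes V Vb :: "'n heis \<Rightarrow> real"
  assumes Vb [measurable]: "Vb \<in> borel_measurable borel" and AE: "AE x in lebesgue. V x = Vb x"
    and bd: "\<And>x. \<bar>Vb x\<bar> \<le> M"
    and r: "0 < r" "r \<le> 1" and C: "0 \<le> C"
    and sd: "\<And>g. hnorm g < r \<Longrightarrow> \<bar>signed_pow p (V x - Vb (x \<diamondop> g)) + signed_pow p (V x - Vb (x \<diamondop> (- g)))\<bar>
      \<le> C * hnorm g powr sdiff_exp"
  shows "\<exists>R. nonlocal_op p K (\<lambda>x. ereal (V x)) x = ereal (2 * (\<integral>g. indicator {g. r \<le> hnorm g} g *
        signed_pow p (V x - Vb (x \<diamondop> g)) * k g \<partial>lborel) + R) \<and>
     \<bar>R\<bar> \<le> C * (\<integral>g. indicator {g. hnorm g < r} g * min 1 (hnorm g) powr sdiff_exp * k g \<partial>lborel)"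
proof -
  define J where "J g = signed_pow p (V x - Vb (x \<diamondop> g))" for g
  have [measurable]: "J \<in> borel_measurable borel" unfolding J_def by measurable
  define B where "B = (\<bar>V x\<bar> + M) powr (p - 1)"
  have JB: "\<bar>J g\<bar> \<le> B" for g
    unfolding J_def B_def using p bd[of "x \<diamondop> g"] by (intro abs_signed_pow_le) linarith+
  have B0: "0 \<le> B" by (simp add: B_def)
  define \<Phi> where "\<Phi> e = (\<integral>g. indicator {g. e \<le> hnorm g} g * J g * k g \<partial>lborel)" for e
  have int1: "integrable lborel (\<lambda>g. indicator {g. e \<le> hnorm g} g * J g * k g)" if "0 < e" for e
    by (rule integrable_k_away[of _ B e]) (use JB B0 that in \<open>auto simp: indicator_def\<close>)
  have int2: "integrable lborel (\<lambda>g. indicator {g. e \<le> hnorm g \<and> hnorm g < r} g * J g * k g)" if "0 < e" for e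
    by (rule integrable_k_away[of _ B e]) (use JB B0 that in \<open>auto simp: indicator_def\<close>)
  have ext: "ext_integral lebesgue (\<lambda>y. indicator (- hball x e) y *
       (signed_pow p (real_of_ereal (ereal (V x)) - real_of_ereal (ereal (V y))) * K x y)) = ereal (\<Phi> e)"
    if e: "0 < e" for e
  proof -
    define H where "H y = (\<lambda>g. indicator {g. e \<le> hnorm g} g * J g * k g) ((- x) \<diamondop> y)" for y
    have "integrable lborel H"
      unfolding H_def by (subst integrable_hmult_iff) (use int1[OF e] in auto)
    moreover have "AE y in lebesgue. indicator (- hball x e) y *
       (signed_pow p (real_of_ereal (ereal (V x)) - real_of_ereal (ereal (V y))) * K x y) = H y"
      using AE
    proof eventually_elim
      case (elim y)
      show ?case
      proof (cases "x = y")
        case False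
        have "K x y = k (- ((- x) \<diamondop> y))"
          using K_eq[OF False] by (simp add: neg_hmult)
        then show ?thesis using elim by (simp add: H_def J_def hball_def indicator_def)
      qed (use e in \<open>simp add: H_def hball_def\<close>)
    qed
    ultimately have "ext_integral lebesgue (\<lambda>y. indicator (- hball x e) y *
       (signed_pow p (real_of_ereal (ereal (V x)) - real_of_ereal (ereal (V y))) * K x y)) = ereal (\<integral>y. H y \<partial>lborel)"
      by (rule ext_integral_eq)
    also have "(\<integral>y. H y \<partial>lborel) = \<Phi> e"
      unfolding H_def \<Phi>_def by (rule integral_hmult) measurable
    finally show ?thesis .
  qed
  define S where "S g = J g + J (- g)" for g
  have [measurable]: "S \<in> borel_measurable borel" unfolding S_def by measurable
  have S: "\<bar>S g\<bar> \<le> C * min 1 (hnorm g) powr sdiff_exp" if "hnorm g < r" for g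
    using sd[OF that] that r by (simp add: S_def J_def min_def)
  define \<Psi> where "\<Psi> e = (\<integral>g. indicator {g. e \<le> hnorm g \<and> hnorm g < r} g * S g * k g \<partial>lborel)" for e
  define R where "R = (\<integral>g. indicator {g. hnorm g < r} g * S g * k g \<partial>lborel)"
  \<comment> \<open>The factor 2 of the operator lets the shell integral be counted once as it
    stands and once reflected.\<close>
  have \<Phi>: "2 * \<Phi> e = 2 * \<Phi> r + \<Psi> e" if e: "0 < e" "e < r" for e
  proof -
    let ?A = "\<lambda>g. indicator {g. e \<le> hnorm g \<and> hnorm g < r} g * J g * k g"
    have "\<Phi> e = (\<integral>g. indicator {g. r \<le> hnorm g} g * J g * k g + ?A g \<partial>lborel)"
      unfolding \<Phi>_def using e by (intro Bochner_Integration.integral_cong) (auto simp: indicator_def)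
    also have "\<dots> = \<Phi> r + integral\<^sup>L lborel ?A"
      unfolding \<Phi>_def using int1[of r] int2[of e] e r by (intro Bochner_Integration.integral_add) auto
    finally have 1: "\<Phi> e = \<Phi> r + integral\<^sup>L lborel ?A" .
    have m: "?A \<in> borel_measurable borel" by measurable
    have "integral\<^sup>L lborel ?A + integral\<^sup>L lborel (\<lambda>g. ?A (- g)) = (\<integral>g. ?A g + ?A (- g) \<partial>lborel)"
      by (rule Bochner_Integration.integral_add[symmetric])
        (use int2[OF e(1)] integrable_neg_iff[OF m] in auto)
    also have "\<dots> = \<Psi> e"
      unfolding \<Psi>_def S_def by (intro Bochner_Integration.integral_cong) (auto simp: indicator_def algebra_simps)
    also have "integral\<^sup>L lborel (\<lambda>g. ?A (- g)) = integral\<^sup>L lborel ?A"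
      by (rule integral_neg[OF m])
    finally show ?thesis using 1 by simp
  qed
  have intS: "integrable lborel (\<lambda>g. indicator {g. hnorm g < r} g * S g * k g)"
    by (rule integrable_k[OF _ sdiff_exp_gt, of _ C]) (use S C in \<open>auto simp: indicator_def\<close>)
  have "(\<Psi> \<longlongrightarrow> R) (at_right 0)"
  proof (rule tendsto_at_right_sequentially[of _ 1])
    fix e :: "nat \<Rightarrow> real" assume e: "\<And>n. 0 < e n" "e \<longlonglongrightarrow> 0"
    show "(\<lambda>n. \<Psi> (e n)) \<longlonglongrightarrow> R"
      unfolding \<Psi>_def R_def
    proof (rule integral_dominated_convergence[where w="\<lambda>g. norm (indicator {g. hnorm g < r} g * S g * k g)"])
      show "AE g in lborel. (\<lambda>n. indicator {g. e n \<le> hnorm g \<and> hnorm g < r} g * S g * k g)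
          \<longlonglongrightarrow> indicator {g. hnorm g < r} g * S g * k g"
      proof (intro always_eventually allI)
        fix g :: "'n heis"
        show "(\<lambda>n. indicator {g. e n \<le> hnorm g \<and> hnorm g < r} g * S g * k g)
          \<longlonglongrightarrow> indicator {g. hnorm g < r} g * S g * k g"
        proof (cases "g = 0")
          case False
          then have "\<forall>\<^sub>F n in sequentially. e n < hnorm g" using e by (intro order_tendstoD) auto
          then have "\<forall>\<^sub>F n in sequentially. indicator {g. e n \<le> hnorm g \<and> hnorm g < r} g * S g * k g
            = indicator {g. hnorm g < r} g * S g * k g"
            by eventually_elim (auto simp: indicator_def)
          then show ?thesis by (rule tendsto_eventually)
        qed simp
      qed
    qed (use intS in \<open>auto simp: indicator_def\<close>)
  qed auto
  then have "((\<lambda>e. \<Phi> r + \<Psi> e / 2) \<longlongrightarrow> \<Phi> r + R / 2) (at_right 0)"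
    by (intro tendsto_intros) auto
  moreover have "\<forall>\<^sub>F e in at_right 0. \<Phi> r + \<Psi> e / 2 = \<Phi> e"
    unfolding eventually_at_right_field
  proof (intro exI[of _ r] conjI r(1) allI impI)
    fix e assume "0 < e" "e < r"
    then show "\<Phi> r + \<Psi> e / 2 = \<Phi> e" using \<Phi>[of e] by simp
  qed
  ultimately have "(\<Phi> \<longlongrightarrow> \<Phi> r + R / 2) (at_right 0)"
    by (rule Lim_transform_eventually)
  then have "((\<lambda>e. ereal (\<Phi> e)) \<longlongrightarrow> ereal (\<Phi> r + R / 2)) (at_right 0)"
    by simp
  moreover have "\<forall>\<^sub>F e in at_right 0. ereal (\<Phi> e) = ext_integral lebesgue (\<lambda>y. indicator (- hball x e) y *
       (signed_pow p (real_of_ereal (ereal (V x)) - real_of_ereal (ereal (V y))) * K x y))"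
    using ext by (auto simp: eventually_at_right_field intro!: exI[of _ 1])
  ultimately have "((\<lambda>e. ext_integral lebesgue (\<lambda>y. indicator (- hball x e) y *
       (signed_pow p (real_of_ereal (ereal (V x)) - real_of_ereal (ereal (V y))) * K x y)))
       \<longlongrightarrow> ereal (\<Phi> r + R / 2)) (at_right 0)"
    by (rule Lim_transform_eventually)
  then have "nonlocal_op p K (\<lambda>x. ereal (V x)) x = 2 * ereal (\<Phi> r + R / 2)"
    unfolding nonlocal_op_def by (subst tendsto_Lim) auto
  also have "\<dots> = ereal (2 * \<Phi> r + R)"
    by (simp only: numeral_eq_ereal times_ereal.simps) simp
  finally have "nonlocal_op p K (\<lambda>x. ereal (V x)) x = ereal (2 * \<Phi> r + R)" .
  moreover have "\<bar>R\<bar> \<le> (\<integral>g. C * (indicator {g. hnorm g < r} g * min 1 (hnorm g) powr sdiff_exp * k g) \<partial>lborel)"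
  proof -
    have intw: "integrable lborel (\<lambda>g. indicator {g. hnorm g < r} g * min 1 (hnorm g) powr sdiff_exp * k g)"
      by (rule integrable_k[OF _ sdiff_exp_gt, of _ 1]) (auto simp: indicator_def)
    have "norm R \<le> (\<integral>g. norm (indicator {g. hnorm g < r} g * S g * k g) \<partial>lborel)"
      unfolding R_def by simp
    also have "\<dots> \<le> (\<integral>g. C * (indicator {g. hnorm g < r} g * min 1 (hnorm g) powr sdiff_exp * k g) \<partial>lborel)"
    proof (intro integral_mono integrable_norm[OF intS] integrable_mult_right[OF intw])
      fix g
      have "\<bar>S g\<bar> * k g \<le> (C * min 1 (hnorm g) powr sdiff_exp) * k g" if "hnorm g < r"
        using S[OF that] by (intro mult_right_mono) auto
      then show "norm (indicator {g. hnorm g < r} g * S g * k g) \<le>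
          C * (indicator {g. hnorm g < r} g * min 1 (hnorm g) powr sdiff_exp * k g)"
        by (simp add: indicator_def abs_mult mult.assoc)
    qed
    finally show ?thesis by simp
  qed
  ultimately show ?thesis unfolding \<Phi>_def J_def by auto
qed

end

section \<open>Paraboloids as viscosity test functions\<close>

lemma Ck_on_cong_open:
  assumes "open S" "\<And>x. x \<in> S \<Longrightarrow> f x = g x" "Ck_on n S f"
  shows "Ck_on n S g"
  using assms(2,3)
proof (induction n arbitrary: f g)
  case 0
  then show ?case by (auto cong: continuous_on_cong)
next
  case (Suc n)
  have d: "(f has_derivative frechet_derivative f (at x)) (at x)" if "x \<in> S" for x
    using Suc.prems(2) that by (auto simp: frechet_derivative_works)
  have d': "(g has_derivative frechet_derivative f (at x)) (at x)" if "x \<in> S" for x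
    using has_derivative_transform_within_open[OF d[OF that] assms(1) that] Suc.prems(1) by auto
  then have eq: "frechet_derivative g (at x) = frechet_derivative f (at x)" if "x \<in> S" for x
    using frechet_derivative_at[OF d'] that by metis
  have "Ck_on n S (\<lambda>x. frechet_derivative g (at x) b)" if "b \<in> Basis" for b
  proof (rule Suc.IH)
    show "Ck_on n S (\<lambda>x. frechet_derivative f (at x) b)" using Suc.prems(2) that by simp
  qed (simp add: eq)
  then show ?case using d' by (auto simp: differentiable_def)
qed

lemma open_hball [simp]: "open (hball (x :: 'n::finite heis) r)"
proof -
  have "open ((\<lambda>z. hnorm ((- x) \<diamondop> z)) -` {..<r})"
    by (intro open_vimage continuous_intros)
  then show ?thesis by (simp add: hball_def vimage_def lessThan_def)
qed

lemma hball_borel [measurable]: "hball (x :: 'n::finite heis) r \<in> sets borel"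
  by (simp add: borel_open)

lemma hmult_mem_hball [simp]: "x \<diamondop> g \<in> hball x r \<longleftrightarrow> hnorm g < r"
  by (simp add: hball_def)

lemma center_mem_hball [simp]: "x \<in> hball x r \<longleftrightarrow> 0 < r"
  by (simp add: hball_def)

text \<open>The group law is addition plus a bilinear term, so translations are affine. The squared
  norm of a translate is thus a quadratic polynomial, and no Taylor remainder has to be
  estimated.\<close>

lemma linear_left_mult: "bounded_linear (\<lambda>g. x \<diamondop> g - (x :: 'n::finite heis))"
proof -
  have "linear (\<lambda>g. x \<diamondop> g - x)"
    by (rule linearI) (cases x; simp add: hmult_alt inner_add_left inner_add_right algebra_simps)+
  then show ?thesis by (simp add: linear_conv_bounded_linear)
qed

lemma linear_right_mult: "bounded_linear (\<lambda>g. g \<diamondop> x - (x :: 'n::finite heis))"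
proof -
  have "linear (\<lambda>g. g \<diamondop> x - x)"
    by (rule linearI) (cases x; simp add: hmult_alt inner_add_left inner_add_right algebra_simps)+
  then show ?thesis by (simp add: linear_conv_bounded_linear)
qed

lemma Ck_on_paraboloid: "Ck_on 2 S (\<lambda>z. c + \<sigma> * (norm (z \<diamondop> (a :: 'n::finite heis)))\<^sup>2)"
proof -
  define L where "L = (\<lambda>g. g \<diamondop> a - a)"
  interpret L: bounded_linear L unfolding L_def by (rule linear_right_mult)
  have L: "z \<diamondop> a = L z + a" for z by (simp add: L_def)
  have d1: "((\<lambda>z. c + \<sigma> * (norm (z \<diamondop> a))\<^sup>2) has_derivative (\<lambda>h. 2 * \<sigma> * ((L x + a) \<bullet> L h))) (at x)" for x
    unfolding L dot_square_norm[symmetric]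
    by (auto intro!: derivative_eq_intros L.has_derivative has_derivative_ident simp: inner_commute fun_eq_iff)
  have d2: "((\<lambda>x. 2 * \<sigma> * ((L x + a) \<bullet> L b)) has_derivative (\<lambda>h. 2 * \<sigma> * (L h \<bullet> L b))) (at x)" for b x
    by (auto intro!: derivative_eq_intros L.has_derivative has_derivative_ident simp: inner_commute fun_eq_iff)
  have f1: "frechet_derivative (\<lambda>z. c + \<sigma> * (norm (z \<diamondop> a))\<^sup>2) (at x) = (\<lambda>h. 2 * \<sigma> * ((L x + a) \<bullet> L h))" for x
    using frechet_derivative_at[OF d1] by metis
  have f2: "frechet_derivative (\<lambda>x. 2 * \<sigma> * ((L x + a) \<bullet> L b)) (at x) = (\<lambda>h. 2 * \<sigma> * (L h \<bullet> L b))" for b x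
    using frechet_derivative_at[OF d2] by metis
  have two: "(Ck_on 2 :: 'n heis set \<Rightarrow> _) = Ck_on (Suc (Suc 0))"
    by (simp only: numeral_2_eq_2)
  show ?thesis
  proof -
    have "(\<lambda>z. c + \<sigma> * (norm (z \<diamondop> a))\<^sup>2) differentiable (at x)"
      "(\<lambda>x. 2 * \<sigma> * ((L x + a) \<bullet> L b)) differentiable (at x)" for x b
      using d1 d2 unfolding differentiable_def by blast+
    then show ?thesis unfolding two by (simp add: f1 f2)
  qed
qed

text \<open>Along \<open>g\<close> the paraboloid is a multiple of
  \<open>(norm (h + B g))\<^sup>2\<close> plus a constant, with \<open>B\<close> linear. Adding the
  increments along \<open>g\<close> and \<open>- g\<close> cancels the linear part. The constant
  \<open>L\<close> is uniform in the point and in the centre, which later yields one radius for all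
  touching points.\<close>

lemma paraboloid_differences:
  obtains L where "0 \<le> L"
    "\<And>x a g :: 'n::finite heis. \<And>P c. norm x \<le> R \<Longrightarrow> norm a \<le> R \<Longrightarrow> hnorm g \<le> 1 \<Longrightarrow>
      P = (\<lambda>z. c + \<sigma> * (norm (z \<diamondop> (- a)))\<^sup>2) \<Longrightarrow>
      \<bar>P x - P (x \<diamondop> g)\<bar> \<le> L * hnorm g \<and>
      \<bar>(P x - P (x \<diamondop> g)) + (P x - P (x \<diamondop> (- g)))\<bar> \<le> L * (hnorm g)\<^sup>2"
proof -
  define R' where "R' = max R 0"
  \<comment> \<open>\<open>\<beta>\<close> bounds \<open>B\<close> relative to \<open>hnorm\<close>:
    each of the two translations costs \<open>1 + 4 * R'\<close>, and 2 is the constant of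
    \<open>norm_le_hnorm\<close>. \<open>H\<close> bounds \<open>h\<close>.\<close>
  define \<beta> where "\<beta> = 2 * (1 + 4 * R') * (1 + 4 * R')"
  define H where "H = R' + (1 + 4 * R') * R'"
  define L where "L = \<bar>\<sigma>\<bar> * (2 * H * \<beta> + 2 * \<beta>\<^sup>2)"
  have pos: "0 \<le> R'" "0 \<le> \<beta>" "0 \<le> H" by (auto simp: R'_def \<beta>_def H_def)
  have "0 \<le> L" using pos by (simp add: L_def)
  moreover have "\<bar>P x - P (x \<diamondop> g)\<bar> \<le> L * hnorm g \<and>
      \<bar>(P x - P (x \<diamondop> g)) + (P x - P (x \<diamondop> (- g)))\<bar> \<le> L * (hnorm g)\<^sup>2"
    if x: "norm x \<le> R" and a: "norm a \<le> R" and g: "hnorm g \<le> 1"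
      and P: "P = (\<lambda>z. c + \<sigma> * (norm (z \<diamondop> (- a)))\<^sup>2)" for x a g :: "'n heis" and P c
  proof -
    define Ll where "Ll = (\<lambda>g. x \<diamondop> g - x)"
    define Lr where "Lr = (\<lambda>g. g \<diamondop> (- a) - (- a))"
    interpret Ll: bounded_linear Ll unfolding Ll_def by (rule linear_left_mult)
    interpret Lr: bounded_linear Lr unfolding Lr_def by (rule linear_right_mult)
    define B where "B = (\<lambda>g. Lr (Ll g))"
    define h where "h = x \<diamondop> (- a)"
    have B: "(x \<diamondop> g) \<diamondop> (- a) = h + B g" for g
    proof -
      have "x \<diamondop> g = x + Ll g" "\<And>z. z \<diamondop> (- a) = Lr z - a" by (simp_all add: Ll_def Lr_def)
      then show ?thesis by (simp add: B_def h_def Lr.add)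
    qed
    have Bm: "B (- g) = - B g" by (simp add: B_def linear_neg[OF Ll.linear] linear_neg[OF Lr.linear])
    have Lrb: "norm (Lr z) \<le> (1 + 4 * R') * norm z" for z
    proof -
      have "norm (Lr z) \<le> (1 + 4 * norm (- a)) * norm z"
        unfolding Lr_def by (rule norm_hmult_diff_le)
      also have "\<dots> \<le> (1 + 4 * R') * norm z" using a by (intro mult_right_mono) (auto simp: R'_def)
      finally show ?thesis .
    qed
    have "norm (B g) \<le> (1 + 4 * R') * norm (Ll g)" unfolding B_def by (rule Lrb)
    also have "norm (Ll g) \<le> (1 + 4 * norm x) * norm g" unfolding Ll_def by (rule norm_hmult_diff_le)
    also have "(1 + 4 * norm x) * norm g \<le> (1 + 4 * R') * (2 * hnorm g)"
      using x norm_le_hnorm[OF g] pos by (intro mult_mono) (auto simp: R'_def)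
    finally have Bg: "norm (B g) \<le> \<beta> * hnorm g" using pos by (simp add: \<beta>_def mult_ac)
    have "h = Lr x - a" by (simp add: h_def Lr_def)
    then have "norm h \<le> norm (Lr x) + norm a" by (simp add: norm_triangle_ineq4)
    also have "norm (Lr x) \<le> (1 + 4 * R') * R'"
      using Lrb[of x] x pos by (rule_tac order_trans) (auto intro!: mult_left_mono simp: R'_def)
    finally have h: "norm h \<le> H" using a by (simp add: H_def R'_def)
    have hB: "\<bar>h \<bullet> B g\<bar> \<le> H * \<beta> * hnorm g"
      using order_trans[OF Cauchy_Schwarz_ineq2 mult_mono[OF h Bg]] pos by (simp add: mult.assoc)
    have BB: "(norm (B g))\<^sup>2 \<le> \<beta>\<^sup>2 * (hnorm g)\<^sup>2"
      using power_mono[OF Bg, of 2] by (simp add: power_mult_distrib)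
    have g2: "(hnorm g)\<^sup>2 \<le> hnorm g" using g by (simp add: power2_eq_square mult_left_le)
    have d1: "P x - P (x \<diamondop> g) = - \<sigma> * (2 * (h \<bullet> B g) + (norm (B g))\<^sup>2)"
      unfolding P B h_def[symmetric] dot_square_norm[symmetric] 
      by (simp add: inner_add_left inner_add_right inner_commute algebra_simps)
    have d2: "P x - P (x \<diamondop> (- g)) = - \<sigma> * (- 2 * (h \<bullet> B g) + (norm (B g))\<^sup>2)"
      unfolding P B h_def[symmetric] dot_square_norm[symmetric] Bm
      by (simp add: inner_diff_left inner_diff_right inner_commute algebra_simps)
    have "\<bar>P x - P (x \<diamondop> g)\<bar> = \<bar>\<sigma>\<bar> * \<bar>2 * (h \<bullet> B g) + (norm (B g))\<^sup>2\<bar>"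
      unfolding d1 by (simp add: abs_mult)
    also have "\<bar>2 * (h \<bullet> B g) + (norm (B g))\<^sup>2\<bar> \<le> 2 * (H * \<beta> * hnorm g) + \<beta>\<^sup>2 * hnorm g"
    proof -
      have "(norm (B g))\<^sup>2 \<le> \<beta>\<^sup>2 * hnorm g"
        using BB g2 by (meson order_trans mult_left_mono zero_le_power2)
      then show ?thesis using hB zero_le_power2[of "norm (B g)"] by linarith
    qed
    also have "\<bar>\<sigma>\<bar> * (2 * (H * \<beta> * hnorm g) + \<beta>\<^sup>2 * hnorm g) \<le> L * hnorm g"
      by (simp add: L_def algebra_simps)
    finally have 1: "\<bar>P x - P (x \<diamondop> g)\<bar> \<le> L * hnorm g" by (simp add: mult_left_mono)
    have "(P x - P (x \<diamondop> g)) + (P x - P (x \<diamondop> (- g))) = - (2 * \<sigma> * (norm (B g))\<^sup>2)"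
      unfolding d1 d2 by (simp add: algebra_simps)
    then have "\<bar>(P x - P (x \<diamondop> g)) + (P x - P (x \<diamondop> (- g)))\<bar> = 2 * \<bar>\<sigma>\<bar> * (norm (B g))\<^sup>2"
      by (simp add: abs_mult)
    also have "\<dots> \<le> 2 * \<bar>\<sigma>\<bar> * (\<beta>\<^sup>2 * (hnorm g)\<^sup>2)" using BB by (intro mult_left_mono) auto
    also have "\<dots> \<le> L * (hnorm g)\<^sup>2"
      using pos by (simp add: L_def algebra_simps)
    finally show ?thesis using 1 by simp
  qed
  ultimately show ?thesis using that by blast
qed

text \<open>The weight is at most 1 on the unit ball and at most
  \<open>hnorm x powr (- hom_dim TYPE('n) - \<gamma>)\<close> outside, and both bounds are
  integrable there.\<close>

lemma Linfty_imp_Lweighted: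
  fixes v :: "'n::finite heis \<Rightarrow> real"
  assumes v: "v \<in> Linfty" and m: "0 < m" and \<gamma>: "0 < \<gamma>"
  shows "v \<in> Lweighted m \<gamma>"
proof -
  have [measurable]: "v \<in> borel_measurable lebesgue" using v by (simp add: Linfty_def)
  obtain C where C: "AE x in lebesgue. \<bar>v x\<bar> \<le> C" using v by (auto simp: Linfty_def)
  have C': "AE x in lebesgue. ennreal (\<bar>v x\<bar> powr m) \<le> ennreal (C powr m)"
    using C by eventually_elim (use m in \<open>auto intro!: ennreal_leI powr_mono2\<close>)
  let ?w = "\<lambda>x :: 'n heis. 1 / (1 + hnorm x powr (hom_dim TYPE('n) + \<gamma>))"
  have "v \<in> Lp_on m K" if K: "compact K" for K
  proof -
    have [measurable]: "K \<in> sets lebesgue" using K by (simp add: lmeasurable_compact fmeasurableD)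
    have "(\<integral>\<^sup>+x\<in>K. ennreal (\<bar>v x\<bar> powr m) \<partial>lebesgue) \<le> (\<integral>\<^sup>+x. ennreal (C powr m) * indicator K x \<partial>lebesgue)"
      using C' by (intro nn_integral_mono_AE) (auto elim!: eventually_mono intro!: mult_right_mono)
    also have "\<dots> = ennreal (C powr m) * emeasure lebesgue K"
      using K by (subst nn_integral_cmult_indicator) (auto simp: compact_imp_closed borel_closed)
    also have "\<dots> < \<infinity>"
      using emeasure_compact_finite[OF K] K by (simp add: ennreal_mult_less_top compact_imp_closed borel_closed)
    finally show ?thesis
      by (auto simp: Lp_on_def set_borel_measurable_def)
  qed
  moreover have "(\<integral>\<^sup>+x. ennreal (\<bar>v x\<bar> powr m / (1 + hnorm x powr (hom_dim TYPE('n) + \<gamma>))) \<partial>lebesgue) < \<infinity>"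
  proof -
    let ?G = "\<lambda>g :: 'n heis. min 1 (hnorm g) powr (\<gamma> + 1) * hnorm g powr (- hom_dim TYPE('n) - \<gamma>)"
    let ?B = "{g :: 'n heis. hnorm g \<le> 1}"
    have w: "?w x \<le> indicator ?B x + ?G x" for x
    proof (cases "hnorm x \<le> 1")
      case True
      have "?w x \<le> 1" by (simp add: add_pos_nonneg)
      then show ?thesis using True by (simp add: add_increasing2)
    next
      case False
      then have "0 < hnorm x powr (hom_dim TYPE('n) + \<gamma>)" by (cases "x = 0") auto
      then have "?w x \<le> 1 / (hnorm x powr (hom_dim TYPE('n) + \<gamma>))"
        by (intro divide_left_mono) (auto simp: add_pos_nonneg)
      also have "\<dots> = ?G x" using False powr_minus_divide[of "hnorm x" "hom_dim TYPE('n) + \<gamma>"]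
        by (simp add: min_def)
      finally show ?thesis using False by simp
    qed
    have "(\<integral>\<^sup>+x. ennreal (\<bar>v x\<bar> powr m / (1 + hnorm x powr (hom_dim TYPE('n) + \<gamma>))) \<partial>lebesgue)
        \<le> (\<integral>\<^sup>+x. ennreal (C powr m) * ennreal (indicator ?B x + ?G x) \<partial>lebesgue)"
    proof (rule nn_integral_mono_AE)
      show "AE x in lebesgue. ennreal (\<bar>v x\<bar> powr m / (1 + hnorm x powr (hom_dim TYPE('n) + \<gamma>))) \<le>
          ennreal (C powr m) * ennreal (indicator ?B x + ?G x)"
        using C'
      proof eventually_elim
        case (elim x)
        have "ennreal (\<bar>v x\<bar> powr m / (1 + hnorm x powr (hom_dim TYPE('n) + \<gamma>))) = ennreal (\<bar>v x\<bar> powr m) * ennreal (?w x)"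
          by (simp flip: ennreal_mult)
        also have "\<dots> \<le> ennreal (C powr m) * ennreal (indicator ?B x + ?G x)"
          using elim w by (intro mult_mono ennreal_leI) auto
        finally show ?case .
      qed
    qed
    also have "\<dots> = (\<integral>\<^sup>+x. ennreal (C powr m) * (indicator ?B x + ennreal (?G x)) \<partial>lborel)"
      by (subst nn_integral_completion) (auto simp: ennreal_indicator intro!: nn_integral_cong)
    also have "\<dots> = ennreal (C powr m) * (emeasure lborel ?B + (\<integral>\<^sup>+x. ennreal (?G x) \<partial>lborel))"
      by (simp add: nn_integral_cmult nn_integral_add)
    also have "\<dots> < \<infinity>"
    proof -
      obtain D where "0 \<le> D"
        "\<And>R. 0 < R \<Longrightarrow> emeasure lborel {g :: 'n heis. hnorm g \<le> R} \<le> ennreal (D * R powr hom_dim TYPE('n))"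
        using emeasure_hnorm_le[where 'n='n] by blast
      from this(2)[of 1] have "emeasure lborel ?B < top"
        by (simp add: order_le_less_trans)
      moreover have "(\<integral>\<^sup>+x. ennreal (?G x) \<partial>lborel) < top"
        using nn_integral_hnorm_finite[of \<gamma> "\<gamma> + 1", where 'n='n] \<gamma> by simp
      ultimately show ?thesis by (simp add: ennreal_mult_less_top)
    qed
    finally show ?thesis .
  qed
  ultimately show ?thesis by (simp add: Lweighted_def)
qed

section \<open>The viscosity inequality at points touched by a paraboloid\<close>

context heis_kernel
begin

text \<open>Half of the operator with its singularity cut out: the factor 2 stays outside, so
  \<open>2 * trunc_op\<close> is what compares with \<open>f\<close>. For bounded Borel
  \<open>w\<close> and positive \<tau> the integral converges absolutely.\<close>

definition trunc_op :: "real \<Rightarrow> ('n heis \<Rightarrow> real) \<Rightarrow> 'n heis \<Rightarrow> real" where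
  "trunc_op \<tau> w x = (\<integral>g. indicator {g. \<tau> \<le> hnorm g} g * signed_pow p (w x - w (x \<diamondop> g)) * k g \<partial>lborel)"

text \<open>A viscosity test function has to lie in the weighted space and to touch on the whole
  group. Continuing the paraboloid by \<open>u\<close> outside the ball settles both: the result is
  bounded almost everywhere, and touching remains to be checked in the ball.\<close>

lemma glued_C2_Lweighted:
  assumes u: "u \<in> Linfty" and P: "P = (\<lambda>z. c + \<sigma> * (norm (z \<diamondop> (- a)))\<^sup>2)"
    and C: "\<forall>z\<in>hball x r. \<bar>P z\<bar> \<le> C"
  shows "(\<lambda>z. ereal (if z \<in> hball x r then P z else u z)) \<in> C2_Lweighted s p x r"
proof -
  let ?V = "\<lambda>z. if z \<in> hball x r then P z else u z"
  have um [measurable]: "u \<in> borel_measurable lebesgue" using u by (simp add: Linfty_def)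
  obtain D where D: "AE z in lebesgue. \<bar>u z\<bar> \<le> D" using u by (auto simp: Linfty_def)
  have "P \<in> borel_measurable borel" unfolding P by measurable
  then have [measurable]: "P \<in> borel_measurable lebesgue" by (intro measurable_completion) simp
  have "AE z in lebesgue. \<bar>?V z\<bar> \<le> max C D" using D by eventually_elim (use C in auto)
  moreover have "?V \<in> borel_measurable lebesgue"
    by (rule measurable_If_set) (auto simp: um)
  ultimately have "?V \<in> Linfty" unfolding Linfty_def by blast
  then have "?V \<in> Lweighted (p - 1) (s * p)"
    by (rule Linfty_imp_Lweighted) (use p sp_pos in auto)
  moreover have "Ck_on 2 (hball x r) ?V"
    by (rule Ck_on_cong_open[of _ P]) (auto simp: P Ck_on_paraboloid)
  ultimately show ?thesis by (simp add: C2_Lweighted_def Lweighted_ext_def)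
qed

text \<open>Inside the ball the function is a paraboloid, whose contribution is at most
  \<open>C * I r\<close> and tends to 0 uniformly in \<open>x\<close> and \<open>a\<close>. Outside,
  the paraboloid enters only through its value \<open>v x\<close> at the centre, which leaves the
  truncated operator of \<open>v\<close>. The sign of \<sigma> is free, so this serves touching from
  below and from above.\<close>

lemma operator_paraboloid:
  assumes e: "0 < e" and u: "u \<in> Linfty" and v [measurable]: "v \<in> borel_measurable borel" and bd: "\<And>z. \<bar>v z\<bar> \<le> M"
    and AE: "AE z in lebesgue. u z = v z"
  shows "\<exists>r0>0. \<forall>r x a. 0 < r \<and> r < r0 \<and> norm x \<le> R \<and> norm a \<le> R \<longrightarrow>
    (\<exists>\<phi>\<in>C2_Lweighted s p x r. (\<forall>z. \<phi> z = ereal (if z \<in> hball x r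
        then v x + \<sigma> * (norm (x \<diamondop> (- a)))\<^sup>2 - \<sigma> * (norm (z \<diamondop> (- a)))\<^sup>2 else u z)) \<and>
      (\<exists>\<delta>. \<bar>\<delta>\<bar> \<le> e \<and> nonlocal_op p K \<phi> x = ereal (2 * trunc_op r v x + \<delta>)))"
proof -
  obtain L where L: "0 \<le> L"
    "\<And>x a g :: 'n::finite heis. \<And>P c. norm x \<le> R \<Longrightarrow> norm a \<le> R \<Longrightarrow> hnorm g \<le> 1 \<Longrightarrow>
      P = (\<lambda>z. c + (- \<sigma>) * (norm (z \<diamondop> (- a)))\<^sup>2) \<Longrightarrow>
      \<bar>P x - P (x \<diamondop> g)\<bar> \<le> L * hnorm g \<and>
      \<bar>(P x - P (x \<diamondop> g)) + (P x - P (x \<diamondop> (- g)))\<bar> \<le> L * (hnorm g)\<^sup>2"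
    by (rule paraboloid_differences[of R "- \<sigma>"]) (rule that)
  obtain C where C: "0 \<le> C" "\<And>a b \<rho>. 0 < \<rho> \<Longrightarrow> \<rho> \<le> 1 \<Longrightarrow> \<bar>a\<bar> \<le> L * \<rho> \<Longrightarrow> \<bar>b\<bar> \<le> L * \<rho> \<Longrightarrow> \<bar>a + b\<bar> \<le> L * \<rho>\<^sup>2 \<Longrightarrow>
     \<bar>signed_pow p a + signed_pow p b\<bar> \<le> C * \<rho> powr min p (2 * p - 2)"
    using signed_pow_second_difference[OF p(1) L(1)] by metis
  define I where "I r = (\<integral>g. indicator {g. hnorm g < r} g * min 1 (hnorm g) powr sdiff_exp * k g \<partial>lborel)" for r
  obtain r1 where r1: "0 < r1" "I r1 < e / (C + 1)"
    using small_ball_integral[OF sdiff_exp_gt, of "e / (C + 1)"] e C(1) unfolding I_def by auto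
  have intw: "integrable lborel (\<lambda>g. indicator {g. hnorm g < r} g * min 1 (hnorm g) powr sdiff_exp * k g)" for r
    by (rule integrable_k[OF _ sdiff_exp_gt, of _ 1]) (auto simp: indicator_def)
  show ?thesis
  proof (rule exI[of _ "min 1 r1"], intro conjI allI impI)
    show "0 < min 1 r1" using r1 by auto
    fix r and x a :: "'n heis"
    assume "0 < r \<and> r < min 1 r1 \<and> norm x \<le> R \<and> norm a \<le> R"
    then have r: "0 < r" "r < min 1 r1" and x: "norm x \<le> R" and a: "norm a \<le> R" by auto
    define c where "c = v x + \<sigma> * (norm (x \<diamondop> (- a)))\<^sup>2"
    define P where P: "P = (\<lambda>z. c + (- \<sigma>) * (norm (z \<diamondop> (- a)))\<^sup>2)"
    have Px: "P x = v x" by (simp add: P c_def)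
    define V where "V z = (if z \<in> hball x r then P z else u z)" for z
    define Vb where "Vb z = (if z \<in> hball x r then P z else v z)" for z
    have Lx: "\<bar>P x - P (x \<diamondop> g)\<bar> \<le> L * hnorm g"
      "\<bar>(P x - P (x \<diamondop> g)) + (P x - P (x \<diamondop> (- g)))\<bar> \<le> L * (hnorm g)\<^sup>2" if "hnorm g \<le> 1" for g
      using L(2)[OF x a that P] by auto
    have Pb: "\<bar>P z\<bar> \<le> \<bar>P x\<bar> + L" if z: "z \<in> hball x r" for z
    proof -
      have "hnorm ((- x) \<diamondop> z) \<le> 1" using z r by (simp add: hball_def)
      from Lx(1)[OF this] have "\<bar>P x - P z\<bar> \<le> L * hnorm ((- x) \<diamondop> z)" by simp
      also have "\<dots> \<le> L * 1" by (rule mult_left_mono) (fact, fact)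
      finally show ?thesis by linarith
    qed
    have [measurable]: "P \<in> borel_measurable borel" unfolding P by measurable
    have Vbm: "Vb \<in> borel_measurable borel" unfolding Vb_def by measurable
    have "\<exists>\<delta>. nonlocal_op p K (\<lambda>z. ereal (V z)) x = ereal (2 * (\<integral>g. indicator {g. r \<le> hnorm g} g *
        signed_pow p (V x - Vb (x \<diamondop> g)) * k g \<partial>lborel) + \<delta>) \<and> \<bar>\<delta>\<bar> \<le> C * I r"
      unfolding I_def
    proof (rule nonlocal_op_eq[OF Vbm])
      show "AE z in lebesgue. V z = Vb z" using AE by (auto simp: V_def Vb_def elim!: eventually_mono)
      have "0 \<le> M" using bd[of x] by linarith
      then show "\<bar>Vb z\<bar> \<le> \<bar>P x\<bar> + L + M" for z
        using Pb[of z] bd[of z] L(1) by (auto simp: Vb_def)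
      show "r \<le> 1" using r by simp
      fix g :: "'n heis" assume g: "hnorm g < r"
      then have "hnorm g \<le> 1" "hnorm (- g) \<le> 1" using r by auto
      note l = Lx(1)[OF this(1)] Lx(2)[OF this(1)] Lx(1)[OF this(2)]
      show "\<bar>signed_pow p (V x - Vb (x \<diamondop> g)) + signed_pow p (V x - Vb (x \<diamondop> - g))\<bar> \<le> C * hnorm g powr sdiff_exp"
      proof (cases "g = 0")
        case False
        then show ?thesis
          using C(2)[of "hnorm g" "P x - P (x \<diamondop> g)" "P x - P (x \<diamondop> (- g))"] l g r
          by (simp add: V_def Vb_def sdiff_exp_def)
      qed (use r in \<open>simp add: V_def Vb_def signed_pow_def\<close>)
    qed (use r C in auto)
    then obtain \<delta> where \<delta>: "nonlocal_op p K (\<lambda>z. ereal (V z)) x = ereal (2 * (\<integral>g. indicator {g. r \<le> hnorm g} g *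
        signed_pow p (V x - Vb (x \<diamondop> g)) * k g \<partial>lborel) + \<delta>)" "\<bar>\<delta>\<bar> \<le> C * I r" by blast
    have "I r \<le> I r1"
      unfolding I_def using r by (intro integral_mono intw) (auto simp: indicator_def)
    then have "C * I r \<le> C * (e / (C + 1))" using r1 C(1) by (intro mult_left_mono) auto
    also have "\<dots> \<le> e" using C(1) e by (simp add: field_simps)
    finally have "\<bar>\<delta>\<bar> \<le> e" using \<delta>(2) by linarith
    moreover have "(\<integral>g. indicator {g. r \<le> hnorm g} g * signed_pow p (V x - Vb (x \<diamondop> g)) * k g \<partial>lborel) =
        trunc_op r v x"
      unfolding trunc_op_def using r Px by (intro Bochner_Integration.integral_cong) (auto simp: indicator_def V_def Vb_def)
    ultimately have "\<exists>\<delta>. \<bar>\<delta>\<bar> \<le> e \<and> nonlocal_op p K (\<lambda>z. ereal (V z)) x = ereal (2 * trunc_op r v x + \<delta>)"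
      using \<delta>(1) by auto
    moreover have "(\<lambda>z. ereal (V z)) \<in> C2_Lweighted s p x r"
      unfolding V_def by (rule glued_C2_Lweighted[OF u P]) (use Pb in blast)
    ultimately show "\<exists>\<phi>\<in>C2_Lweighted s p x r. (\<forall>z. \<phi> z = ereal (if z \<in> hball x r
        then v x + \<sigma> * (norm (x \<diamondop> (- a)))\<^sup>2 - \<sigma> * (norm (z \<diamondop> (- a)))\<^sup>2 else u z)) \<and>
      (\<exists>\<delta>. \<bar>\<delta>\<bar> \<le> e \<and> nonlocal_op p K \<phi> x = ereal (2 * trunc_op r v x + \<delta>))"
      by (intro bexI[of _ "\<lambda>z. ereal (V z)"] conjI allI) (simp_all add: V_def P c_def)
  qed
qed

text \<open>What is kept of the viscosity condition, in a form shared by supersolutions and negated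
  subsolutions. The threshold \<open>r0\<close> may depend on \<open>R\<close>, \<sigma> and
  \<open>e\<close> but not on \<open>x\<close> or \<open>a\<close>, so one truncation radius serves
  all touching points. The paraboloid in \<open>z \<diamondop> (- a)\<close> has the shape of the
  penalty of the inf-convolution.\<close>

definition touched_below :: "'n heis set \<Rightarrow> ('n heis \<Rightarrow> real) \<Rightarrow> ('n heis \<Rightarrow> real) \<Rightarrow> bool" where
  "touched_below A f v \<longleftrightarrow> (\<forall>R \<sigma> e. 0 < e \<longrightarrow> (\<exists>r0>0. \<forall>r x a. 0 < r \<and> r < r0 \<and> norm x \<le> R \<and> norm a \<le> R \<and> hball x r \<subseteq> A \<and>
     (\<forall>z\<in>hball x r. v x + \<sigma> * (norm (x \<diamondop> (- a)))\<^sup>2 - \<sigma> * (norm (z \<diamondop> (- a)))\<^sup>2 \<le> v z) \<longrightarrow>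
     f x \<le> 2 * trunc_op r v x + e))"

lemma viscosity_supersolution_touched_below:
  assumes vis: "viscosity_supersolution s p K f \<Omega> (\<lambda>z. ereal (u z))" and u: "u \<in> Linfty"
    and A: "A \<subseteq> \<Omega>" and v: "v \<in> borel_measurable borel" "\<And>z. \<bar>v z\<bar> \<le> M"
    and AE: "AE z in lebesgue. u z = v z" and eq: "\<And>z. z \<in> A \<Longrightarrow> v z = u z"
  shows "touched_below A f v"
  unfolding touched_below_def
proof (intro allI impI)
  fix R \<sigma> e :: real assume e: "0 < e"
  from operator_paraboloid[where v=v and M=M and R=R and \<sigma>="\<sigma>", OF e u v AE]
  obtain r0 where r0: "0 < r0" and test: "\<forall>r x a. 0 < r \<and> r < r0 \<and> norm x \<le> R \<and> norm a \<le> R \<longrightarrow>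
    (\<exists>\<phi>\<in>C2_Lweighted s p x r. (\<forall>z. \<phi> z = ereal (if z \<in> hball x r
        then v x + \<sigma> * (norm (x \<diamondop> (- a)))\<^sup>2 - \<sigma> * (norm (z \<diamondop> (- a)))\<^sup>2 else u z)) \<and>
      (\<exists>\<delta>. \<bar>\<delta>\<bar> \<le> e \<and> nonlocal_op p K \<phi> x = ereal (2 * trunc_op r v x + \<delta>)))"
    by (elim exE conjE)
  show "\<exists>r0>0. \<forall>r x a. 0 < r \<and> r < r0 \<and> norm x \<le> R \<and> norm a \<le> R \<and> hball x r \<subseteq> A \<and>
     (\<forall>z\<in>hball x r. v x + \<sigma> * (norm (x \<diamondop> (- a)))\<^sup>2 - \<sigma> * (norm (z \<diamondop> (- a)))\<^sup>2 \<le> v z) \<longrightarrow> f x \<le> 2 * trunc_op r v x + e"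
  proof (intro exI[of _ r0] conjI r0 allI impI)
    fix r x a
    assume asm: "0 < r \<and> r < r0 \<and> norm x \<le> R \<and> norm a \<le> R \<and> hball x r \<subseteq> A \<and>
     (\<forall>z\<in>hball x r. v x + \<sigma> * (norm (x \<diamondop> (- a)))\<^sup>2 - \<sigma> * (norm (z \<diamondop> (- a)))\<^sup>2 \<le> v z)"
    from asm test obtain \<phi> \<delta> where C2: "\<phi> \<in> C2_Lweighted s p x r"
      and \<phi>: "\<And>z. \<phi> z = ereal (if z \<in> hball x r
        then v x + \<sigma> * (norm (x \<diamondop> (- a)))\<^sup>2 - \<sigma> * (norm (z \<diamondop> (- a)))\<^sup>2 else u z)"
      and \<delta>: "\<bar>\<delta>\<bar> \<le> e" "nonlocal_op p K \<phi> x = ereal (2 * trunc_op r v x + \<delta>)" by blast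
    have vu: "v z = u z" if "z \<in> hball x r" for z using that asm by (intro eq) blast
    have "\<phi> z \<le> ereal (u z)" for z
    proof (cases "z \<in> hball x r")
      case True
      then have "v x + \<sigma> * (norm (x \<diamondop> (- a)))\<^sup>2 - \<sigma> * (norm (z \<diamondop> (- a)))\<^sup>2 \<le> v z"
        using asm by blast
      then show ?thesis using True vu by (simp add: \<phi>)
    qed (simp add: \<phi>)
    moreover have "\<phi> x = ereal (u x)" using asm vu by (simp add: \<phi>)
    moreover have "hball x r \<subseteq> \<Omega>" using asm A by blast
    ultimately have "nonlocal_op p K (glue x r \<phi> (\<lambda>z. ereal (u z))) x \<ge> ereal (f x)"
      using vis asm C2 unfolding viscosity_supersolution_def by blast
    \<comment> \<open>Outside the ball \<open>\<phi>\<close> is already \<open>u\<close>, so gluing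
      again changes nothing.\<close>
    moreover have "glue x r \<phi> (\<lambda>z. ereal (u z)) = \<phi>"
      by (auto simp: glue_def fun_eq_iff \<phi>)
    ultimately show "f x \<le> 2 * trunc_op r v x + e"
      using \<delta> by simp
  qed
qed

text \<open>Mirror image: a paraboloid below \<open>- v\<close> is the negative of one above
  \<open>v\<close>, hence \<open>- \<sigma>\<close>, and oddness of \<open>signed_pow\<close> makes
  the truncated operator odd.\<close>

lemma viscosity_subsolution_touched_below:
  assumes vis: "viscosity_subsolution s p K f \<Omega> (\<lambda>z. ereal (u z))" and u: "u \<in> Linfty"
    and A: "A \<subseteq> \<Omega>" and v: "v \<in> borel_measurable borel" "\<And>z. \<bar>v z\<bar> \<le> M"
    and AE: "AE z in lebesgue. u z = v z" and eq: "\<And>z. z \<in> A \<Longrightarrow> v z = u z"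
  shows "touched_below A (\<lambda>z. - f z) (\<lambda>z. - v z)"
  unfolding touched_below_def
proof (intro allI impI)
  fix R \<sigma> e :: real assume e: "0 < e"
  from operator_paraboloid[where v=v and M=M and R=R and \<sigma>="- \<sigma>", OF e u v AE]
  obtain r0 where r0: "0 < r0" and test: "\<forall>r x a. 0 < r \<and> r < r0 \<and> norm x \<le> R \<and> norm a \<le> R \<longrightarrow>
    (\<exists>\<phi>\<in>C2_Lweighted s p x r. (\<forall>z. \<phi> z = ereal (if z \<in> hball x r
        then v x + (- \<sigma>) * (norm (x \<diamondop> (- a)))\<^sup>2 - (- \<sigma>) * (norm (z \<diamondop> (- a)))\<^sup>2 else u z)) \<and>
      (\<exists>\<delta>. \<bar>\<delta>\<bar> \<le> e \<and> nonlocal_op p K \<phi> x = ereal (2 * trunc_op r v x + \<delta>)))"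
    by (elim exE conjE)
  show "\<exists>r0>0. \<forall>r x a. 0 < r \<and> r < r0 \<and> norm x \<le> R \<and> norm a \<le> R \<and> hball x r \<subseteq> A \<and>
     (\<forall>z\<in>hball x r. - v x + \<sigma> * (norm (x \<diamondop> (- a)))\<^sup>2 - \<sigma> * (norm (z \<diamondop> (- a)))\<^sup>2 \<le> - v z) \<longrightarrow> - f x \<le> 2 * trunc_op r (\<lambda>z. - v z) x + e"
  proof (intro exI[of _ r0] conjI r0 allI impI)
    fix r x a
    assume asm: "0 < r \<and> r < r0 \<and> norm x \<le> R \<and> norm a \<le> R \<and> hball x r \<subseteq> A \<and>
     (\<forall>z\<in>hball x r. - v x + \<sigma> * (norm (x \<diamondop> (- a)))\<^sup>2 - \<sigma> * (norm (z \<diamondop> (- a)))\<^sup>2 \<le> - v z)"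
    from asm test obtain \<phi> \<delta> where C2: "\<phi> \<in> C2_Lweighted s p x r"
      and \<phi>: "\<And>z. \<phi> z = ereal (if z \<in> hball x r
        then v x + (- \<sigma>) * (norm (x \<diamondop> (- a)))\<^sup>2 - (- \<sigma>) * (norm (z \<diamondop> (- a)))\<^sup>2 else u z)"
      and \<delta>: "\<bar>\<delta>\<bar> \<le> e" "nonlocal_op p K \<phi> x = ereal (2 * trunc_op r v x + \<delta>)" by blast
    have vu: "v z = u z" if "z \<in> hball x r" for z using that asm by (intro eq) blast
    have "ereal (u z) \<le> \<phi> z" for z
    proof (cases "z \<in> hball x r")
      case True
      then have "- v x + \<sigma> * (norm (x \<diamondop> (- a)))\<^sup>2 - \<sigma> * (norm (z \<diamondop> (- a)))\<^sup>2 \<le> - v z"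
        using asm by blast
      then show ?thesis using True vu by (simp add: \<phi>)
    qed (simp add: \<phi>)
    moreover have "\<phi> x = ereal (u x)" using asm vu by (simp add: \<phi>)
    moreover have "hball x r \<subseteq> \<Omega>" using asm A by blast
    ultimately have "nonlocal_op p K (glue x r \<phi> (\<lambda>z. ereal (u z))) x \<le> ereal (f x)"
      using vis asm C2 unfolding viscosity_subsolution_def by blast
    moreover have "glue x r \<phi> (\<lambda>z. ereal (u z)) = \<phi>"
      by (auto simp: glue_def fun_eq_iff \<phi>)
    moreover have "trunc_op r (\<lambda>z. - v z) x = - trunc_op r v x"
    proof -
      have "signed_pow p (- v x - - v (x \<diamondop> g)) = - signed_pow p (v x - v (x \<diamondop> g))" for g
        using signed_pow_minus[of p "v x - v (x \<diamondop> g)"] by simp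
      then show ?thesis unfolding trunc_op_def by (simp only: mult_minus_left mult_minus_right Bochner_Integration.integral_minus)
    qed
    ultimately show "- f x \<le> 2 * trunc_op r (\<lambda>z. - v z) x + e"
      using \<delta> by simp
  qed
qed

end

section \<open>Inf-convolution along left translations\<close>

text \<open>The competitor \<open>y\<close> stands for \<open>h \<diamondop> x\<close>, so
  \<open>y \<diamondop> (- x)\<close> is the translation \<open>h\<close>. Competitors are
  restricted to \<open>A\<close>, where compactness and semicontinuity will be available; outside
  \<open>A\<close> the function is left as it is.\<close>

definition infconv :: "'n::finite heis set \<Rightarrow> ('n heis \<Rightarrow> real) \<Rightarrow> nat \<Rightarrow> 'n heis \<Rightarrow> real" where
  "infconv A v n x = (if x \<in> A then INF y\<in>A. v y + real n * (norm (y \<diamondop> (- x)))\<^sup>2 else v x)"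

lemma dist_left_translate_le:
  "norm (y - x) \<le> (1 + 4 * norm x) * norm (y \<diamondop> (- x :: 'n::finite heis))"
  using norm_hmult_diff_le(2)[of "y \<diamondop> (- x)" x] by (simp add: hmult_assoc)

context
  fixes A :: "'n::finite heis set" and v :: "'n heis \<Rightarrow> real" and M :: real
  assumes M: "\<And>z. \<bar>v z\<bar> \<le> M"
begin

lemma infconv_bdd: "bdd_below ((\<lambda>y. v y + real n * (norm (y \<diamondop> (- x)))\<^sup>2) ` A)"
proof (rule bdd_belowI2[of _ "- M"])
  fix y
  have "- M \<le> v y" using M[of y] by linarith
  then show "- M \<le> v y + real n * (norm (y \<diamondop> (- x)))\<^sup>2" by (simp add: add_increasing2)
qed

lemma infconv_le: "x \<in> A \<Longrightarrow> y \<in> A \<Longrightarrow> infconv A v n x \<le> v y + real n * (norm (y \<diamondop> (- x)))\<^sup>2"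
  unfolding infconv_def using cINF_lower[OF infconv_bdd] by simp

lemma infconv_le_self: "infconv A v n x \<le> v x"
  using infconv_le[of x x n] by (cases "x \<in> A") (auto simp: infconv_def)

lemma abs_infconv_le: "\<bar>infconv A v n x\<bar> \<le> M"
proof -
  have "- M \<le> infconv A v n x"
  proof (cases "x \<in> A")
    case True
    have "- M \<le> v y + real n * (norm (y \<diamondop> (- x)))\<^sup>2" for y
      using M[of y] by (intro add_increasing2) (auto simp: abs_le_iff)
    then show ?thesis using True by (auto simp: infconv_def intro!: cINF_greatest)
  qed (use M[of x] in \<open>auto simp: infconv_def\<close>)
  then show ?thesis using infconv_le_self[of n x] M[of x] by linarith
qed

text \<open>The penalised value is continuous in \<open>x\<close> for fixed \<open>y\<close>. Strict
  sublevel sets of the infimum are therefore unions of open sets, and the uncountable index set does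
  no harm.\<close>

lemma infconv_measurable:
  assumes A: "A \<in> sets borel" and v [measurable]: "v \<in> borel_measurable borel"
  shows "infconv A v n \<in> borel_measurable borel"
proof -
  define F where "F y x = v y + real n * (norm (y \<diamondop> (- x)))\<^sup>2" for x y
  have "(\<lambda>x. if x \<in> A then (INF y\<in>A. F y x) else v x) \<in> borel_measurable borel"
  proof (rule measurable_If_restrict_space_iff[THEN iffD2])
    show "{x \<in> space borel. x \<in> A} \<in> sets borel" using A by simp
    show "(\<lambda>x. INF y\<in>A. F y x) \<in> restrict_space borel {x. x \<in> A} \<rightarrow>\<^sub>M borel \<and>
        v \<in> restrict_space borel {x. x \<notin> A} \<rightarrow>\<^sub>M borel"
    proof
      show "(\<lambda>x. INF y\<in>A. F y x) \<in> restrict_space borel {x. x \<in> A} \<rightarrow>\<^sub>M borel"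
      proof (cases "A = {}")
        case False
        have "{x. (INF y\<in>A. F y x) < a} = (\<Union>y\<in>A. {x. F y x < a})" for a
          using False infconv_bdd[of n] by (auto simp: cINF_less_iff F_def)
        moreover have "open {x. F y x < a}" for y a
          unfolding F_def by (intro open_Collect_less continuous_intros)
        ultimately have "open {x. (INF y\<in>A. F y x) < a}" for a by auto
        then have "(\<lambda>x. INF y\<in>A. F y x) \<in> borel_measurable borel"
          by (subst borel_measurable_iff_less) auto
        then show ?thesis by (rule measurable_restrict_space1)
      qed simp
      show "v \<in> restrict_space borel {x. x \<notin> A} \<rightarrow>\<^sub>M borel"
        by (intro measurable_restrict_space1 v)
    qed
  qed
  then show ?thesis unfolding infconv_def F_def .
qed

text \<open>Direct method: a minimising sequence has a limit point in \<open>A\<close>, where lower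
  semicontinuity of \<open>v\<close> and continuity of the penalty give the infimum.\<close>

lemma infconv_attained:
  assumes A: "compact A" and x: "x \<in> A" and lsc: "\<And>a. openin (top_of_set A) {x\<in>A. a < v x}"
  obtains y where "y \<in> A" "infconv A v n x = v y + real n * (norm (y \<diamondop> (- x)))\<^sup>2"
proof -
  define F where "F y = v y + real n * (norm (y \<diamondop> (- x)))\<^sup>2" for y
  define m where "m = (INF y\<in>A. F y)"
  have m: "m = infconv A v n x" using x by (simp add: m_def infconv_def F_def)
  have "\<exists>y\<in>A. F y < m + inverse (real (Suc j))" for j
  proof -
    have "(INF y\<in>A. F y) < m + inverse (real (Suc j))" unfolding m_def by simp
    then show ?thesis
      using x infconv_bdd[of n x] by (subst (asm) cINF_less_iff) (auto simp: F_def)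
  qed
  then obtain Y where Y: "\<And>j. Y j \<in> A" "\<And>j. F (Y j) < m + inverse (real (Suc j))" by metis
  obtain y r where y: "y \<in> A" and r: "strict_mono r" "(Y \<circ> r) \<longlonglongrightarrow> y"
    using A Y(1) unfolding compact_def by metis
  have inv: "(\<lambda>j. m + inverse (real (Suc (r j)))) \<longlonglongrightarrow> m"
    using tendsto_add[OF tendsto_const LIMSEQ_subseq_LIMSEQ[OF LIMSEQ_inverse_real_of_nat r(1)], of m]
    by (simp add: o_def)
  have "F y \<le> m + e" if e: "0 < e" for e
  proof -
    obtain T where T: "open T" "{z\<in>A. v y - e < v z} = A \<inter> T"
      using lsc[of "v y - e"] unfolding openin_open by blast
    have "y \<in> A \<inter> T" using y e unfolding T(2)[symmetric] by simp
    then have "\<forall>\<^sub>F j in sequentially. (Y \<circ> r) j \<in> T" using topological_tendstoD[OF r(2) T(1)] by simp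
    then have ev: "\<forall>\<^sub>F j in sequentially. v y - e + real n * (norm (Y (r j) \<diamondop> (- x)))\<^sup>2 \<le> m + inverse (real (Suc (r j)))"
    proof eventually_elim
      case (elim j)
      then have "Y (r j) \<in> A \<inter> T" using Y by simp
      then have "v y - e < v (Y (r j))" unfolding T(2)[symmetric] by simp
      then show ?case using Y(2)[of "r j"] by (simp add: F_def)
    qed
    have "continuous_on UNIV (\<lambda>z. v y - e + real n * (norm (z \<diamondop> (- x)))\<^sup>2)"
      by (intro continuous_intros)
    then have "(\<lambda>j. v y - e + real n * (norm ((Y \<circ> r) j \<diamondop> (- x)))\<^sup>2) \<longlonglongrightarrow> v y - e + real n * (norm (y \<diamondop> (- x)))\<^sup>2"
      using r(2) by (rule continuous_on_tendsto_compose) auto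
    from tendsto_le[OF _ inv this[unfolded o_def] ev]
    show ?thesis by (simp add: F_def)
  qed
  then have "F y \<le> m" by (rule field_le_epsilon)
  moreover have "m \<le> F y" using infconv_le[OF x y, of n] by (simp add: m F_def)
  ultimately show ?thesis using that[OF y] m by (simp add: F_def)
qed

text \<open>A minimiser in the neighbourhood \<open>T\<close> loses less than \<open>e\<close> by
  lower semicontinuity. One outside \<open>T\<close> pays a penalty above \<open>2 * M\<close>, more
  than the oscillation of \<open>v\<close>.\<close>

lemma infconv_tendsto:
  assumes A: "compact A" and lsc: "\<And>a. openin (top_of_set A) {x\<in>A. a < v x}"
  shows "(\<lambda>n. infconv A v n x) \<longlonglongrightarrow> v x"
proof (cases "x \<in> A")
  case True
  show ?thesis
  proof (rule LIMSEQ_I)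
    fix e :: real assume e: "0 < e"
    obtain T where T: "open T" "{z\<in>A. v x - e < v z} = A \<inter> T"
      using lsc[of "v x - e"] unfolding openin_open by blast
    have "x \<in> A \<inter> T" using True e unfolding T(2)[symmetric] by simp
    then obtain d where d: "0 < d" "ball x d \<subseteq> T" using T(1) by (metis IntD2 openE)
    \<comment> \<open>Leaving the Euclidean ball of radius \<open>d\<close> around \<open>x\<close>
      takes a left translation of norm at least \<open>c\<close>.\<close>
    define c where "c = d / (1 + 4 * norm x)"
    have c: "0 < c" using d by (simp add: c_def add_pos_nonneg)
    have M0: "0 \<le> M" using M[of x] by linarith
    obtain N :: nat where N: "2 * M / c\<^sup>2 < real N" using reals_Archimedean2 by blast
    show "\<exists>no. \<forall>n\<ge>no. norm (infconv A v n x - v x) < e"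
    proof (intro exI[of _ N] allI impI)
      fix n assume n: "N \<le> n"
      obtain y where y: "y \<in> A" "infconv A v n x = v y + real n * (norm (y \<diamondop> (- x)))\<^sup>2"
        using infconv_attained[OF A True lsc] by blast
      have "v x - e < infconv A v n x"
      proof (cases "y \<in> T")
        case True
        then have "y \<in> {z\<in>A. v x - e < v z}" using y T(2) by blast
        then have "v x - e < v y" by simp
        moreover have "0 \<le> real n * (norm (y \<diamondop> (- x)))\<^sup>2" by simp
        ultimately show ?thesis unfolding y(2) by linarith
      next
        case False
        then have "y \<notin> ball x d" using d by blast
        then have "d \<le> norm (y - x)" by (simp add: dist_norm norm_minus_commute)
        also note dist_left_translate_le
        finally have "c \<le> norm (y \<diamondop> (- x))"
          by (simp add: c_def divide_le_eq add_pos_nonneg mult.commute)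
        then have "c\<^sup>2 \<le> (norm (y \<diamondop> (- x)))\<^sup>2" using c by (intro power_mono) auto
        then have "real N * c\<^sup>2 \<le> real n * (norm (y \<diamondop> (- x)))\<^sup>2" using n by (intro mult_mono) auto
        moreover have "2 * M < real N * c\<^sup>2" using N c by (simp add: divide_less_eq)
        ultimately show ?thesis using M[of y] M[of x] e unfolding y(2) abs_le_iff by linarith
      qed
      then show "norm (infconv A v n x - v x) < e" using infconv_le_self[of n x] by simp
    qed
  qed
qed (simp add: infconv_def)

lemma infconv_minimizer_near:
  assumes "infconv A v n x = v y + real n * (norm (y \<diamondop> (- x)))\<^sup>2" "0 < c" "2 * M / c\<^sup>2 < real n"
  shows "norm (y \<diamondop> (- x)) < c"
proof (rule ccontr)
  assume "\<not> norm (y \<diamondop> (- x)) < c"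
  then have "c\<^sup>2 \<le> (norm (y \<diamondop> (- x)))\<^sup>2" using assms by (intro power_mono) auto
  then have "real n * c\<^sup>2 \<le> real n * (norm (y \<diamondop> (- x)))\<^sup>2" by (rule mult_left_mono) simp
  moreover have "2 * M < real n * c\<^sup>2" using assms by (simp add: divide_less_eq)
  ultimately show False using infconv_le_self[of n x] M[of y] M[of x] assms(1) by linarith
qed

end

text \<open>The right increment from \<open>y\<close> to \<open>x\<close> is the inverse of a
  conjugate of the left translation \<open>y \<diamondop> (- x)\<close>. This bound makes the shift
  of the kernel variable small when the optimal translation is small.\<close>

lemma norm_conj_le: "norm ((- x) \<diamondop> (h \<diamondop> x)) \<le> (1 + 4 * norm x) * ((1 + 4 * norm x) * norm (h :: 'n::finite heis))"
proof -
  define L where "L = (\<lambda>g. (- x) \<diamondop> g - (- x))"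
  interpret bounded_linear L unfolding L_def by (rule linear_left_mult)
  have Lx: "L x = x" "(- x) \<diamondop> (h \<diamondop> x) = L (h \<diamondop> x) - x" by (simp_all add: L_def)
  then have "(- x) \<diamondop> (h \<diamondop> x) = L (h \<diamondop> x - x)" by (simp add: diff)
  then have "norm ((- x) \<diamondop> (h \<diamondop> x)) \<le> (1 + 4 * norm (- x)) * norm (h \<diamondop> x - x)"
    unfolding L_def by (metis norm_hmult_diff_le(1))
  also have "\<dots> \<le> (1 + 4 * norm x) * ((1 + 4 * norm x) * norm h)"
    using norm_hmult_diff_le(2)[of h x] by (simp add: mult_left_mono)
  finally show ?thesis .
qed

section \<open>The truncated operator on the inf-convolution\<close>

context heis_kernel
begin

text \<open>Along translations tending to the identity the functions converge pointwise and, by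
  invariance of the measure, keep their norm in L1. Scheffe's lemma turns this into convergence in
  L1.\<close>

lemma translation_continuous_L1:
  fixes F :: "'n heis \<Rightarrow> real"
  assumes F: "continuous_on UNIV F" "\<And>g :: 'n heis. 0 \<le> F g" "integrable lborel F" and e: "0 < e"
  shows "\<exists>d>0. \<forall>y :: 'n heis. norm y < d \<longrightarrow> (\<integral>g. \<bar>F (y \<diamondop> g) - F g\<bar> \<partial>lborel) < e"
proof (rule ccontr)
  assume contra: "\<not> ?thesis"
  define I where "I y = (\<integral>g. \<bar>F (y \<diamondop> g) - F g\<bar> \<partial>lborel)" for y
  have contra': "\<not> (\<exists>d>0. \<forall>y. norm y < d \<longrightarrow> I y < e)"
    using contra unfolding I_def by blast
  have ex: "\<exists>y. norm y < inverse (real (Suc j)) \<and> e \<le> I y" for j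
  proof (rule ccontr)
    assume a: "\<not> ?thesis"
    have "I y < e" if "norm y < inverse (real (Suc j))" for y
      using a that by (meson not_less)
    moreover have "0 < inverse (real (Suc j))" by simp
    ultimately have "\<exists>d>0. \<forall>y. norm y < d \<longrightarrow> I y < e" by blast
    then show False using contra' by (rule notE[rotated])
  qed
  have "\<exists>y. \<forall>j. norm (y j) < inverse (real (Suc j)) \<and> e \<le> I (y j)"
    by (rule choice, rule allI, rule ex)
  then obtain y where y: "\<And>j. norm (y j) < inverse (real (Suc j))" "\<And>j. e \<le> I (y j)"
    by blast
  have [measurable]: "F \<in> borel_measurable borel" using F(1) by (rule borel_measurable_continuous_onI)
  have "y \<longlonglongrightarrow> 0"
    by (rule Lim_null_comparison[OF always_eventually[OF allI[OF less_imp_le[OF y(1)]]] LIMSEQ_inverse_real_of_nat])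
  have int: "integrable lborel (\<lambda>g. F (y j \<diamondop> g))" for j
    using F(3) by (subst integrable_hmult_iff) auto
  have lim: "(\<lambda>j. \<integral>\<^sup>+g. norm (F (y j \<diamondop> g) - F g) \<partial>lborel) \<longlonglongrightarrow> 0"
  proof (rule Scheffe_lemma2)
    show "AE g in lborel. (\<lambda>j. F (y j \<diamondop> g)) \<longlonglongrightarrow> F g"
    proof (intro always_eventually allI)
      fix g
      have "continuous_on UNIV (\<lambda>z. F (z \<diamondop> g))"
        by (intro continuous_on_compose2[OF F(1)] continuous_intros) auto
      from continuous_on_tendsto_compose[OF this \<open>y \<longlonglongrightarrow> 0\<close>]
      show "(\<lambda>j. F (y j \<diamondop> g)) \<longlonglongrightarrow> F g" by simp
    qed
    show "(\<integral>\<^sup>+g. ennreal (norm (F (y j \<diamondop> g))) \<partial>lborel) \<le> (\<integral>\<^sup>+g. ennreal (norm (F g)) \<partial>lborel)" for j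
      by (subst nn_integral_hmult[of "\<lambda>g. ennreal (norm (F g))"]) auto
  qed (use F(3) in auto)
  have low: "ennreal e \<le> (\<integral>\<^sup>+g. norm (F (y j \<diamondop> g) - F g) \<partial>lborel)" for j
  proof -
    have "ennreal e \<le> ennreal (\<integral>g. norm (F (y j \<diamondop> g) - F g) \<partial>lborel)" using y(2)[of j] by (intro ennreal_leI) (simp add: I_def)
    also have "\<dots> = (\<integral>\<^sup>+g. norm (F (y j \<diamondop> g) - F g) \<partial>lborel)"
      using int[of j] F(3) by (intro nn_integral_eq_integral[symmetric]) auto
    finally show ?thesis .
  qed
  have "ennreal e \<le> 0"
    by (rule LIMSEQ_le_const[OF lim]) (use low in blast)
  then show False using e by simp
qed

text \<open>A continuous transition from 0 to 1 between \<open>hnorm g = \<rho>\<close> and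
  \<open>hnorm g = 2 * \<rho>\<close>. The product with \<open>k\<close> is then continuous, as
  \<open>translation_continuous_L1\<close> asks; a sharp indicator would jump.\<close>

definition cutoff :: "real \<Rightarrow> 'n heis \<Rightarrow> real" where
  "cutoff \<rho> g = min 1 (max 0 (hnorm g / \<rho> - 1))"

lemma cutoff_props:
  assumes "0 < \<rho>"
  shows "0 \<le> cutoff \<rho> g" "cutoff \<rho> g \<le> 1" "hnorm g \<le> \<rho> \<Longrightarrow> cutoff \<rho> g = 0" "2 * \<rho> \<le> hnorm g \<Longrightarrow> cutoff \<rho> g = 1"
  using assms by (auto simp: cutoff_def field_simps)

lemma cutoff_measurable [measurable]: "cutoff \<rho> \<in> borel_measurable borel"
  unfolding cutoff_def by measurable

lemma continuous_cutoff_kernel: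
  assumes \<rho>: "0 < \<rho>" shows "continuous_on UNIV (\<lambda>g. cutoff \<rho> g * k g)"
proof -
  have "continuous_on (- {0}) (\<lambda>g. cutoff \<rho> g * k g)"
    unfolding cutoff_def using \<rho> by (intro continuous_intros continuous_k) auto
  moreover have "continuous_on (hball 0 \<rho>) (\<lambda>g. cutoff \<rho> g * k g)"
    using \<rho> by (intro continuous_on_eq[OF continuous_on_const[of _ 0]]) (auto simp: hball_def cutoff_props)
  ultimately have "continuous_on (- {0} \<union> hball 0 \<rho>) (\<lambda>g. cutoff \<rho> g * k g)"
    by (intro continuous_on_open_Un) auto
  moreover have "- {0} \<union> hball 0 \<rho> = (UNIV :: 'n heis set)" using \<rho> by auto
  ultimately show ?thesis by (simp only:)
qed

lemma integrable_cutoff_kernel: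
  assumes \<rho>: "0 < \<rho>" shows "integrable lborel (\<lambda>g. cutoff \<rho> g * k g)"
proof (rule integrable_k_away[of _ 1 \<rho>])
  show "\<bar>cutoff \<rho> g\<bar> \<le> 1" for g using cutoff_props[OF \<rho>, of g] by simp
qed (use \<rho> in \<open>simp_all add: cutoff_props\<close>)

text \<open>If \<open>h\<close> is the optimal translation for \<open>w = infconv A v n\<close> at \<open>x\<close>, then \<open>w\<close> increases less
  from \<open>x\<close> to a nearby \<open>x \<diamondop> g\<close> than \<open>v\<close> does from \<open>h \<diamondop> x\<close> to \<open>h \<diamondop> x \<diamondop> g\<close>. Far away this comparison
  is unavailable, but there the kernel is continuous under translation in \<open>L\<^sup>1\<close>.\<close>

lemma trunc_op_infconv_ge:
  assumes M: "\<And>z. \<bar>v z\<bar> \<le> M" and v [measurable]: "v \<in> borel_measurable borel" and A: "A \<in> sets borel"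
    and x: "x \<in> A" and y: "infconv A v n x = v y + real n * (norm (y \<diamondop> (- x)))\<^sup>2" 
    and near: "\<And>g. hnorm g < 2 * \<rho> \<Longrightarrow> x \<diamondop> g \<in> A \<and> y \<diamondop> g \<in> A"
    and \<rho>: "0 < \<tau>" "\<tau> \<le> \<rho>"
  shows "trunc_op \<tau> v y - (2 * M) powr (p - 1) * (\<integral>g. \<bar>cutoff \<rho> (((- y) \<diamondop> x) \<diamondop> g) * k (((- y) \<diamondop> x) \<diamondop> g) - cutoff \<rho> g * k g\<bar> \<partial>lborel)
     \<le> trunc_op \<tau> (infconv A v n) x"
proof -
  define w where "w = infconv A v n"
  have wb [measurable]: "w \<in> borel_measurable borel" unfolding w_def using infconv_measurable[where v=v, OF M A v] .
  have wM: "\<bar>w z\<bar> \<le> M" for z unfolding w_def by (rule abs_infconv_le[where v=v, OF M])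
  define B where "B = (2 * M) powr (p - 1)"
  have J: "\<bar>signed_pow p (a - b)\<bar> \<le> B" if "\<bar>a\<bar> \<le> M" "\<bar>b\<bar> \<le> M" for a b
    unfolding B_def using that p by (intro abs_signed_pow_le) linarith+
  have B0: "0 \<le> B" by (simp add: B_def)
  have \<rho>0: "0 < \<rho>" using \<rho> by simp
  note cp = cutoff_props[OF \<rho>0]
  \<comment> \<open>Left multiplication by \<open>q\<close> turns an increment seen from
    \<open>x\<close> into the increment seen from \<open>y\<close> that leads to the same
    point.\<close>
  define q where "q = (- y) \<diamondop> x"
  define ct where "ct = cutoff \<rho>"
  have [measurable]: "ct \<in> borel_measurable borel" unfolding ct_def by measurable
  have ct: "0 \<le> ct g" "ct g \<le> 1" "hnorm g < \<tau> \<Longrightarrow> ct g = 0" "2 * \<rho> \<le> hnorm g \<Longrightarrow> ct g = 1" for g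
    unfolding ct_def using cp[of g] \<rho> by auto
  have ct_abs: "\<bar>ct g\<bar> \<le> 1" for g using ct[of g] by simp
  define far where "far c z = (\<integral>g. (ct g * signed_pow p (c - v (z \<diamondop> g))) * k g \<partial>lborel)" for c z
  have int: "integrable lborel (\<lambda>g. (a g * signed_pow p (c - f g)) * k g)"
    if [measurable]: "a \<in> borel_measurable borel" "f \<in> borel_measurable borel"
      and "\<And>g. \<bar>a g\<bar> \<le> 1" "\<And>g. hnorm g < \<tau> \<Longrightarrow> a g = 0" "\<bar>c\<bar> \<le> M" "\<And>g. \<bar>f g\<bar> \<le> M" for a f c
  proof (rule integrable_k_away[of _ B \<tau>])
    fix g
    have "\<bar>a g\<bar> * \<bar>signed_pow p (c - f g)\<bar> \<le> 1 * B" using that J by (intro mult_mono) auto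
    then show "\<bar>a g * signed_pow p (c - f g)\<bar> \<le> B" by (simp add: abs_mult)
  qed (use that \<rho> in auto)
  let ?I = "\<lambda>g. indicat_real {g. \<tau> \<le> hnorm g} g"
  \<comment> \<open>The near part of the truncation: nonnegative because \<open>ct\<close> vanishes
    up to \<open>\<rho>\<close>, which is at least \<open>\<tau>\<close>, and zero beyond
    \<open>2 * \<rho>\<close>, where membership in \<open>A\<close> is no longer guaranteed.\<close>
  let ?N = "\<lambda>g. ?I g - ct g"
  have N: "\<bar>?N g\<bar> \<le> 1" "0 \<le> ?N g" "hnorm g < \<tau> \<Longrightarrow> ?N g = 0" "2 * \<rho> \<le> hnorm g \<Longrightarrow> ?N g = 0" for g
    using ct[of g] \<rho> by (auto simp: indicator_def)
  have intN: "integrable lborel (\<lambda>g. (?N g * signed_pow p (c - f (z \<diamondop> g))) * k g)"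
    if [measurable]: "f \<in> borel_measurable borel" and f: "\<And>z. \<bar>f z\<bar> \<le> M" and c: "\<bar>c\<bar> \<le> M" for f c z
  proof (rule int)
    show "?N \<in> borel_measurable borel" "(\<lambda>g. f (z \<diamondop> g)) \<in> borel_measurable borel" by measurable
    show "\<bar>?N g\<bar> \<le> 1" for g by (rule N)
    show "?N g = 0" if "hnorm g < \<tau>" for g using that by (rule N)
  qed (rule c f)+
  have intct: "integrable lborel (\<lambda>g. (ct g * signed_pow p (c - f (z \<diamondop> g))) * k g)"
    if [measurable]: "f \<in> borel_measurable borel" and f: "\<And>z. \<bar>f z\<bar> \<le> M" and c: "\<bar>c\<bar> \<le> M" for f c z
  proof (rule int)
    show "ct \<in> borel_measurable borel" "(\<lambda>g. f (z \<diamondop> g)) \<in> borel_measurable borel" by measurable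
    show "\<bar>ct g\<bar> \<le> 1" for g by (rule ct_abs)
    show "ct g = 0" if "hnorm g < \<tau>" for g using that by (rule ct)
  qed (rule c f)+
  have split: "trunc_op \<tau> f z = (\<integral>g. (?N g * signed_pow p (f z - f (z \<diamondop> g))) * k g \<partial>lborel) +
       (\<integral>g. (ct g * signed_pow p (f z - f (z \<diamondop> g))) * k g \<partial>lborel)"
    if [measurable]: "f \<in> borel_measurable borel" and "\<And>z. \<bar>f z\<bar> \<le> M" for f z
  proof -
    have i1: "integrable lborel (\<lambda>g. (?N g * signed_pow p (f z - f (z \<diamondop> g))) * k g)"
      by (rule intN[OF that that(2)])
    have i2: "integrable lborel (\<lambda>g. (ct g * signed_pow p (f z - f (z \<diamondop> g))) * k g)"
      by (rule intct[OF that that(2)])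
    have "?I g * signed_pow p (f z - f (z \<diamondop> g)) * k g =
        (?N g * signed_pow p (f z - f (z \<diamondop> g))) * k g + (ct g * signed_pow p (f z - f (z \<diamondop> g))) * k g" for g
      by (simp add: algebra_simps)
    then show ?thesis
      unfolding trunc_op_def by (simp only: Bochner_Integration.integral_add[OF i1 i2])
  qed
  have vy: "v y \<le> w x" unfolding w_def y by simp
  have 1: "(\<integral>g. (?N g * signed_pow p (v y - v (y \<diamondop> g))) * k g \<partial>lborel) \<le>
      (\<integral>g. (?N g * signed_pow p (w x - w (x \<diamondop> g))) * k g \<partial>lborel)"
  proof (rule integral_mono[OF intN intN])
    fix g
    show "(?N g * signed_pow p (v y - v (y \<diamondop> g))) * k g \<le> (?N g * signed_pow p (w x - w (x \<diamondop> g))) * k g"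
    proof (cases "hnorm g < 2 * \<rho>")
      case True
      have xy: "x \<diamondop> g \<in> A" "y \<diamondop> g \<in> A" using near[OF True] by auto
      \<comment> \<open>A common right factor does not change the left translation, so the
        competitor \<open>y \<diamondop> g\<close> at \<open>x \<diamondop> g\<close> pays the
        penalty that was optimal at \<open>x\<close>, and the penalties cancel in the
        increments.\<close>
      have "(y \<diamondop> g) \<diamondop> (- (x \<diamondop> g)) = y \<diamondop> (- x)"
        by (simp add: neg_hmult hmult_assoc)
      then have "w (x \<diamondop> g) \<le> v (y \<diamondop> g) + real n * (norm (y \<diamondop> (- x)))\<^sup>2"
        using infconv_le[where v=v and n=n, OF M xy] by (simp add: w_def)
      then have "v y - v (y \<diamondop> g) \<le> w x - w (x \<diamondop> g)" unfolding w_def y by simp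
      then show ?thesis by (rule mult_right_mono[OF mult_left_mono[OF signed_pow_mono[OF p(1)] N(2)] k_nonneg])
    next
      case False
      then have "?N g = 0" by (intro N(4)) simp
      then show ?thesis by (simp only: mult_zero_left order_refl)
    qed
  qed (rule wb v M wM)+
  \<comment> \<open>The far part compares values at the common point
    \<open>x \<diamondop> g\<close>, using \<open>v y \<le> w x\<close> and
    \<open>w \<le> v\<close>. The remaining change of base point from \<open>y\<close> to
    \<open>x\<close> is then moved onto the kernel by substituting
    \<open>q \<diamondop> g\<close>.\<close>
  have "far (v y) x \<le> (\<integral>g. (ct g * signed_pow p (w x - w (x \<diamondop> g))) * k g \<partial>lborel)"
    unfolding far_def
  proof (rule integral_mono[OF intct intct])
    fix g
    have "w (x \<diamondop> g) \<le> v (x \<diamondop> g)" unfolding w_def by (rule infconv_le_self[where v=v, OF M])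
    then have "v y - v (x \<diamondop> g) \<le> w x - w (x \<diamondop> g)" using vy by simp
    then show "(ct g * signed_pow p (v y - v (x \<diamondop> g))) * k g \<le> (ct g * signed_pow p (w x - w (x \<diamondop> g))) * k g"
      by (rule mult_right_mono[OF mult_left_mono[OF signed_pow_mono[OF p(1)] ct(1)] k_nonneg])
  qed (rule wb v M wM)+
  moreover have "far (v y) y - B * (\<integral>g. \<bar>ct (q \<diamondop> g) * k (q \<diamondop> g) - ct g * k g\<bar> \<partial>lborel) \<le> far (v y) x"
  proof -
    let ?f = "\<lambda>g. (ct g * signed_pow p (v y - v (y \<diamondop> g))) * k g"
    have yq: "y \<diamondop> (q \<diamondop> g) = x \<diamondop> g" for g by (simp add: q_def flip: hmult_assoc)
    have i1: "integrable lborel ?f"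
      by (rule intct) (rule v M)+
    have i2: "integrable lborel (\<lambda>g. ?f (q \<diamondop> g))"
      using i1 by (subst integrable_hmult_iff) auto
    have i3: "integrable lborel (\<lambda>g. (ct g * signed_pow p (v y - v (x \<diamondop> g))) * k g)"
      by (rule intct) (rule v M)+
    have i4: "integrable lborel (\<lambda>g. ct g * k g)" unfolding ct_def by (rule integrable_cutoff_kernel[OF \<rho>0])
    then have i5: "integrable lborel (\<lambda>g. ct (q \<diamondop> g) * k (q \<diamondop> g))"
      using integrable_hmult_iff[of "\<lambda>g. ct g * k g" q] by simp
    have i6: "integrable lborel (\<lambda>g. B * \<bar>ct (q \<diamondop> g) * k (q \<diamondop> g) - ct g * k g\<bar>)"
      using i4 i5 by (intro integrable_mult_right integrable_abs Bochner_Integration.integrable_diff)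
    have "far (v y) y = (\<integral>g. ?f (q \<diamondop> g) \<partial>lborel)"
      unfolding far_def by (rule integral_hmult[symmetric]) measurable
    also have "\<dots> \<le> (\<integral>g. (ct g * signed_pow p (v y - v (x \<diamondop> g))) * k g + B * \<bar>ct (q \<diamondop> g) * k (q \<diamondop> g) - ct g * k g\<bar> \<partial>lborel)"
    proof (intro integral_mono i2 Bochner_Integration.integrable_add i3 i6)
      fix g
      define S where "S = signed_pow p (v y - v (x \<diamondop> g))"
      have "?f (q \<diamondop> g) - (ct g * S) * k g = S * (ct (q \<diamondop> g) * k (q \<diamondop> g) - ct g * k g)"
        unfolding yq S_def by (simp add: algebra_simps)
      also have "\<dots> \<le> \<bar>S\<bar> * \<bar>ct (q \<diamondop> g) * k (q \<diamondop> g) - ct g * k g\<bar>" by (simp flip: abs_mult)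
      also have "\<dots> \<le> B * \<bar>ct (q \<diamondop> g) * k (q \<diamondop> g) - ct g * k g\<bar>"
        unfolding S_def by (intro mult_right_mono J M) auto
      finally show "?f (q \<diamondop> g) \<le> (ct g * signed_pow p (v y - v (x \<diamondop> g))) * k g + B * \<bar>ct (q \<diamondop> g) * k (q \<diamondop> g) - ct g * k g\<bar>"
        unfolding S_def by simp
    qed
    also have "\<dots> = far (v y) x + B * (\<integral>g. \<bar>ct (q \<diamondop> g) * k (q \<diamondop> g) - ct g * k g\<bar> \<partial>lborel)"
      unfolding far_def using i3 i6 by (subst Bochner_Integration.integral_add) auto
    finally show ?thesis by simp
  qed
  moreover have "trunc_op \<tau> w x = (\<integral>g. (?N g * signed_pow p (w x - w (x \<diamondop> g))) * k g \<partial>lborel) +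
       (\<integral>g. (ct g * signed_pow p (w x - w (x \<diamondop> g))) * k g \<partial>lborel)"
    by (rule split) (rule wb wM)+
  moreover have "trunc_op \<tau> v y = (\<integral>g. (?N g * signed_pow p (v y - v (y \<diamondop> g))) * k g \<partial>lborel) + far (v y) y"
    unfolding far_def by (rule split) (rule v M)+
  ultimately show ?thesis
    unfolding B_def[symmetric] w_def[symmetric] q_def[symmetric] ct_def[symmetric] using 1 by linarith
qed


text \<open>The inequality at \<open>x\<close> is read off at the minimiser \<open>y\<close>, and
  three errors arise: from the touching itself, from \<open>f\<close> between \<open>y\<close> and
  \<open>x\<close>, and from the shifted kernel. The choice of \<open>n\<close> makes the last two
  small uniformly on \<open>D\<close>; the threshold for \<tau> depends on \<open>n\<close> through
  the opening of the paraboloid.\<close>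

lemma touched_below_approximation:
  assumes touch: "touched_below A f v" and M: "\<And>z. \<bar>v z\<bar> \<le> M" and v: "v \<in> borel_measurable borel"
    and A: "compact A" and lsc: "\<And>a. openin (top_of_set A) {x\<in>A. a < v x}" and f: "continuous_on A f"
    and d: "0 < d" "\<And>x z. x \<in> D \<Longrightarrow> norm (z - x) \<le> d \<Longrightarrow> z \<in> A" and e: "0 < e"
  shows "\<exists>n0. \<forall>n\<ge>n0. \<exists>\<tau>0>0. \<forall>\<tau>. 0 < \<tau> \<and> \<tau> < \<tau>0 \<longrightarrow> (\<forall>x\<in>D. f x \<le> 2 * trunc_op \<tau> (infconv A v n) x + e)"
proof -
  have DA: "x \<in> A" if "x \<in> D" for x using d(1) by (intro d(2)[OF that]) simp
  obtain R where R: "0 < R" "\<And>x. x \<in> A \<Longrightarrow> norm x \<le> R"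
    using compact_imp_bounded[OF A] unfolding bounded_pos by blast
  define L where "L = 1 + 4 * R"
  have L: "1 \<le> L" "0 < L" using R by (auto simp: L_def)
  have xL: "(1 + 4 * norm x) \<le> L" if "x \<in> A" for x using R(2)[OF that] by (simp add: L_def)
  \<comment> \<open>The bound \<open>1 / 2\<close> keeps \<open>2 * \<rho>\<close> within the unit
    ball, where \<open>norm_le_hnorm\<close> applies. With \<open>d / (8 * L)\<close>, right factors
    shorter than \<open>2 * \<rho>\<close> move points of \<open>A\<close> by at most
    \<open>d / 2\<close>.\<close>
  define \<rho> where "\<rho> = min (1 / 2) (d / (8 * L))"
  have \<rho>: "0 < \<rho>" "\<rho> \<le> 1 / 2" "L * (4 * \<rho>) \<le> d / 2"
  proof -
    show "0 < \<rho>" "\<rho> \<le> 1 / 2" using L d(1) by (simp_all add: \<rho>_def)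
    have "L * (4 * \<rho>) \<le> L * (4 * (d / (8 * L)))" using L by (intro mult_left_mono) (simp_all add: \<rho>_def)
    also have "\<dots> = d / 2" using L by simp
    finally show "L * (4 * \<rho>) \<le> d / 2" .
  qed
  define B where "B = (2 * M) powr (p - 1)"
  define \<kappa> where "\<kappa> q = (\<integral>g. \<bar>cutoff \<rho> (q \<diamondop> g) * k (q \<diamondop> g) - cutoff \<rho> g * k g\<bar> \<partial>lborel)" for q
  have B: "0 \<le> B" by (simp add: B_def)
  have "0 < e / (8 * (B + 1))" using e B by (intro divide_pos_pos) simp_all
  then have "\<exists>d>0. \<forall>q. norm q < d \<longrightarrow> \<kappa> q < e / (8 * (B + 1))"
    unfolding \<kappa>_def using cutoff_props(1)[OF \<rho>(1)]
    by (intro translation_continuous_L1 continuous_cutoff_kernel integrable_cutoff_kernel \<rho>(1) mult_nonneg_nonneg k_nonneg)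
  then obtain d1 where d1: "0 < d1" "\<And>q. norm q < d1 \<Longrightarrow> \<kappa> q < e / (8 * (B + 1))" by blast
  have "0 < e / 4" using e by simp
  then obtain d2 where d2: "0 < d2" "\<And>x y. x \<in> A \<Longrightarrow> y \<in> A \<Longrightarrow> dist y x < d2 \<Longrightarrow> dist (f y) (f x) < e / 4"
    using uniformly_continuous_onE[OF compact_uniformly_continuous[OF f A]] by blast
  \<comment> \<open>Conjugation costs two factors \<open>L\<close>. A left translation shorter than
    \<open>c\<close> then moves \<open>x\<close> by less than \<open>d / 2\<close> and
    \<open>d2\<close>, and shifts the kernel variable by less than \<open>d1\<close>.\<close>
  define c where "c = min (d / 2) (min d1 d2) / (L * L)"
  have c: "0 < c" "L * (L * c) \<le> d / 2" "L * (L * c) \<le> d1" "L * (L * c) \<le> d2"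
  proof -
    have m: "0 < min (d / 2) (min d1 d2)" using d(1) d1(1) d2(1) by simp
    then show "0 < c" unfolding c_def using L by (intro divide_pos_pos mult_pos_pos)
    have "L * (L * c) = min (d / 2) (min d1 d2)" using L by (simp add: c_def)
    then show "L * (L * c) \<le> d / 2" "L * (L * c) \<le> d1" "L * (L * c) \<le> d2" by simp_all
  qed
  \<comment> \<open>From \<open>n0\<close> on, a translation of length \<open>c\<close> would cost
    more than \<open>2 * M\<close>, so every minimiser stays closer than that.\<close>
  obtain n0 :: nat where n0: "2 * M / c\<^sup>2 < real n0" using reals_Archimedean2 by blast
  show ?thesis
  proof (intro exI[of _ n0] allI impI)
    fix n assume n: "n0 \<le> n"
    have "0 < e / 4" using e by simp
    then obtain r0 where r0: "0 < r0" and tb: "\<forall>r x a. 0 < r \<and> r < r0 \<and> norm x \<le> R \<and> norm a \<le> R \<and> hball x r \<subseteq> A \<and>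
     (\<forall>z\<in>hball x r. v x + real n * (norm (x \<diamondop> (- a)))\<^sup>2 - real n * (norm (z \<diamondop> (- a)))\<^sup>2 \<le> v z) \<longrightarrow>
     f x \<le> 2 * trunc_op r v x + e / 4"
      using touch unfolding touched_below_def by blast
    show "\<exists>\<tau>0>0. \<forall>\<tau>. 0 < \<tau> \<and> \<tau> < \<tau>0 \<longrightarrow> (\<forall>x\<in>D. f x \<le> 2 * trunc_op \<tau> (infconv A v n) x + e)"
    proof (intro exI[of _ "min r0 \<rho>"] conjI allI impI ballI)
      show "0 < min r0 \<rho>" using r0 \<rho> by simp
      fix \<tau> x assume \<tau>: "0 < \<tau> \<and> \<tau> < min r0 \<rho>" and x: "x \<in> D"
      have xA: "x \<in> A" by (rule DA[OF x])
      obtain y where y: "y \<in> A" "infconv A v n x = v y + real n * (norm (y \<diamondop> (- x)))\<^sup>2"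
        using infconv_attained[where v=v, OF M A xA lsc] by blast
      have "2 * M / c\<^sup>2 < real n" using n0 n by linarith
      then have h: "norm (y \<diamondop> (- x)) < c" using infconv_minimizer_near[where v=v, OF M y(2) c(1)] by blast
      have "norm (y - x) \<le> (1 + 4 * norm x) * norm (y \<diamondop> (- x))" by (rule dist_left_translate_le)
      also have "\<dots> \<le> L * norm (y \<diamondop> (- x))" using xL[OF xA] by (intro mult_right_mono) auto
      also have "\<dots> < L * c" using h L by simp
      also have Lc: "L * c \<le> L * (L * c)" using L c by (simp add: mult_le_cancel_left1)
      finally have yx: "norm (y - x) < L * (L * c)" .
      have move: "norm (z \<diamondop> g - z) \<le> d / 2" if "hnorm g < 2 * \<rho>" "z \<in> A" for z g
      proof -
        have "norm g \<le> 2 * hnorm g" using that \<rho> by (intro norm_le_hnorm) simp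
        then have "norm g \<le> 4 * \<rho>" using that by simp
        have "norm (z \<diamondop> g - z) \<le> (1 + 4 * norm z) * norm g" by (rule norm_hmult_diff_le)
        also have "\<dots> \<le> L * (4 * \<rho>)" using xL[OF that(2)] L \<open>norm g \<le> 4 * \<rho>\<close> by (intro mult_mono) auto
        finally show ?thesis using \<rho> by simp
      qed
      have near: "x \<diamondop> g \<in> A \<and> y \<diamondop> g \<in> A" if g: "hnorm g < 2 * \<rho>" for g
      proof
        show "x \<diamondop> g \<in> A" using move[OF g xA] d by (intro d(2)[OF x]) linarith
        have "norm (y \<diamondop> g - x) \<le> norm (y \<diamondop> g - y) + norm (y - x)"
          using norm_triangle_ineq[of "y \<diamondop> g - y" "y - x"] by simp
        then show "y \<diamondop> g \<in> A" using move[OF g y(1)] yx c by (intro d(2)[OF x]) linarith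
      qed
      have ball: "hball y \<tau> \<subseteq> A"
      proof
        fix z assume "z \<in> hball y \<tau>"
        then have "hnorm ((- y) \<diamondop> z) < 2 * \<rho>" using \<tau> by (simp add: hball_def)
        from near[OF this] show "z \<in> A" by simp
      qed
      \<comment> \<open>Minimality of \<open>y\<close> says precisely that the paraboloid with
        centre \<open>x\<close> and opening \<open>n\<close> touches \<open>v\<close> from below at
        \<open>y\<close>.\<close>
      have "f y \<le> 2 * trunc_op \<tau> v y + e / 4"
      proof (rule tb[rule_format, of _ _ x], intro conjI ballI)
        fix z assume "z \<in> hball y \<tau>"
        then have "z \<in> A" using ball by blast
        from infconv_le[where v=v and n=n, OF M xA this]
        show "v y + real n * (norm (y \<diamondop> (- x)))\<^sup>2 - real n * (norm (z \<diamondop> (- x)))\<^sup>2 \<le> v z"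
          unfolding y(2) by linarith
      qed (use \<tau> R xA y ball in auto)
      moreover have "f x \<le> f y + e / 4"
      proof -
        have "dist (f y) (f x) < e / 4" using yx c by (intro d2(2) xA y(1)) (simp add: dist_norm)
        then show ?thesis unfolding dist_real_def by linarith
      qed
      moreover have "trunc_op \<tau> v y - B * \<kappa> ((- y) \<diamondop> x) \<le> trunc_op \<tau> (infconv A v n) x"
        unfolding B_def \<kappa>_def
        by (rule trunc_op_infconv_ge[where v=v, OF M v _ xA y(2) near]) (use A \<tau> in \<open>auto intro: borel_closed compact_imp_closed\<close>)
      moreover have "B * \<kappa> ((- y) \<diamondop> x) \<le> e / 8"
      proof -
        have "(- y) \<diamondop> x = - ((- x) \<diamondop> ((y \<diamondop> (- x)) \<diamondop> x))" by (simp add: neg_hmult hmult_assoc)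
        then have "norm ((- y) \<diamondop> x) = norm ((- x) \<diamondop> ((y \<diamondop> (- x)) \<diamondop> x))" by simp
        also have "\<dots> \<le> (1 + 4 * norm x) * ((1 + 4 * norm x) * norm (y \<diamondop> (- x)))" by (rule norm_conj_le)
        also have "\<dots> \<le> L * (L * norm (y \<diamondop> (- x)))"
          using xL[OF xA] L by (intro mult_mono) auto
        also have "\<dots> < L * (L * c)" using h L by simp
        finally have "\<kappa> ((- y) \<diamondop> x) < e / (8 * (B + 1))" using c by (intro d1(2)) simp
        then have "B * \<kappa> ((- y) \<diamondop> x) \<le> B * (e / (8 * (B + 1)))"
          by (intro mult_left_mono) (auto simp: B_def)
        also have "\<dots> \<le> e / 8"
        proof -
          have "0 \<le> B" by (simp add: B_def)
          then show ?thesis using e by (simp add: divide_simps)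
        qed
        finally show ?thesis .
      qed
      \<comment> \<open>The errors are \<open>e / 4\<close> from touching, \<open>e / 4\<close> from
        \<open>f\<close>, and twice \<open>e / 8\<close> from the kernel.\<close>
      ultimately show "f x \<le> 2 * trunc_op \<tau> (infconv A v n) x + e" using e by linarith
    qed
  qed
qed

text \<open>Diagonal choice: the index of the convolution is at least \<open>j\<close>, which gives
  pointwise convergence, and the radius is taken below both its own threshold and
  \<open>inverse (real (Suc j))\<close>.\<close>

lemma touched_below_approximation_sequence:
  assumes touch: "touched_below A f v" and M: "\<And>z. \<bar>v z\<bar> \<le> M" and v: "v \<in> borel_measurable borel"
    and A: "compact A" and lsc: "\<And>a. openin (top_of_set A) {x\<in>A. a < v x}" and f: "continuous_on A f"
    and d: "0 < d" "\<And>x z. x \<in> D \<Longrightarrow> norm (z - x) \<le> d \<Longrightarrow> z \<in> A"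
  obtains w \<tau> where "\<And>j. w j \<in> borel_measurable borel" "\<And>j z. \<bar>w j z\<bar> \<le> M" "\<And>z. (\<lambda>j. w j z) \<longlonglongrightarrow> v z"
    "\<And>j. 0 < \<tau> j" "\<tau> \<longlonglongrightarrow> 0" "\<And>j x. x \<in> D \<Longrightarrow> f x \<le> 2 * trunc_op (\<tau> j) (w j) x + inverse (real (Suc j))"
proof -
  have "\<exists>n \<tau>. j \<le> n \<and> 0 < \<tau> \<and> \<tau> < inverse (real (Suc j)) \<and>
      (\<forall>x\<in>D. f x \<le> 2 * trunc_op \<tau> (infconv A v n) x + inverse (real (Suc j)))" for j
  proof -
    have "\<exists>n0. \<forall>n\<ge>n0. \<exists>\<tau>0>0. \<forall>\<tau>. 0 < \<tau> \<and> \<tau> < \<tau>0 \<longrightarrow>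
        (\<forall>x\<in>D. f x \<le> 2 * trunc_op \<tau> (infconv A v n) x + inverse (real (Suc j)))"
      by (rule touched_below_approximation[where v=v and M=M and d=d])
        (rule touch M v A lsc f d(1) | (rule d(2), assumption, assumption) | simp)+
    then obtain n0 where n0: "\<forall>n\<ge>n0. \<exists>\<tau>0>0. \<forall>\<tau>. 0 < \<tau> \<and> \<tau> < \<tau>0 \<longrightarrow>
        (\<forall>x\<in>D. f x \<le> 2 * trunc_op \<tau> (infconv A v n) x + inverse (real (Suc j)))" by blast
    obtain \<tau>0 where "0 < \<tau>0" "\<forall>\<tau>. 0 < \<tau> \<and> \<tau> < \<tau>0 \<longrightarrow>
        (\<forall>x\<in>D. f x \<le> 2 * trunc_op \<tau> (infconv A v (max n0 j)) x + inverse (real (Suc j)))"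
      using n0 max.cobounded1 by blast
    then show ?thesis
    proof (intro exI[of _ "max n0 j"] exI[of _ "min \<tau>0 (inverse (real (Suc j))) / 2"] conjI)
      have "0 < inverse (real (Suc j))" by simp
      then show "min \<tau>0 (inverse (real (Suc j))) / 2 < inverse (real (Suc j))" by linarith
    qed auto
  qed
  then obtain n \<tau> where n\<tau>: "\<And>j. j \<le> n j" "\<And>j. 0 < \<tau> j" "\<And>j. \<tau> j < inverse (real (Suc j))"
      "\<And>j x. x \<in> D \<Longrightarrow> f x \<le> 2 * trunc_op (\<tau> j) (infconv A v (n j)) x + inverse (real (Suc j))"
    by metis
  have "filterlim n at_top sequentially"
    by (rule filterlim_at_top_mono[OF filterlim_ident]) (use n\<tau>(1) in auto)
  then have "(\<lambda>j. infconv A v (n j) z) \<longlonglongrightarrow> v z" for z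
    using infconv_tendsto[where v=v and x=z, OF M A lsc] by (rule filterlim_compose[rotated])
  moreover have "\<tau> \<longlonglongrightarrow> 0"
    by (rule tendsto_sandwich[OF _ _ tendsto_const LIMSEQ_inverse_real_of_nat])
      (use n\<tau> in \<open>auto intro!: always_eventually less_imp_le\<close>)
  moreover have "infconv A v (n j) \<in> borel_measurable borel" for j
    using A by (intro infconv_measurable[where v=v, OF M _ v] borel_closed compact_imp_closed)
  ultimately show ?thesis
    using n\<tau> abs_infconv_le[where v=v, OF M] by (intro that[of "\<lambda>j. infconv A v (n j)" \<tau>]) auto
qed

end

section \<open>The truncated weak form\<close>

lemma
  fixes H :: "'n::finite heis \<times> 'n heis \<Rightarrow> real"
  assumes H: "integrable lborel H"
  shows integrable_lborel_swap: "integrable lborel (\<lambda>z. H (snd z, fst z))"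
    and integral_lborel_swap: "(\<integral>z. H (snd z, fst z) \<partial>lborel) = (\<integral>z. H z \<partial>lborel)"
  using lborel_pair.integrable_product_swap[of H] lborel_pair.integral_product_swap[of H] H
  by (simp_all add: lborel_prod case_prod_beta')

lemma integral_lborel_pair_hmult:
  fixes H :: "'n::finite heis \<times> 'n heis \<Rightarrow> real"
  assumes H: "integrable lborel H"
  shows "(\<integral>z. H z \<partial>lborel) = (\<integral>x. (\<integral>g. H (x, x \<diamondop> g) \<partial>lborel) \<partial>lborel)"
proof -
  have [measurable]: "H \<in> borel_measurable borel" using H by simp
  have "(\<integral>z. H z \<partial>lborel) = (\<integral>x. (\<integral>y. H (x, y) \<partial>lborel) \<partial>lborel)"
    using lborel_pair.integral_fst'[of H] H by (simp add: lborel_prod)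
  also have "\<dots> = (\<integral>x. (\<integral>g. H (x, x \<diamondop> g) \<partial>lborel) \<partial>lborel)"
    by (intro Bochner_Integration.integral_cong refl integral_hmult[symmetric]) measurable
  finally show ?thesis .
qed

lemma nn_integral_lborel_pair_hmult:
  fixes H :: "'n::finite heis \<times> 'n heis \<Rightarrow> ennreal"
  assumes [measurable]: "H \<in> borel_measurable borel"
  shows "(\<integral>\<^sup>+z. H z \<partial>lborel) = (\<integral>\<^sup>+x. (\<integral>\<^sup>+g. H (x, x \<diamondop> g) \<partial>lborel) \<partial>lborel)"
proof -
  have "(\<integral>\<^sup>+z. H z \<partial>lborel) = (\<integral>\<^sup>+x. (\<integral>\<^sup>+y. H (x, y) \<partial>lborel) \<partial>lborel)"
    by (rule nn_integral_lborel_pair) measurable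
  also have "\<dots> = (\<integral>\<^sup>+x. (\<integral>\<^sup>+g. H (x, x \<diamondop> g) \<partial>lborel) \<partial>lborel)"
    by (intro nn_integral_cong nn_integral_hmult[symmetric]) measurable
  finally show ?thesis .
qed

context heis_kernel
begin

definition gdiff :: "'n heis \<times> 'n heis \<Rightarrow> 'n heis" where "gdiff z = (- snd z) \<diamondop> fst z"

text \<open>The kernel on pairs: it agrees with \<open>K\<close> off the diagonal, is 0 on it, and
  is Borel measurable.\<close>

definition kap :: "'n heis \<times> 'n heis \<Rightarrow> real" where "kap z = k (gdiff z)"

definition trunc :: "real \<Rightarrow> 'n heis \<times> 'n heis \<Rightarrow> real" where
  "trunc \<tau> z = indicator {g. \<tau> \<le> hnorm g} (gdiff z)"

lemma gdiff_swap: "gdiff (y, x) = - gdiff (x, y)"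
  by (simp add: gdiff_def neg_hmult)

lemma gdiff_right [simp]: "gdiff (x, x \<diamondop> g) = - g"
  by (simp add: gdiff_def neg_hmult hmult_assoc)

lemma gdiff_measurable [measurable]: "gdiff \<in> borel_measurable borel"
proof -
  have "continuous_on UNIV gdiff" unfolding gdiff_def by (intro continuous_intros)
  then show ?thesis by (rule borel_measurable_continuous_onI)
qed

lemma kap_measurable [measurable]: "kap \<in> borel_measurable borel"
  unfolding kap_def by measurable

lemma trunc_measurable [measurable]: "trunc \<tau> \<in> borel_measurable borel"
  unfolding trunc_def by measurable

lemma fst_heis_measurable [measurable]: "(fst :: 'n heis \<times> 'n heis \<Rightarrow> 'n heis) \<in> borel_measurable borel"
  by (intro borel_measurable_continuous_onI continuous_intros)

lemma snd_heis_measurable [measurable]: "(snd :: 'n heis \<times> 'n heis \<Rightarrow> 'n heis) \<in> borel_measurable borel"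
  by (intro borel_measurable_continuous_onI continuous_intros)

lemma kap_swap: "kap (y, x) = kap (x, y)"
  by (simp add: kap_def gdiff_swap[of y x])

lemma trunc_swap: "trunc \<tau> (y, x) = trunc \<tau> (x, y)"
  by (simp add: trunc_def gdiff_swap[of y x] indicator_def)

lemma kap_nonneg [simp]: "0 \<le> kap z"
  by (simp add: kap_def)

lemma trunc_bounds [simp]: "0 \<le> trunc \<tau> z" "trunc \<tau> z \<le> 1"
  by (simp_all add: trunc_def indicator_def)

text \<open>In the coordinates \<open>(x, x \<diamondop> g)\<close> the majorant becomes a product,
  the measure of \<open>D\<close> times the integral of \<open>h g * k g\<close>;
  \<open>- gdiff z\<close> is the increment \<open>g\<close>.\<close>

lemma integrable_pair_kernel:
  assumes [measurable]: "F \<in> borel_measurable borel" "D \<in> sets borel" "h \<in> borel_measurable borel"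
    and D: "emeasure lborel D < \<infinity>" and h: "integrable lborel (\<lambda>g. h g * k g)" "\<And>g. 0 \<le> h g"
    and F: "\<And>z. \<bar>F z\<bar> \<le> indicator D (fst z) * h (- gdiff z) * kap z"
  shows "integrable lborel F"
proof (rule integrableI_bounded)
  have "(\<integral>\<^sup>+z. ennreal (norm (F z)) \<partial>lborel) \<le> (\<integral>\<^sup>+z. ennreal (indicator D (fst z) * h (- gdiff z) * kap z) \<partial>lborel)"
    using F by (intro nn_integral_mono ennreal_leI) simp
  also have "\<dots> = (\<integral>\<^sup>+x. (\<integral>\<^sup>+g. ennreal (indicator D x * h g * k g) \<partial>lborel) \<partial>lborel)"
    by (subst nn_integral_lborel_pair_hmult) (simp_all add: kap_def)
  also have "\<dots> = (\<integral>\<^sup>+x. indicator D x * (\<integral>\<^sup>+g. ennreal (h g * k g) \<partial>lborel) \<partial>lborel)"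
    by (intro nn_integral_cong) (auto simp: indicator_def)
  also have "\<dots> = emeasure lborel D * (\<integral>\<^sup>+g. ennreal (h g * k g) \<partial>lborel)"
    by (subst nn_integral_multc) auto
  also have "(\<integral>\<^sup>+g. ennreal (h g * k g) \<partial>lborel) = ennreal (\<integral>g. h g * k g \<partial>lborel)"
    using h by (intro nn_integral_eq_integral) auto
  also have "emeasure lborel D * ennreal (\<integral>g. h g * k g \<partial>lborel) < \<infinity>"
    using D by (simp add: ennreal_mult_less_top)
  finally show "(\<integral>\<^sup>+z. ennreal (norm (F z)) \<partial>lborel) < \<infinity>" .
qed simp

text \<open>The truncation makes the two halves of \<open>\<phi> (fst z) - \<phi> (snd z)\<close>
  separately integrable, and swapping the variables exchanges them, whence the factor 2. A bounded
  Borel \<phi> supported in a set of finite measure is enough, so the test function may be built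
  from \<open>w\<close> itself.\<close>

lemma trunc_weak_form:
  assumes w [measurable]: "w \<in> borel_measurable borel" and M: "\<And>z. \<bar>w z\<bar> \<le> M"
    and \<phi> [measurable]: "\<phi> \<in> borel_measurable borel" and C: "\<And>x. \<bar>\<phi> x\<bar> \<le> C"
    and D [measurable]: "D \<in> sets borel" and fin: "emeasure lborel D < \<infinity>" and supp: "\<And>x. x \<notin> D \<Longrightarrow> \<phi> x = 0"
    and \<tau>: "0 < \<tau>"
  defines "G \<equiv> \<lambda>z. trunc \<tau> z * (signed_pow p (w (fst z) - w (snd z)) * (\<phi> (fst z) - \<phi> (snd z))) * kap z"
  shows "integrable lborel G" "(\<integral>z. G z \<partial>lborel) = 2 * (\<integral>x. \<phi> x * trunc_op \<tau> w x \<partial>lborel)"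
proof -
  define B where "B = (2 * M) powr (p - 1)"
  have J: "\<bar>signed_pow p (w x - w y)\<bar> \<le> B" for x y
    unfolding B_def using M[of x] M[of y] p by (intro abs_signed_pow_le) linarith+
  have B0: "0 \<le> B" by (simp add: B_def)
  have C0: "0 \<le> C" using C[of 0] by linarith
  define H where "H z = trunc \<tau> z * (signed_pow p (w (fst z) - w (snd z)) * \<phi> (fst z)) * kap z" for z
  have Hm: "H \<in> borel_measurable borel" unfolding H_def by measurable
  have intH: "integrable lborel H"
  proof (rule integrable_pair_kernel[OF Hm D _ fin, of "\<lambda>g. B * C * indicator {g. \<tau> \<le> hnorm g} g"])
    show "integrable lborel (\<lambda>g. B * C * indicator {g. \<tau> \<le> hnorm g} g * k g)"
      by (rule integrable_k_away[of _ "B * C" \<tau>]) (use B0 C0 \<tau> in \<open>auto simp: indicator_def\<close>)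
    fix z
    have "\<bar>signed_pow p (w (fst z) - w (snd z)) * \<phi> (fst z)\<bar> \<le> indicator D (fst z) * (B * C)"
    proof (cases "fst z \<in> D")
      case True
      then show ?thesis using J[of "fst z" "snd z"] C[of "fst z"] B0 by (simp add: abs_mult mult_mono)
    qed (simp add: supp)
    then have "trunc \<tau> z * \<bar>signed_pow p (w (fst z) - w (snd z)) * \<phi> (fst z)\<bar> * kap z \<le>
        trunc \<tau> z * (indicator D (fst z) * (B * C)) * kap z"
      by (intro mult_right_mono mult_left_mono) auto
    then show "\<bar>H z\<bar> \<le> indicator D (fst z) * (B * C * indicator {g. \<tau> \<le> hnorm g} (- gdiff z)) * kap z"
      by (simp add: H_def abs_mult trunc_def indicator_def mult_ac)
  qed (use B0 C0 in \<open>auto simp: indicator_def\<close>)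
  have G: "G = (\<lambda>z. H z + H (snd z, fst z))"
  proof
    fix z :: "'n heis \<times> 'n heis"
    obtain x y where z: "z = (x, y)" by (cases z)
    have "signed_pow p (w y - w x) = - signed_pow p (w x - w y)"
      using signed_pow_minus[of p "w x - w y"] by simp
    then show "G z = H z + H (snd z, fst z)"
      by (simp only: z G_def H_def fst_conv snd_conv trunc_swap[of \<tau> y x] kap_swap[of y x]) (simp add: algebra_simps)
  qed
  show "integrable lborel G"
    unfolding G by (intro Bochner_Integration.integrable_add intH integrable_lborel_swap)
  have "(\<integral>z. G z \<partial>lborel) = (\<integral>z. H z \<partial>lborel) + (\<integral>z. H (snd z, fst z) \<partial>lborel)"
    unfolding G by (intro Bochner_Integration.integral_add intH integrable_lborel_swap)
  also have "\<dots> = 2 * (\<integral>z. H z \<partial>lborel)"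
    using integral_lborel_swap[OF intH] by simp
  also have "(\<integral>z. H z \<partial>lborel) = (\<integral>x. (\<integral>g. H (x, x \<diamondop> g) \<partial>lborel) \<partial>lborel)"
    by (rule integral_lborel_pair_hmult[OF intH])
  also have "\<dots> = (\<integral>x. \<phi> x * trunc_op \<tau> w x \<partial>lborel)"
  proof (intro Bochner_Integration.integral_cong refl)
    fix x
    have "(\<integral>g. H (x, x \<diamondop> g) \<partial>lborel) = (\<integral>g. \<phi> x * (indicator {g. \<tau> \<le> hnorm g} g * signed_pow p (w x - w (x \<diamondop> g)) * k g) \<partial>lborel)"
      by (intro Bochner_Integration.integral_cong refl) (simp add: H_def trunc_def kap_def indicator_def)
    then show "(\<integral>g. H (x, x \<diamondop> g) \<partial>lborel) = \<phi> x * trunc_op \<tau> w x"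
      by (simp add: trunc_op_def)
  qed
  finally show "(\<integral>z. G z \<partial>lborel) = 2 * (\<integral>x. \<phi> x * trunc_op \<tau> w x \<partial>lborel)" .
qed

lemma trunc_op_measurable [measurable]:
  assumes [measurable]: "w \<in> borel_measurable borel"
  shows "trunc_op \<tau> w \<in> borel_measurable borel"
proof -
  have "(\<lambda>x. \<integral>g. indicator {g. \<tau> \<le> hnorm g} g * signed_pow p (w x - w (x \<diamondop> g)) * k g \<partial>lborel) \<in> borel_measurable borel"
    by (rule lborel.borel_measurable_lebesgue_integral) measurable
  then show ?thesis unfolding trunc_op_def[abs_def] .
qed

lemma abs_trunc_op_le:
  assumes w [measurable]: "w \<in> borel_measurable borel" and M: "\<And>z. \<bar>w z\<bar> \<le> M" and \<tau>: "0 < \<tau>"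
  obtains C where "\<And>x. \<bar>trunc_op \<tau> w x\<bar> \<le> C"
proof
  define B where "B = (2 * M) powr (p - 1)"
  have J: "\<bar>signed_pow p (w x - w y)\<bar> \<le> B" for x y
    unfolding B_def using M[of x] M[of y] p by (intro abs_signed_pow_le) linarith+
  have B0: "0 \<le> B" by (simp add: B_def)
  fix x
  let ?F = "\<lambda>g. indicator {g. \<tau> \<le> hnorm g} g * signed_pow p (w x - w (x \<diamondop> g)) * k g"
  have i: "integrable lborel ?F"
    by (rule integrable_k_away[of _ B \<tau>]) (use J B0 \<tau> in \<open>auto simp: indicator_def\<close>)
  have i2: "integrable lborel (\<lambda>g. B * indicator {g. \<tau> \<le> hnorm g} g * k g)"
    by (rule integrable_k_away[of _ B \<tau>]) (use B0 \<tau> in \<open>auto simp: indicator_def\<close>)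
  have "\<bar>trunc_op \<tau> w x\<bar> \<le> (\<integral>g. \<bar>?F g\<bar> \<partial>lborel)"
    unfolding trunc_op_def by (rule integral_abs_bound)
  also have "\<dots> \<le> (\<integral>g. B * indicator {g. \<tau> \<le> hnorm g} g * k g \<partial>lborel)"
  proof (rule integral_mono[OF integrable_abs[OF i] i2])
    fix g
    show "\<bar>?F g\<bar> \<le> B * indicator {g. \<tau> \<le> hnorm g} g * k g"
      using J[of x "x \<diamondop> g"] by (simp add: abs_mult indicator_def mult_right_mono)
  qed
  finally show "\<bar>trunc_op \<tau> w x\<bar> \<le> (\<integral>g. B * indicator {g. \<tau> \<le> hnorm g} g * k g \<partial>lborel)" .
qed

lemma integrable_bounded_support:
  fixes \<phi> a :: "'a::euclidean_space \<Rightarrow> real"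
  assumes [measurable]: "\<phi> \<in> borel_measurable borel" and C: "\<And>x. 0 \<le> \<phi> x" "\<And>x. \<phi> x \<le> C"
    and D [measurable]: "D \<in> sets borel" and fin: "emeasure lborel D < \<infinity>" and supp: "\<And>x. x \<notin> D \<Longrightarrow> \<phi> x = 0"
    and [measurable]: "a \<in> borel_measurable borel" and a: "\<And>x. \<bar>a x\<bar> \<le> A"
  shows "integrable lborel (\<lambda>x. \<phi> x * a x)"
proof (rule Bochner_Integration.integrable_bound)
  show "integrable lborel (\<lambda>x. indicator D x * (C * A) :: real)"
    using fin by simp
  show "AE x in lborel. norm (\<phi> x * a x) \<le> norm (indicator D x * (C * A) :: real)"
  proof (intro always_eventually allI)
    fix x
    show "norm (\<phi> x * a x) \<le> norm (indicator D x * (C * A) :: real)"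
    proof (cases "x \<in> D")
      case True
      have "\<bar>\<phi> x\<bar> * \<bar>a x\<bar> \<le> C * A" using C[of x] a[of x] by (intro mult_mono) auto
      also have "\<dots> \<le> \<bar>C * A\<bar>" by simp
      finally show ?thesis using True by (simp add: abs_mult)
    qed (simp add: supp)
  qed
qed measurable

text \<open>Integrates the pointwise inequality against a nonnegative test function. The bound from
  \<open>abs_trunc_op_le\<close> serves integrability alone, so its dependence on \<tau> does not
  enter the estimate.\<close>

lemma integral_test_trunc_op_ge:
  assumes w [measurable]: "w \<in> borel_measurable borel" and M: "\<And>z. \<bar>w z\<bar> \<le> M"
    and \<phi> [measurable]: "\<phi> \<in> borel_measurable borel" and C: "\<And>x. 0 \<le> \<phi> x" "\<And>x. \<phi> x \<le> C"
    and D [measurable]: "D \<in> sets borel" and fin: "emeasure lborel D < \<infinity>" and supp: "\<And>x. x \<notin> D \<Longrightarrow> \<phi> x = 0"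
    and \<tau>: "0 < \<tau>" and h [measurable]: "h \<in> borel_measurable borel" and hF: "\<And>x. \<bar>h x\<bar> \<le> F"
    and op: "\<And>x. x \<in> D \<Longrightarrow> h x \<le> 2 * trunc_op \<tau> w x"
  shows "(\<integral>x. \<phi> x * h x \<partial>lborel) \<le> 2 * (\<integral>x. \<phi> x * trunc_op \<tau> w x \<partial>lborel)"
proof -
  have bd: "integrable lborel (\<lambda>x. \<phi> x * a x)"
    if "a \<in> borel_measurable borel" "\<And>x. \<bar>a x\<bar> \<le> A" for a A
    using that by (intro integrable_bounded_support[of \<phi> C D a A] \<phi> C D fin supp)
  obtain E where E: "\<And>x. \<bar>trunc_op \<tau> w x\<bar> \<le> E" using abs_trunc_op_le[OF w M \<tau>] by blast
  have "(\<integral>x. \<phi> x * h x \<partial>lborel) \<le> (\<integral>x. 2 * (\<phi> x * trunc_op \<tau> w x) \<partial>lborel)"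
  proof (intro integral_mono bd[OF h hF] integrable_mult_right bd[OF _ E])
    fix x
    show "\<phi> x * h x \<le> 2 * (\<phi> x * trunc_op \<tau> w x)"
    proof (cases "x \<in> D")
      case True
      then have "\<phi> x * h x \<le> \<phi> x * (2 * trunc_op \<tau> w x)" using C op by (intro mult_left_mono) auto
      then show ?thesis by simp
    qed (simp add: supp)
  qed measurable
  then show ?thesis by simp
qed

section \<open>Caccioppoli estimate\<close>

text \<open>On the bounded set \<open>D\<close> the Euclidean Lipschitz bound becomes
  \<open>A * min 1 (hnorm g)\<close>, whose p-th power has order p > sp at the identity. Pairs with
  only the second point in \<open>D\<close> are reached by symmetry.\<close>

lemma lipschitz_energy_integrable:
  assumes \<psi> [measurable]: "\<psi> \<in> borel_measurable borel" and C: "\<And>x. \<bar>\<psi> x\<bar> \<le> C"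
    and D [measurable]: "D \<in> sets borel" and bD: "bounded D" and supp: "\<And>x. x \<notin> D \<Longrightarrow> \<psi> x = 0"
    and lip: "\<And>x y. \<bar>\<psi> x - \<psi> y\<bar> \<le> L * norm (x - y)"
  shows "integrable lborel (\<lambda>z. \<bar>\<psi> (fst z) - \<psi> (snd z)\<bar> powr p * kap z)"
proof -
  obtain R where R: "0 < R" "\<And>x. x \<in> D \<Longrightarrow> norm x \<le> R" using bD unfolding bounded_pos by blast
  have fin: "emeasure lborel D < \<infinity>" using emeasure_bounded_finite[OF bD] .
  have C0: "0 \<le> C" using C[of 0] by linarith
  have L0: "0 \<le> L"
  proof -
    have "0 \<le> L * norm ((1,1,1) - 0 :: 'n heis)" using lip[of "(1,1,1)" 0] by linarith
    moreover have "0 < norm ((1,1,1) - 0 :: 'n heis)" by (simp add: zero_prod_def)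
    ultimately show ?thesis by (simp add: zero_le_mult_iff)
  qed
  define A where "A = max (2 * C) (2 * L * (1 + 4 * R))"
  have A0: "0 \<le> A" using C0 by (simp add: A_def)
  have est: "\<bar>\<psi> x - \<psi> (x \<diamondop> g)\<bar> \<le> A * min 1 (hnorm g)" if x: "x \<in> D" for x g
  proof (cases "hnorm g \<le> 1")
    case True
    have "\<bar>\<psi> (x \<diamondop> g) - \<psi> x\<bar> \<le> L * norm (x \<diamondop> g - x)" by (rule lip)
    also have "\<dots> \<le> L * ((1 + 4 * norm x) * norm g)" using L0 by (intro mult_left_mono norm_hmult_diff_le)
    also have "\<dots> \<le> L * ((1 + 4 * R) * (2 * hnorm g))"
      using R(1) R(2)[OF x] L0 norm_le_hnorm[OF True] by (intro mult_left_mono mult_mono) auto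
    also have "\<dots> = (2 * L * (1 + 4 * R)) * hnorm g" by simp
    also have "\<dots> \<le> A * hnorm g" by (intro mult_right_mono) (auto simp: A_def)
    finally show ?thesis using True by (simp add: min_def abs_minus_commute)
  next
    case False
    have "\<bar>\<psi> x - \<psi> (x \<diamondop> g)\<bar> \<le> 2 * C" using C[of x] C[of "x \<diamondop> g"] by linarith
    also have "\<dots> \<le> A" by (simp add: A_def)
    finally show ?thesis using False by (simp add: min_def)
  qed
  define h where "h g = A powr p * min 1 (hnorm g) powr p" for g :: "'n heis"
  have [measurable]: "h \<in> borel_measurable borel" unfolding h_def by measurable
  have h0: "0 \<le> h g" for g by (simp add: h_def)
  have inth: "integrable lborel (\<lambda>g. h g * k g)"
    by (rule integrable_k[of _ p "A powr p"]) (use s p in \<open>auto simp: h_def\<close>)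
  define F where "F z = indicator D (fst z) * h (- gdiff z) * kap z" for z
  have [measurable]: "F \<in> borel_measurable borel" unfolding F_def by measurable
  have intF: "integrable lborel F"
    by (rule integrable_pair_kernel[OF _ D _ fin inth h0]) (auto simp: F_def abs_mult h0 intro!: mult_right_mono)
  have est': "\<bar>\<psi> x - \<psi> y\<bar> powr p * kap (x, y) \<le> F (x, y)" if x: "x \<in> D" for x y
  proof -
    have y: "y = x \<diamondop> (- gdiff (x, y))" by (simp add: gdiff_def neg_hmult)
    have "\<bar>\<psi> x - \<psi> y\<bar> powr p \<le> (A * min 1 (hnorm (- gdiff (x, y)))) powr p"
      using est[OF x, of "- gdiff (x, y)"] p y by (intro powr_mono2) auto
    also have "\<dots> = h (- gdiff (x, y))" using A0 by (simp add: h_def powr_mult)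
    finally show ?thesis using x by (auto simp: F_def intro!: mult_right_mono)
  qed
  have F0: "0 \<le> F z" for z by (simp add: F_def h0)
  show ?thesis
  proof (rule Bochner_Integration.integrable_bound[OF Bochner_Integration.integrable_add[OF intF integrable_lborel_swap[OF intF]]])
    show "AE z in lborel. norm (\<bar>\<psi> (fst z) - \<psi> (snd z)\<bar> powr p * kap z) \<le> norm (F z + F (snd z, fst z))"
    proof (intro always_eventually allI)
      fix z :: "'n heis \<times> 'n heis"
      obtain x y where z: "z = (x, y)" by (cases z)
      have "\<bar>\<psi> x - \<psi> y\<bar> powr p * kap (x, y) \<le> F (x, y) + F (y, x)"
      proof -
        consider "x \<in> D" | "y \<in> D" | "x \<notin> D" "y \<notin> D" by blast
        then show ?thesis
        proof cases
          case 1 then show ?thesis using est'[of x y] F0[of "(y, x)"] by linarith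
        next
          case 2
          have "\<bar>\<psi> y - \<psi> x\<bar> powr p * kap (y, x) \<le> F (y, x)" by (rule est'[OF 2])
          then show ?thesis using F0[of "(x, y)"] by (simp only: kap_swap[of y x] abs_minus_commute)
        next
          case 3 then show ?thesis using F0[of "(x, y)"] F0[of "(y, x)"] p by (simp add: supp)
        qed
      qed
      moreover have "0 \<le> F (x, y) + F (y, x)" using F0 by (intro add_nonneg_nonneg)
      ultimately show "norm (\<bar>\<psi> (fst z) - \<psi> (snd z)\<bar> powr p * kap z) \<le> norm (F z + F (snd z, fst z))"
        by (simp add: z abs_mult)
    qed
  qed measurable
qed

text \<open>The test function is \<open>(M - w) * \<zeta> powr p\<close>, nonnegative because
  \<open>w \<le> M\<close>. Passing to \<open>M - w\<close> reverses increments, so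
  \<open>caccioppoli_pointwise\<close> bounds the energy by \<open>- 2 * G\<close> plus the energy
  of the cutoff, and a lower bound on the operator controls the former. The resulting constant
  involves neither \<tau> nor any modulus of continuity of \<open>w\<close>.\<close>

lemma caccioppoli:
  assumes w [measurable]: "w \<in> borel_measurable borel" and M: "\<And>z. \<bar>w z\<bar> \<le> M"
    and \<zeta> [measurable]: "\<zeta> \<in> borel_measurable borel" and \<zeta>01: "\<And>x. 0 \<le> \<zeta> x" "\<And>x. \<zeta> x \<le> 1"
    and D [measurable]: "D \<in> sets borel" and fin: "emeasure lborel D < \<infinity>" and supp: "\<And>x. x \<notin> D \<Longrightarrow> \<zeta> x = 0"
    and energy: "integrable lborel (\<lambda>z. \<bar>\<zeta> (fst z) - \<zeta> (snd z)\<bar> powr p * kap z)"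
    and \<tau>: "0 < \<tau>" and F: "0 \<le> F" and op: "\<And>x. x \<in> D \<Longrightarrow> - F \<le> 2 * trunc_op \<tau> w x"
  shows "(\<integral>\<^sup>+z. ennreal (trunc \<tau> z * (\<bar>w (fst z) - w (snd z)\<bar> powr p * (max (\<zeta> (fst z)) (\<zeta> (snd z))) powr p) * kap z) \<partial>lborel)
    \<le> ennreal (4 * M * F * measure lborel D + 2 * (2 * p) powr (p - 1) * p * (2 * M) powr p *
        (\<integral>z. \<bar>\<zeta> (fst z) - \<zeta> (snd z)\<bar> powr p * kap z \<partial>lborel))"
proof -
  have M0: "0 \<le> M" using M[of 0] by linarith
  define v where "v x = M - w x" for x
  have v: "0 \<le> v x" "v x \<le> 2 * M" for x using M[of x] by (auto simp: v_def)
  define \<phi> where "\<phi> x = v x * \<zeta> x powr p" for x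
  have [measurable]: "\<phi> \<in> borel_measurable borel" unfolding \<phi>_def v_def by measurable
  have \<zeta>p: "\<zeta> x powr p \<le> 1" "0 \<le> \<zeta> x powr p" for x using \<zeta>01[of x] p by (auto simp: powr_le1)
  have \<phi>: "0 \<le> \<phi> x" "\<phi> x \<le> 2 * M" for x
    unfolding \<phi>_def using v[of x] \<zeta>p[of x] mult_mono[of "v x" "2 * M" "\<zeta> x powr p" 1] M0 by auto
  have \<phi>D: "x \<notin> D \<Longrightarrow> \<phi> x = 0" for x using supp p by (simp add: \<phi>_def)
  define c where "c = 2 * (2 * p) powr (p - 1) * p * (2 * M) powr p"
  have c: "0 \<le> c" using p by (simp add: c_def)
  define G where "G z = trunc \<tau> z * (signed_pow p (w (fst z) - w (snd z)) * (\<phi> (fst z) - \<phi> (snd z))) * kap z" for z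
  define E where "E z = \<bar>\<zeta> (fst z) - \<zeta> (snd z)\<bar> powr p * kap z" for z
  have intG: "integrable lborel G" and G: "(\<integral>z. G z \<partial>lborel) = 2 * (\<integral>x. \<phi> x * trunc_op \<tau> w x \<partial>lborel)"
    unfolding G_def by (rule trunc_weak_form[where M=M and C="2 * M" and D=D]; simp add: M \<phi> \<phi>D fin[simplified] \<tau>)+
  have intE: "integrable lborel E" using energy unfolding E_def .
  let ?X = "\<lambda>z. trunc \<tau> z * (\<bar>w (fst z) - w (snd z)\<bar> powr p * (max (\<zeta> (fst z)) (\<zeta> (snd z))) powr p) * kap z"
  have le: "?X z \<le> - 2 * G z + c * E z" for z
  proof -
    obtain x y where z: "z = (x, y)" by (cases z)
    have "\<bar>v x - v y\<bar> powr p * (max (\<zeta> x) (\<zeta> y)) powr p \<le>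
       2 * (signed_pow p (v x - v y) * (\<phi> x - \<phi> y)) + 2 * (2 * p) powr (p - 1) * p * (max (v x) (v y)) powr p * \<bar>\<zeta> x - \<zeta> y\<bar> powr p"
      unfolding \<phi>_def by (rule caccioppoli_pointwise[OF p(1) v(1) v(1) \<zeta>01(1) \<zeta>01(1)])
    also have "2 * (2 * p) powr (p - 1) * p * (max (v x) (v y)) powr p * \<bar>\<zeta> x - \<zeta> y\<bar> powr p \<le> c * \<bar>\<zeta> x - \<zeta> y\<bar> powr p"
      unfolding c_def using v[of x] v[of y] p by (intro mult_right_mono mult_left_mono powr_mono2) auto
    also have "v x - v y = - (w x - w y)" by (simp add: v_def)
    finally have *: "\<bar>w x - w y\<bar> powr p * (max (\<zeta> x) (\<zeta> y)) powr p \<le>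
       - 2 * (signed_pow p (w x - w y) * (\<phi> x - \<phi> y)) + c * \<bar>\<zeta> x - \<zeta> y\<bar> powr p"
      unfolding signed_pow_minus abs_minus_cancel by simp
    have "?X z \<le> trunc \<tau> z * (- 2 * (signed_pow p (w x - w y) * (\<phi> x - \<phi> y)) + c * \<bar>\<zeta> x - \<zeta> y\<bar> powr p) * kap z"
      unfolding z fst_conv snd_conv by (intro mult_right_mono mult_left_mono *) auto
    also have "\<dots> = - 2 * G z + trunc \<tau> z * (c * E z)"
      unfolding z G_def E_def fst_conv snd_conv by (simp add: algebra_simps)
    also have "\<dots> \<le> - 2 * G z + 1 * (c * E z)"
      using c by (intro add_left_mono mult_right_mono) (auto simp: E_def)
    finally show ?thesis by simp
  qed
  have "(\<integral>\<^sup>+z. ennreal (?X z) \<partial>lborel) \<le> (\<integral>\<^sup>+z. ennreal (- 2 * G z + c * E z) \<partial>lborel)"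
    by (intro nn_integral_mono ennreal_leI le)
  also have "\<dots> = ennreal (\<integral>z. - 2 * G z + c * E z \<partial>lborel)"
  proof (rule nn_integral_eq_integral)
    show "integrable lborel (\<lambda>z. - 2 * G z + c * E z)"
      by (intro Bochner_Integration.integrable_add integrable_mult_right intG intE)
    have "0 \<le> ?X z" for z by (intro mult_nonneg_nonneg trunc_bounds kap_nonneg powr_ge_zero)
    then have "0 \<le> - 2 * G z + c * E z" for z by (rule order_trans[OF _ le[of z]])
    then show "AE z in lborel. 0 \<le> - 2 * G z + c * E z" by (intro always_eventually allI)
  qed
  finally have 1: "(\<integral>\<^sup>+z. ennreal (?X z) \<partial>lborel) \<le> ennreal (\<integral>z. - 2 * G z + c * E z \<partial>lborel)" .
  have "(\<integral>z. - 2 * G z + c * E z \<partial>lborel) = - 2 * (\<integral>z. G z \<partial>lborel) + c * (\<integral>z. E z \<partial>lborel)"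
    using intG intE by simp
  \<comment> \<open>Minus twice the integral of \<open>G\<close> is at most \<open>2 * F\<close>
    times the integral of \<open>\<phi>\<close>, and \<open>\<phi> \<le> 2 * M\<close> on
    \<open>D\<close>.\<close>
  also have "\<dots> \<le> 4 * M * F * measure lborel D + c * (\<integral>z. E z \<partial>lborel)"
  proof -
    have "(\<integral>x. \<phi> x * (- F) \<partial>lborel) \<le> 2 * (\<integral>x. \<phi> x * trunc_op \<tau> w x \<partial>lborel)"
      by (rule integral_test_trunc_op_ge[where M=M and C="2 * M" and D=D and F=F])
        (simp_all add: M \<phi> \<phi>D fin[simplified] \<tau> op F)
    moreover have "(\<integral>x. \<phi> x * F \<partial>lborel) \<le> (\<integral>x. indicator D x * (2 * M) * F \<partial>lborel)"
    proof (rule integral_mono_AE')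
      show "integrable lborel (\<lambda>x. indicator D x * (2 * M) * F)" using fin by simp
      have "\<phi> x * F \<le> indicator D x * (2 * M) * F" for x
        using \<phi>[of x] F by (cases "x \<in> D") (auto simp: \<phi>D intro!: mult_right_mono)
      then show "AE x in lborel. \<phi> x * F \<le> indicator D x * (2 * M) * F" by simp
      show "AE x in lborel. 0 \<le> indicator D x * (2 * M) * F" using M0 F by simp
    qed
    moreover have "(\<integral>x. indicator D x * (2 * M) * F \<partial>lborel) = measure lborel D * (2 * M) * F"
      by simp
    moreover have "(\<integral>x. \<phi> x * (- F) \<partial>lborel) = - (\<integral>x. \<phi> x * F \<partial>lborel)" by simp
    moreover have "4 * M * F * measure lborel D = 2 * (measure lborel D * (2 * M) * F)" by simp
    ultimately show ?thesis unfolding G by linarith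
  qed
  finally have 2: "(\<integral>z. - 2 * G z + c * E z \<partial>lborel) \<le> 4 * M * F * measure lborel D + c * (\<integral>z. E z \<partial>lborel)" .
  show ?thesis using order_trans[OF 1 ennreal_leI[OF 2]] unfolding c_def E_def .
qed

section \<open>Passage to the limit\<close>


definition weak_density :: "('n heis \<Rightarrow> real) \<Rightarrow> ('n heis \<Rightarrow> real) \<Rightarrow> 'n heis \<times> 'n heis \<Rightarrow> real" where
  "weak_density v \<phi> z = (signed_pow p (v (fst z) - v (snd z)) * (\<phi> (fst z) - \<phi> (snd z))) * kap z"

text \<open>Off the diagonal the truncation is eventually inactive; on the diagonal
  \<open>kap\<close> is 0.\<close>

lemma trunc_kap_tendsto:
  assumes "\<tau> \<longlonglongrightarrow> 0" "a \<longlonglongrightarrow> b"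
  shows "(\<lambda>j. trunc (\<tau> j) z * a j * kap z) \<longlonglongrightarrow> b * kap z"
proof (cases "gdiff z = 0")
  case True
  then show ?thesis by (simp add: kap_def)
next
  case False
  then have "0 < hnorm (gdiff z)" by (simp only: hnorm_pos_iff not_False_eq_True)
  with assms(1) have "\<forall>\<^sub>F j in sequentially. \<tau> j < hnorm (gdiff z)"
    by (rule order_tendstoD(2))
  then have "\<forall>\<^sub>F j in sequentially. a j * kap z = trunc (\<tau> j) z * a j * kap z"
    by eventually_elim (simp add: trunc_def)
  moreover have "(\<lambda>j. a j * kap z) \<longlonglongrightarrow> b * kap z"
    by (intro tendsto_intros assms)
  ultimately show ?thesis by (rule Lim_transform_eventually[rotated])
qed

text \<open>\<open>m\<close> stands for the larger of two cutoff values, equal to 1 wherever the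
  test function has a nonzero increment \<open>b\<close>. The density is thus split into a small
  multiple of the localised energy and a multiple of the fixed energy of the test function.\<close>

lemma young_pointwise:
  assumes e: "0 < e" and "0 \<le> t" "t \<le> 1" "0 \<le> \<kappa>" and m: "b \<noteq> 0 \<Longrightarrow> m = 1"
  shows "\<bar>t * (signed_pow p a * b) * \<kappa>\<bar> \<le> e * (t * (\<bar>a\<bar> powr p * m powr p) * \<kappa>) + e powr (1 - p) * (\<bar>b\<bar> powr p * \<kappa>)"
proof (cases "b = 0")
  case True
  then show ?thesis using assms p by (simp add: mult_nonneg_nonneg)
next
  case False
  have "\<bar>t * (signed_pow p a * b) * \<kappa>\<bar> = t * (\<bar>a\<bar> powr (p - 1) * \<bar>b\<bar>) * \<kappa>"
    using assms by (simp add: abs_mult abs_signed_pow)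
  also have "\<dots> \<le> t * (e * \<bar>a\<bar> powr p + e powr (1 - p) * \<bar>b\<bar> powr p) * \<kappa>"
    using assms p by (intro mult_right_mono mult_left_mono powr_mult_le_young) auto
  also have "\<dots> = e * (t * (\<bar>a\<bar> powr p * m powr p) * \<kappa>) + t * (e powr (1 - p) * (\<bar>b\<bar> powr p * \<kappa>))"
    using m[OF False] by (simp add: algebra_simps)
  also have "\<dots> \<le> e * (t * (\<bar>a\<bar> powr p * m powr p) * \<kappa>) + 1 * (e powr (1 - p) * (\<bar>b\<bar> powr p * \<kappa>))"
    using assms by (intro add_left_mono mult_right_mono) auto
  finally show ?thesis by simp
qed

lemma integral_le_of_nn_integral_le:
  fixes X :: "'a \<Rightarrow> real"
  assumes "X \<in> borel_measurable M" "\<And>z. 0 \<le> X z" "(\<integral>\<^sup>+z. ennreal (X z) \<partial>M) \<le> ennreal C" "0 \<le> C"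
  shows "integrable M X" "(\<integral>z. X z \<partial>M) \<le> C"
proof -
  show i: "integrable M X"
    using assms by (intro integrableI_bounded) (auto intro: order_le_less_trans)
  have "ennreal (\<integral>z. X z \<partial>M) \<le> ennreal C"
    using assms nn_integral_eq_integral[OF i] by simp
  then show "(\<integral>z. X z \<partial>M) \<le> C" using assms by simp
qed

text \<open>The energies of the \<open>w j\<close> are bounded but not shown to converge, so the
  densities have no evident common majorant. Young's inequality bounds them by a small multiple of
  the energies plus a multiple of the fixed function \<open>g\<close>. What exceeds the energy part
  is dominated by \<open>g\<close> and tends to 0 in the mean; the energy part contributes at most
  \<open>2 * e * B\<close>.\<close>

lemma weak_limit:
  assumes v [measurable]: "v \<in> borel_measurable borel" and M: "\<And>z. \<bar>v z\<bar> \<le> M"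
    and w [measurable]: "\<And>j. w j \<in> borel_measurable borel" and wM: "\<And>j z. \<bar>w j z\<bar> \<le> M"
    and wv: "\<And>z. (\<lambda>j. w j z) \<longlonglongrightarrow> v z" and \<tau>: "\<And>j. 0 < \<tau> j" "\<tau> \<longlonglongrightarrow> 0"
    and D [measurable]: "D \<in> sets borel" and bD: "bounded D"
    and f [measurable]: "f \<in> borel_measurable borel" and F: "\<And>x. \<bar>f x\<bar> \<le> F"
    and op: "\<And>j x. x \<in> D \<Longrightarrow> f x \<le> 2 * trunc_op (\<tau> j) (w j) x + inverse (real (Suc j))"
    and \<zeta> [measurable]: "\<zeta> \<in> borel_measurable borel" and \<zeta>01: "\<And>x. 0 \<le> \<zeta> x" "\<And>x. \<zeta> x \<le> 1"
    and \<zeta>D: "\<And>x. x \<notin> D \<Longrightarrow> \<zeta> x = 0" and \<zeta>lip: "\<And>x y. \<bar>\<zeta> x - \<zeta> y\<bar> \<le> L * norm (x - y)"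
  defines "X \<equiv> \<lambda>z. (\<bar>v (fst z) - v (snd z)\<bar> powr p * (max (\<zeta> (fst z)) (\<zeta> (snd z))) powr p) * kap z"
  shows "integrable lborel X"
    and "\<And>\<phi> C L'. \<lbrakk>\<phi> \<in> borel_measurable borel; \<And>x. 0 \<le> \<phi> x; \<And>x. \<phi> x \<le> C; \<And>x. \<phi> x \<noteq> 0 \<Longrightarrow> \<zeta> x = 1;
       \<And>x y. \<bar>\<phi> x - \<phi> y\<bar> \<le> L' * norm (x - y)\<rbrakk> \<Longrightarrow>
      (\<integral>x. \<phi> x * f x \<partial>lborel) \<le>
      (\<integral>z. weak_density v \<phi> z \<partial>lborel)"
proof -
  have fin: "emeasure lborel D < \<infinity>" using emeasure_bounded_finite[OF bD] .
  have M0: "0 \<le> M" using M[of 0] by linarith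
  have F0: "0 \<le> F" using F[of 0] by linarith
  have \<zeta>abs: "\<bar>\<zeta> x\<bar> \<le> 1" for x using \<zeta>01[of x] by simp
  have energy: "integrable lborel (\<lambda>z. \<bar>\<zeta> (fst z) - \<zeta> (snd z)\<bar> powr p * kap z)"
    by (rule lipschitz_energy_integrable[OF \<zeta> \<zeta>abs D bD \<zeta>D \<zeta>lip])
  define B where "B = 4 * M * (F + 1) * measure lborel D + 2 * (2 * p) powr (p - 1) * p * (2 * M) powr p *
        (\<integral>z. \<bar>\<zeta> (fst z) - \<zeta> (snd z)\<bar> powr p * kap z \<partial>lborel)"
  have "0 \<le> (\<integral>z. \<bar>\<zeta> (fst z) - \<zeta> (snd z)\<bar> powr p * kap z \<partial>lborel)"
    by (intro Bochner_Integration.integral_nonneg mult_nonneg_nonneg) auto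
  then have B0: "0 \<le> B"
    unfolding B_def using M0 F0 p by (intro add_nonneg_nonneg mult_nonneg_nonneg) auto
  define Xj where "Xj j z = trunc (\<tau> j) z * (\<bar>w j (fst z) - w j (snd z)\<bar> powr p * (max (\<zeta> (fst z)) (\<zeta> (snd z))) powr p) * kap z" for j z
  have Xjm [measurable]: "Xj j \<in> borel_measurable borel" for j unfolding Xj_def by measurable
  have Xm [measurable]: "X \<in> borel_measurable borel" unfolding X_def by measurable
  have Xj0: "0 \<le> Xj j z" for j z
    unfolding Xj_def by (intro mult_nonneg_nonneg trunc_bounds kap_nonneg powr_ge_zero)
  have X0: "0 \<le> X z" for z
    unfolding X_def by (intro mult_nonneg_nonneg kap_nonneg powr_ge_zero)
  have XjB: "(\<integral>\<^sup>+z. ennreal (Xj j z) \<partial>lborel) \<le> ennreal B" for j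
    unfolding Xj_def B_def
  proof (rule caccioppoli[OF w wM \<zeta> \<zeta>01 D fin \<zeta>D energy \<tau>(1)])
    \<comment> \<open>The unit added to \<open>F\<close> absorbs the error
      \<open>inverse (real (Suc j))\<close>.\<close>
    show "0 \<le> F + 1" using F0 by linarith
    fix x assume "x \<in> D"
    from op[OF this, of j] have "f x \<le> 2 * trunc_op (\<tau> j) (w j) x + inverse (real (Suc j))" .
    moreover have "inverse (real (Suc j)) \<le> 1" by (simp add: field_simps)
    ultimately show "- (F + 1) \<le> 2 * trunc_op (\<tau> j) (w j) x" using F[of x] by linarith
  qed
  have Xlim: "(\<lambda>j. Xj j z) \<longlonglongrightarrow> X z" for z
    unfolding Xj_def X_def using p
    by (intro trunc_kap_tendsto \<tau> tendsto_intros wv tendsto_powr2) (auto intro!: always_eventually)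
  have "(\<integral>\<^sup>+z. ennreal (X z) \<partial>lborel) = (\<integral>\<^sup>+z. liminf (\<lambda>j. ennreal (Xj j z)) \<partial>lborel)"
  proof (intro nn_integral_cong)
    fix z
    have "(\<lambda>j. ennreal (Xj j z)) \<longlonglongrightarrow> ennreal (X z)" using Xlim by (rule tendsto_ennrealI)
    then show "ennreal (X z) = liminf (\<lambda>j. ennreal (Xj j z))"
      by (intro lim_imp_Liminf[symmetric]) auto
  qed
  also have "\<dots> \<le> liminf (\<lambda>j. \<integral>\<^sup>+z. ennreal (Xj j z) \<partial>lborel)"
    by (rule nn_integral_liminf) measurable
  also have "\<dots> \<le> ennreal B"
    by (rule Liminf_le) (use XjB in auto)
  finally have XB: "(\<integral>\<^sup>+z. ennreal (X z) \<partial>lborel) \<le> ennreal B" .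
  have Xi: "integrable lborel X" "(\<integral>z. X z \<partial>lborel) \<le> B"
    using integral_le_of_nn_integral_le[of X lborel B] X0 XB B0 by auto
  have Xji: "integrable lborel (Xj j)" "(\<integral>z. Xj j z \<partial>lborel) \<le> B" for j
    using integral_le_of_nn_integral_le[of "Xj j" lborel B] Xj0 XjB B0 by auto
  show "integrable lborel X" by (rule Xi)

  fix \<phi> C L'
  assume \<phi>m [measurable]: "\<phi> \<in> borel_measurable borel" and \<phi>: "\<And>x. 0 \<le> \<phi> x" "\<And>x. \<phi> x \<le> C"
    and \<phi>1: "\<And>x. \<phi> x \<noteq> 0 \<Longrightarrow> \<zeta> x = 1" and \<phi>lip: "\<And>x y. \<bar>\<phi> x - \<phi> y\<bar> \<le> L' * norm (x - y)"
  have \<phi>D: "\<phi> x = 0" if "x \<notin> D" for x using \<phi>1[of x] \<zeta>D[OF that] by auto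
  have \<phi>abs: "\<bar>\<phi> x\<bar> \<le> C" for x using \<phi>[of x] by simp
  define g where "g z = \<bar>\<phi> (fst z) - \<phi> (snd z)\<bar> powr p * kap z" for z
  have gi: "integrable lborel g"
    unfolding g_def by (rule lipschitz_energy_integrable[OF \<phi>m \<phi>abs D bD \<phi>D \<phi>lip])
  define Gj where "Gj j z = trunc (\<tau> j) z * (signed_pow p (w j (fst z) - w j (snd z)) * (\<phi> (fst z) - \<phi> (snd z))) * kap z" for j z
  define G where "G z = weak_density v \<phi> z" for z
  have Gjm [measurable]: "Gj j \<in> borel_measurable borel" for j unfolding Gj_def by measurable
  have Gm [measurable]: "G \<in> borel_measurable borel" unfolding G_def weak_density_def by measurable
  have m1: "max (\<zeta> (fst z)) (\<zeta> (snd z)) = 1" if "\<phi> (fst z) - \<phi> (snd z) \<noteq> 0" for z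
  proof -
    have "\<phi> (fst z) \<noteq> 0 \<or> \<phi> (snd z) \<noteq> 0" using that by auto
    then have "\<zeta> (fst z) = 1 \<or> \<zeta> (snd z) = 1" using \<phi>1 by blast
    then show ?thesis using \<zeta>01(2)[of "fst z"] \<zeta>01(2)[of "snd z"] by auto
  qed
  have Gjle: "\<bar>Gj j z\<bar> \<le> e * Xj j z + e powr (1 - p) * g z" if "0 < e" for e j z
    unfolding Gj_def Xj_def g_def
    by (rule young_pointwise[OF that trunc_bounds kap_nonneg m1])
  have Gle: "\<bar>G z\<bar> \<le> e * X z + e powr (1 - p) * g z" if "0 < e" for e z
    unfolding G_def weak_density_def X_def g_def
    using young_pointwise[OF that zero_le_one order_refl kap_nonneg m1] by simp
  have Glim: "(\<lambda>j. Gj j z) \<longlonglongrightarrow> G z" for z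
    unfolding Gj_def G_def weak_density_def
    by (intro trunc_kap_tendsto \<tau> tendsto_mult tendsto_const isCont_tendsto_compose[OF isCont_signed_pow[OF p(1)]] tendsto_diff wv)
  have Gi: "integrable lborel G"
  proof (rule Bochner_Integration.integrable_bound[of _ "\<lambda>z. 1 * X z + 1 powr (1 - p) * g z"])
    show "integrable lborel (\<lambda>z. 1 * X z + 1 powr (1 - p) * g z)"
      using Xi gi by (intro Bochner_Integration.integrable_add integrable_mult_right)
    have "norm (G z) \<le> norm (1 * X z + 1 powr (1 - p) * g z)" for z
      using Gle[of 1 z] by simp
    then show "AE z in lborel. norm (G z) \<le> norm (1 * X z + 1 powr (1 - p) * g z)" by simp
  qed simp
  have Gji: "integrable lborel (Gj j)" and Gjint: "(\<integral>z. Gj j z \<partial>lborel) = 2 * (\<integral>x. \<phi> x * trunc_op (\<tau> j) (w j) x \<partial>lborel)" for j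
    unfolding Gj_def by (rule trunc_weak_form[OF w wM \<phi>m \<phi>abs D fin \<phi>D \<tau>(1)]; assumption)+
  have conv: "(\<lambda>j. \<integral>z. Gj j z \<partial>lborel) \<longlonglongrightarrow> (\<integral>z. G z \<partial>lborel)"
  proof (rule LIMSEQ_I)
    fix \<epsilon> :: real assume \<epsilon>: "0 < \<epsilon>"
    \<comment> \<open>With this choice \<open>2 * e * B\<close> is at most
      \<open>\<epsilon> / 2\<close>; the denominator uses \<open>B + 1\<close> because
      \<open>B\<close> may be 0.\<close>
    define e where "e = \<epsilon> / (4 * (B + 1))"
    have e: "0 < e" using \<epsilon> B0 by (simp add: e_def)
    define c where "c = 2 * e powr (1 - p)"
    \<comment> \<open>The part of the difference not covered by the two energies. Young's inequality
      bounds it by \<open>c * g\<close>, uniformly in \<open>j\<close>.\<close>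
    define Y where "Y j z = max 0 (\<bar>Gj j z - G z\<bar> - e * Xj j z - e * X z)" for j z
    have Ym [measurable]: "Y j \<in> borel_measurable borel" for j unfolding Y_def by measurable
    have Yle: "\<bar>Y j z\<bar> \<le> c * g z" for j z
    proof -
      have "0 \<le> c * g z" by (auto simp: c_def g_def intro!: mult_nonneg_nonneg)
      moreover have "\<bar>Gj j z - G z\<bar> \<le> \<bar>Gj j z\<bar> + \<bar>G z\<bar>" by (rule abs_triangle_ineq4)
      moreover have "c * g z = e powr (1 - p) * g z + e powr (1 - p) * g z" by (simp add: c_def)
      ultimately show ?thesis using Gjle[OF e, of j z] Gle[OF e, of z] unfolding Y_def by linarith
    qed
    have cg: "integrable lborel (\<lambda>z. c * g z)" using gi by (rule integrable_mult_right)
    have Yi: "integrable lborel (Y j)" for j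
    proof (rule Bochner_Integration.integrable_bound[OF cg])
      have "norm (Y j z) \<le> norm (c * g z)" for z using Yle[of j z] by simp
      then show "AE z in lborel. norm (Y j z) \<le> norm (c * g z)" by simp
    qed simp
    have "(\<lambda>j. \<integral>z. Y j z \<partial>lborel) \<longlonglongrightarrow> (\<integral>z. 0 \<partial>(lborel :: ('n heis \<times> 'n heis) measure))"
    proof (rule integral_dominated_convergence[OF _ _ cg])
      show "AE z in lborel. (\<lambda>j. Y j z) \<longlonglongrightarrow> 0"
      proof (intro always_eventually allI)
        fix z
        have "(\<lambda>j. \<bar>Gj j z - G z\<bar>) \<longlonglongrightarrow> \<bar>G z - G z\<bar>"
          by (intro tendsto_intros Glim)
        then have up: "(\<lambda>j. \<bar>Gj j z - G z\<bar>) \<longlonglongrightarrow> 0" by simp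
        have "0 \<le> Y j z" "Y j z \<le> \<bar>Gj j z - G z\<bar>" for j
          using mult_nonneg_nonneg[of e "Xj j z"] mult_nonneg_nonneg[of e "X z"] e Xj0[of j z] X0[of z]
          unfolding Y_def by linarith+
        then show "(\<lambda>j. Y j z) \<longlonglongrightarrow> 0"
          by (intro tendsto_sandwich[OF _ _ tendsto_const up] always_eventually allI)
      qed
      show "\<And>j. AE z in lborel. norm (Y j z) \<le> c * g z" using Yle by simp
    qed simp_all
    then have Y0: "(\<lambda>j. \<integral>z. Y j z \<partial>lborel) \<longlonglongrightarrow> 0" by simp
    have "0 < \<epsilon> / 2" using \<epsilon> by simp
    from order_tendstoD(2)[OF Y0 this]
    obtain N where N: "\<And>j. N \<le> j \<Longrightarrow> (\<integral>z. Y j z \<partial>lborel) < \<epsilon> / 2"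
      unfolding eventually_sequentially by blast
    show "\<exists>N. \<forall>j\<ge>N. norm ((\<integral>z. Gj j z \<partial>lborel) - (\<integral>z. G z \<partial>lborel)) < \<epsilon>"
    proof (intro exI[of _ N] allI impI)
      fix j assume j: "N \<le> j"
      have "norm ((\<integral>z. Gj j z \<partial>lborel) - (\<integral>z. G z \<partial>lborel)) = \<bar>\<integral>z. Gj j z - G z \<partial>lborel\<bar>"
        using Gji Gi by simp
      also have "\<dots> \<le> (\<integral>z. \<bar>Gj j z - G z\<bar> \<partial>lborel)" by (rule integral_abs_bound)
      also have "\<dots> \<le> (\<integral>z. Y j z + (e * Xj j z + e * X z) \<partial>lborel)"
      proof (rule integral_mono)
        show "integrable lborel (\<lambda>z. \<bar>Gj j z - G z\<bar>)" using Gji Gi by simp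
        show "integrable lborel (\<lambda>z. Y j z + (e * Xj j z + e * X z))"
          using Yi Xji Xi by simp
        show "\<bar>Gj j z - G z\<bar> \<le> Y j z + (e * Xj j z + e * X z)" for z
          unfolding Y_def by linarith
      qed
      also have "\<dots> = (\<integral>z. Y j z \<partial>lborel) + (e * (\<integral>z. Xj j z \<partial>lborel) + e * (\<integral>z. X z \<partial>lborel))"
        using Yi Xji Xi by simp
      also have "\<dots> < \<epsilon> / 2 + (e * B + e * B)"
        using N[OF j] Xi(2) Xji(2)[of j] e by (intro add_less_le_mono add_mono mult_left_mono) auto
      also have "\<dots> \<le> \<epsilon>"
      proof -
        have "e * B \<le> e * (B + 1)" using e by (intro mult_left_mono) auto
        also have "\<dots> = \<epsilon> / 4" using B0 by (simp add: e_def divide_simps)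
        finally show ?thesis by linarith
      qed
      finally show "norm ((\<integral>z. Gj j z \<partial>lborel) - (\<integral>z. G z \<partial>lborel)) < \<epsilon>" .
    qed
  qed
  have fi: "integrable lborel (\<lambda>x. \<phi> x * f x)"
    by (rule integrable_bounded_support[of \<phi> C D f F]) (use \<phi> fin \<phi>D F in auto)
  have pi: "integrable lborel \<phi>"
    using integrable_bounded_support[of \<phi> C D "\<lambda>_. 1" 1] \<phi> fin \<phi>D by simp
  have low: "(\<integral>x. \<phi> x * f x \<partial>lborel) - inverse (real (Suc j)) * (\<integral>x. \<phi> x \<partial>lborel) \<le> (\<integral>z. Gj j z \<partial>lborel)" for j
  proof -
    have "(\<integral>x. \<phi> x * (f x - inverse (real (Suc j))) \<partial>lborel) \<le> 2 * (\<integral>x. \<phi> x * trunc_op (\<tau> j) (w j) x \<partial>lborel)"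
    proof (rule integral_test_trunc_op_ge[OF w wM \<phi>m \<phi> D fin \<phi>D \<tau>(1)])
      show "\<bar>f x - inverse (real (Suc j))\<bar> \<le> F + 1" for x
      proof -
        have "0 \<le> inverse (real (Suc j))" "inverse (real (Suc j)) \<le> 1" by (simp_all add: field_simps)
        then show ?thesis using F[of x] by linarith
      qed
      show "f x - inverse (real (Suc j)) \<le> 2 * trunc_op (\<tau> j) (w j) x" if "x \<in> D" for x
        using op[OF that, of j] by linarith
    qed simp_all
    moreover have "(\<integral>x. \<phi> x * (f x - inverse (real (Suc j))) \<partial>lborel) =
        (\<integral>x. \<phi> x * f x \<partial>lborel) - inverse (real (Suc j)) * (\<integral>x. \<phi> x \<partial>lborel)"
      using fi pi by (simp add: right_diff_distrib mult.commute)
    ultimately show ?thesis unfolding Gjint by linarith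
  qed
  have "(\<lambda>j. (\<integral>x. \<phi> x * f x \<partial>lborel) - inverse (real (Suc j)) * (\<integral>x. \<phi> x \<partial>lborel)) \<longlonglongrightarrow>
      (\<integral>x. \<phi> x * f x \<partial>lborel) - 0 * (\<integral>x. \<phi> x \<partial>lborel)"
    by (intro tendsto_intros LIMSEQ_inverse_real_of_nat)
  then have "(\<integral>x. \<phi> x * f x \<partial>lborel) - 0 * (\<integral>x. \<phi> x \<partial>lborel) \<le> (\<integral>z. G z \<partial>lborel)"
    by (rule LIMSEQ_le[OF _ conv]) (use low in blast)
  then show "(\<integral>x. \<phi> x * f x \<partial>lborel) \<le> (\<integral>z. weak_density v \<phi> z \<partial>lborel)"
    unfolding G_def by simp
qed

end

section \<open>Test functions\<close>

lemma bounded_of_compact_support: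
  fixes g :: "'a::euclidean_space \<Rightarrow> real"
  assumes "continuous_on UNIV g" "compact S" "\<And>x. x \<notin> S \<Longrightarrow> g x = 0"
  obtains C where "0 \<le> C" "\<And>x. \<bar>g x\<bar> \<le> C"
proof -
  have "compact (g ` S)" using assms by (intro compact_continuous_image) (auto intro: continuous_on_subset)
  from compact_imp_bounded[OF this] obtain C where C: "0 < C" "\<forall>y\<in>g ` S. norm y \<le> C"
    unfolding bounded_pos by blast
  show ?thesis
  proof (rule that[of C])
    show "0 \<le> C" using C(1) by simp
    show "\<bar>g x\<bar> \<le> C" for x using C assms(3)[of x] by (cases "x \<in> S") auto
  qed
qed

text \<open>The partial derivatives are continuous and vanish off the compact support, so each is
  bounded. The sum of these bounds over \<open>Basis\<close> dominates the operator norm of the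
  derivative and serves as Lipschitz constant.\<close>

lemma test_function_props:
  fixes \<phi> :: "'a::euclidean_space \<Rightarrow> real"
  assumes \<phi>: "\<phi> \<in> test_functions \<Omega>"
  obtains S C L where "compact S" "S \<subseteq> \<Omega>" "\<And>x. \<phi> x \<noteq> 0 \<Longrightarrow> x \<in> S" "continuous_on UNIV \<phi>"
    "\<And>x. \<bar>\<phi> x\<bar> \<le> C" "\<And>x y. \<bar>\<phi> x - \<phi> y\<bar> \<le> L * norm (x - y)"
proof -
  define S where "S = closure {x. \<phi> x \<noteq> 0}"
  have S: "compact S" "S \<subseteq> \<Omega>" using \<phi> by (auto simp: test_functions_def S_def)
  have S0: "\<phi> x \<noteq> 0 \<Longrightarrow> x \<in> S" for x unfolding S_def by (rule subsetD[OF closure_subset]) simp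
  define D where "D x = frechet_derivative \<phi> (at x)" for x
  have "Ck_on 0 UNIV \<phi>" "Ck_on (Suc 0) UNIV \<phi>" using \<phi> unfolding test_functions_def by blast+
  then have cont: "continuous_on UNIV \<phi>" and diff: "\<And>x. \<phi> differentiable (at x)"
    and contD: "\<And>b. b \<in> Basis \<Longrightarrow> continuous_on UNIV (\<lambda>x. D x b)"
    by (auto simp: D_def)
  have D: "(\<phi> has_derivative D x) (at x)" for x
    using diff[of x] by (simp add: D_def frechet_derivative_works)
  have D0: "D x = (\<lambda>_. 0)" if "x \<notin> S" for x
  proof -
    have "((\<lambda>_. 0) has_derivative (\<lambda>_. 0)) (at x)" by simp
    then have "(\<phi> has_derivative (\<lambda>_. 0)) (at x)"
      by (rule has_derivative_transform_within_open[of _ _ _ _ "- S"])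
        (use S that S0 in \<open>auto intro: compact_imp_closed\<close>)
    then show ?thesis using D has_derivative_unique by blast
  qed
  have "\<phi> x = 0" if "x \<notin> S" for x using that S0 by blast
  then obtain C where C: "\<And>x. \<bar>\<phi> x\<bar> \<le> C"
    by (rule bounded_of_compact_support[OF cont S(1)]) auto
  have "\<exists>B. \<forall>x. \<bar>D x b\<bar> \<le> B" if b: "b \<in> Basis" for b
  proof -
    have "D x b = 0" if "x \<notin> S" for x using D0[OF that] by simp
    then obtain B where "\<And>x. \<bar>D x b\<bar> \<le> B"
      by (rule bounded_of_compact_support[OF contD[OF b] S(1)]) auto
    then show ?thesis by blast
  qed
  then obtain B where B: "\<And>b x. b \<in> Basis \<Longrightarrow> \<bar>D x b\<bar> \<le> B b" by metis
  define L where "L = (\<Sum>b\<in>Basis. B b)"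
  have L0: "0 \<le> L" unfolding L_def by (intro sum_nonneg order_trans[OF abs_ge_zero B[of _ 0]])
  have on: "onorm (D x) \<le> L" for x
  proof (rule onorm_bound[OF L0])
    fix h
    have lin: "linear (D x)" using D[of x] has_derivative_linear by blast
    have "D x h = D x (\<Sum>b\<in>Basis. (h \<bullet> b) *\<^sub>R b)" by (simp add: euclidean_representation)
    also have "\<dots> = (\<Sum>b\<in>Basis. (h \<bullet> b) * D x b)"
      by (simp add: linear_sum[OF lin] linear_scale[OF lin])
    finally have "norm (D x h) \<le> (\<Sum>b\<in>Basis. \<bar>(h \<bullet> b) * D x b\<bar>)" by (simp add: sum_abs)
    also have "\<dots> \<le> (\<Sum>b\<in>Basis. norm h * B b)"
      unfolding abs_mult by (intro sum_mono mult_mono Basis_le_norm B) auto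
    finally show "norm (D x h) \<le> L * norm h" by (simp add: L_def sum_distrib_left mult.commute)
  qed
  have "\<bar>\<phi> x - \<phi> y\<bar> \<le> L * norm (x - y)" for x y
    using differentiable_bound[of UNIV \<phi> D L x y] D on by simp
  then show ?thesis using that[OF S S0 cont C] by blast
qed

section \<open>Null sets and Lebesgue measurability\<close>

lemma AE_lebesgue_null_set:
  assumes "AE x in lebesgue. P (x :: 'a::euclidean_space)"
  obtains N where "N \<in> null_sets lebesgue" "{x. \<not> P x} \<subseteq> N"
proof -
  from AE_E[OF assms] obtain N where N: "{x \<in> space lebesgue. \<not> P x} \<subseteq> N"
    "emeasure lebesgue N = 0" "N \<in> sets lebesgue" by blast
  have "{x. \<not> P x} \<subseteq> N" using N(1) by (simp add: space_borel)
  with null_setsI[OF N(2,3)] show ?thesis by (rule that)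
qed

lemma borel_measurable_lebesgue_AE:
  fixes f g :: "'a::euclidean_space \<Rightarrow> real"
  assumes f: "f \<in> borel_measurable lebesgue" and eq: "AE x in lebesgue. f x = g x"
  shows "g \<in> borel_measurable lebesgue"
proof (rule measurableI)
  fix A :: "real set" assume A: "A \<in> sets borel"
  obtain N where N: "N \<in> null_sets lebesgue" "{x. f x \<noteq> g x} \<subseteq> N"
    using AE_lebesgue_null_set[OF eq] by blast
  have sub: "B \<in> sets lebesgue" if "B \<subseteq> N" for B
    using completion.complete2[OF that N(1)] by (simp add: null_sets_def)
  have "f x = g x" if "x \<notin> N" for x using N(2) that by blast
  then have eq: "g -` A = (f -` A - N) \<union> (g -` A \<inter> N)" by auto
  have "f -` A \<in> sets lebesgue" using measurable_sets[OF f A] by simp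
  then have "f -` A - N \<in> sets lebesgue" using N(1) by (intro sets.Diff) auto
  then have "g -` A \<in> sets lebesgue" 
  proof (subst eq, rule sets.Un)
    show "g -` A \<inter> N \<in> sets lebesgue" by (rule sub) simp
  qed
  then show "g -` A \<inter> space lebesgue \<in> sets lebesgue" by simp
qed simp

text \<open>The exceptional pairs lie in the two strips over a Borel null set, and these are null
  for the product measure.\<close>

lemma AE_lebesgue_pair:
  assumes "AE x in lebesgue. P (x :: 'a::euclidean_space)"
  shows "AE z in (lebesgue :: ('a \<times> 'a) measure). P (fst z) \<and> P (snd z)"
proof -
  have "AE x in lborel. P x" using assms by (simp add: AE_completion_iff)
  from AE_E[OF this] obtain N where "{x \<in> space lborel. \<not> P x} \<subseteq> N" "emeasure lborel N = 0" "N \<in> sets lborel"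
    by blast
  then have N: "{x. \<not> P x} \<subseteq> N" "N \<in> sets borel" "emeasure lborel N = 0" by simp_all
  have "(N \<times> UNIV) \<union> (UNIV \<times> N) \<in> null_sets (lborel :: ('a \<times> 'a) measure)"
  proof (rule null_sets.Un)
    show "N \<times> UNIV \<in> null_sets (lborel :: ('a \<times> 'a) measure)"
      using N emeasure_lborel_Times[of N "UNIV :: 'a set"] by (auto simp: null_sets_def borel_Times)
    show "UNIV \<times> N \<in> null_sets (lborel :: ('a \<times> 'a) measure)"
      using N emeasure_lborel_Times[of "UNIV :: 'a set" N] by (auto simp: null_sets_def borel_Times)
  qed
  then have "AE z in (lborel :: ('a \<times> 'a) measure). P (fst z) \<and> P (snd z)"
    by (rule AE_I') (use N(1) in auto)
  then show ?thesis by (rule AE_completion)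
qed

section \<open>From viscosity to weak solutions\<close>

text \<open>The set where \<open>u\<close> exceeds \<open>C\<close> is open by semicontinuity and
  null by the essential bound, hence empty.\<close>

lemma lsc_upper_bound:
  assumes \<Omega>: "open \<Omega>" and lsc: "lsc_on \<Omega> (\<lambda>x. ereal (u x))" and C: "AE x in lebesgue. \<bar>u x\<bar> \<le> C"
    and x: "x \<in> (\<Omega> :: 'a::euclidean_space set)"
  shows "u x \<le> C"
proof (rule ccontr)
  assume "\<not> u x \<le> C"
  define V where "V = {z \<in> \<Omega>. ereal C < ereal (u z)}"
  have "openin (top_of_set \<Omega>) V" using lsc unfolding lsc_on_def V_def by blast
  then have "open V" using openin_open_eq[OF \<Omega>] by blast
  moreover have "x \<in> V" using x \<open>\<not> u x \<le> C\<close> by (simp add: V_def)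
  moreover have "negligible V"
  proof -
    obtain N where N: "N \<in> null_sets lebesgue" "{x. \<not> \<bar>u x\<bar> \<le> C} \<subseteq> N"
      using AE_lebesgue_null_set[OF C] by blast
    have "V \<subseteq> {x. \<not> \<bar>u x\<bar> \<le> C}" by (auto simp: V_def)
    then have "V \<subseteq> N" using N(2) by (rule order_trans)
    moreover have "negligible N" using N(1) by (simp only: negligible_iff_null_sets)
    ultimately show ?thesis by (rule negligible_subset[rotated])
  qed
  ultimately show False using open_not_negligible by blast
qed

text \<open>From below an essential bound says nothing about single points. Compactness does: the
  sets where \<open>u\<close> is above \<open>- n\<close> form an open cover of
  \<open>A\<close>.\<close>

lemma lsc_lower_bound:
  assumes A: "compact A" "A \<subseteq> \<Omega>" and \<Omega>: "open \<Omega>" and lsc: "lsc_on \<Omega> (\<lambda>x. ereal (u x))"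
  obtains m where "\<And>x. x \<in> (A :: 'a::euclidean_space set) \<Longrightarrow> m \<le> u x"
proof -
  have "openin (top_of_set \<Omega>) {z \<in> \<Omega>. ereal (- real n) < ereal (u z)}" for n
    using lsc unfolding lsc_on_def by blast
  then have op: "open {z \<in> \<Omega>. ereal (- real n) < ereal (u z)}" for n
    using openin_open_eq[OF \<Omega>] by blast
  have "A \<subseteq> (\<Union>n\<in>UNIV. {z \<in> \<Omega>. ereal (- real n) < ereal (u z)})"
  proof
    fix x assume "x \<in> A"
    moreover obtain n :: nat where "- u x < real n" using reals_Archimedean2 by blast
    ultimately show "x \<in> (\<Union>n\<in>UNIV. {z \<in> \<Omega>. ereal (- real n) < ereal (u z)})"
      using subsetD[OF A(2)] by (intro UN_I[of n]) simp_all
  qed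
  then obtain T where "T \<subseteq> UNIV" and T: "finite T" "A \<subseteq> (\<Union>n\<in>T. {z \<in> \<Omega>. ereal (- real n) < ereal (u z)})"
    by (rule compactE_image[OF A(1) op]) (rule that)
  have "- real (Max T) \<le> u x" if xA: "x \<in> A" for x
  proof -
    obtain n where "n \<in> T" "x \<in> {z \<in> \<Omega>. ereal (- real n) < ereal (u z)}" using T(2) xA by blast
    then have n: "n \<in> T" "- real n < u x" by simp_all
    then have "real n \<le> real (Max T)" using T(1) by simp
    then show ?thesis using n by linarith
  qed
  then show ?thesis by (rule that)
qed

context heis_kernel
begin

text \<open>The weak inequality against nonnegative bounded Lipschitz functions vanishing off
  \<open>S\<close>; by \<open>test_function_props\<close> the nonnegative smooth test functions
  supported in \<open>S\<close> are among them.\<close>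

definition weak_inequality :: "'n heis set \<Rightarrow> ('n heis \<Rightarrow> real) \<Rightarrow> ('n heis \<Rightarrow> real) \<Rightarrow> bool" where
  "weak_inequality S h v \<longleftrightarrow> (\<forall>\<phi> C L. \<phi> \<in> borel_measurable borel \<and> (\<forall>x. 0 \<le> \<phi> x) \<and> (\<forall>x. \<phi> x \<le> C) \<and> (\<forall>x. \<phi> x \<noteq> 0 \<longrightarrow> x \<in> S) \<and>
         (\<forall>x y. \<bar>\<phi> x - \<phi> y\<bar> \<le> L * norm (x - y)) \<longrightarrow>
       (\<integral>x. \<phi> x * h x \<partial>lborel) \<le> (\<integral>z. weak_density v \<phi> z \<partial>lborel))"

text \<open>\<open>touch\<close> abstracts from the viscosity condition, so that supersolutions and
  negated subsolutions share one argument. For each compact \<open>S\<close> a Borel function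
  \<open>v\<close> is built; membership in the fractional space and the weak inequality pass from
  \<open>v\<close> to \<open>u\<close>, since integrals do not see null sets.\<close>

lemma touched_imp_weak_supersolution:
  assumes \<Omega>: "open \<Omega>" and f: "continuous_on \<Omega> f" and u: "u \<in> Linfty"
    and lsc: "lsc_on \<Omega> (\<lambda>z. ereal (u z))"
    and touch: "\<And>A v M. \<lbrakk>A \<subseteq> \<Omega>; v \<in> borel_measurable borel; \<And>z. \<bar>v z\<bar> \<le> M; AE z in lebesgue. u z = v z;
        \<And>z. z \<in> A \<Longrightarrow> v z = u z\<rbrakk> \<Longrightarrow> touched_below A f v"
  shows "weak_supersolution s p K f \<Omega> u"
proof -
  have um: "u \<in> borel_measurable lebesgue" using u by (simp add: Linfty_def)
  obtain C where C: "AE x in lebesgue. \<bar>u x\<bar> \<le> C" using u by (auto simp: Linfty_def)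
  obtain u' where u'm [measurable]: "u' \<in> borel_measurable borel" and u': "AE x in lborel. u x = u' x"
    using completion_ex_borel_measurable_real[OF um] by auto
  have "\<exists>v D. v \<in> borel_measurable borel \<and> (AE z in lebesgue. u z = v z) \<and> D \<subseteq> \<Omega> \<and> S \<subseteq> D \<and>
      integrable lborel (\<lambda>z. indicator (S \<times> S) z * \<bar>v (fst z) - v (snd z)\<bar> powr p * kap z) \<and>
      weak_inequality S (\<lambda>x. indicator D x * f x) v"
    if S: "compact S" "S \<subseteq> \<Omega>" "S \<noteq> {}" for S
  proof -
    obtain e where e: "0 < e" "{x. infdist x S \<le> e} \<subseteq> \<Omega>"
      using compact_in_open_separated[OF S(3) S(1) \<Omega> S(2)] by blast
    \<comment> \<open>Nested neighbourhoods of \<open>S\<close>: the inf-convolution acts on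
      \<open>A\<close>, the inequality and the cutoff live on \<open>D\<close>. The gap between
      \<open>S\<close> and \<open>D\<close> carries the slope of the cutoff, the gap between
      \<open>D\<close> and \<open>A\<close> gives room for translations.\<close>
    define A where "A = {x. infdist x S \<le> e}"
    define D where "D = {x. infdist x S \<le> e / 2}"
    have e2: "0 < e / 2" using e(1) by simp
    have A: "compact A" "A \<subseteq> \<Omega>"
      unfolding A_def by (rule compact_infdist_le[OF S(3,1) e(1)], rule e(2))
    have D: "compact D" "D \<subseteq> A"
      unfolding D_def by (rule compact_infdist_le[OF S(3,1) e2]) (use e(1) in \<open>auto simp: A_def\<close>)
    have SD: "S \<subseteq> D" using e by (auto simp: D_def)
    have Dm [measurable]: "D \<in> sets borel" using D by (simp add: borel_closed compact_imp_closed)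
    obtain m where m: "\<And>x. x \<in> A \<Longrightarrow> m \<le> u x" using lsc_lower_bound[OF A \<Omega> lsc] by blast
    define M where "M = max (max C 0) (- m)"
    \<comment> \<open>Touching requires equality with \<open>u\<close> at every point of
      \<open>A\<close>. Elsewhere the Borel representative, clipped to the range of the bound, makes
      \<open>v\<close> Borel and bounded everywhere.\<close>
    define v where "v z = (if z \<in> A then u z else max (- M) (min M (u' z)))" for z
    have vA: "v z = u z" if "z \<in> A" for z using that by (simp add: v_def)
    have uA: "\<bar>u z\<bar> \<le> M" if "z \<in> A" for z
      using m[OF that] lsc_upper_bound[OF \<Omega> lsc C, of z] that A(2) by (auto simp: M_def)
    have vM: "\<bar>v z\<bar> \<le> M" for z using uA[of z] by (auto simp: v_def M_def)
    have lscA: "openin (top_of_set A) {x\<in>A. a < v x}" for a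
    proof -
      have "openin (top_of_set \<Omega>) {z \<in> \<Omega>. ereal a < ereal (u z)}"
        using lsc unfolding lsc_on_def by blast
      then have "open {z \<in> \<Omega>. ereal a < ereal (u z)}" using openin_open_eq[OF \<Omega>] by blast
      moreover have "{x\<in>A. a < v x} = A \<inter> {z \<in> \<Omega>. ereal a < ereal (u z)}" using vA A(2) by auto
      ultimately show ?thesis by auto
    qed
    have Am [measurable]: "A \<in> sets borel" using A by (simp add: borel_closed compact_imp_closed)
    \<comment> \<open>On \<open>A\<close> Borel measurability comes from lower semicontinuity, since
      superlevel sets are relatively open there.\<close>
    have vm [measurable]: "v \<in> borel_measurable borel"
    proof (rule borel_measurable_iff_greater[THEN iffD2], intro allI)
      fix a
      obtain T where T: "open T" "{x\<in>A. a < v x} = A \<inter> T" using lscA[of a] unfolding openin_open by blast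
      have "{w \<in> space borel. a < v w} = (A \<inter> T) \<union> ((- A) \<inter> {z. a < max (- M) (min M (u' z))})"
        unfolding T(2)[symmetric] by (auto simp: v_def)
      also have "\<dots> \<in> sets borel" using T(1) by measurable
      finally show "{w \<in> space borel. a < v w} \<in> sets borel" .
    qed
    have AE: "AE z in lebesgue. u z = v z"
      using C AE_completion[OF u']
    proof eventually_elim
      case (elim z)
      then show ?case by (auto simp: v_def M_def)
    qed
    have tb: "touched_below A f v" by (rule touch[OF A(2) vm vM AE vA])
    have fA: "continuous_on A f" using f A(2) by (rule continuous_on_subset)
    have sep: "z \<in> A" if "x \<in> D" "norm (z - x) \<le> e / 2" for x z
      using infdist_triangle[of z S x] that by (simp add: A_def D_def dist_norm)
    obtain w \<tau> where w: "\<And>j. w j \<in> borel_measurable borel" "\<And>j z. \<bar>w j z\<bar> \<le> M" "\<And>z. (\<lambda>j. w j z) \<longlonglongrightarrow> v z"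
      and \<tau>: "\<And>j. 0 < \<tau> j" "\<tau> \<longlonglongrightarrow> 0" and op: "\<And>j x. x \<in> D \<Longrightarrow> f x \<le> 2 * trunc_op (\<tau> j) (w j) x + inverse (real (Suc j))"
      by (rule touched_below_approximation_sequence[where v=v and M=M and D=D and d="e / 2", OF tb vM vm A(1) lscA fA _ sep])
        (use e in auto)
    have fD: "continuous_on D f" using fA D(2) by (rule continuous_on_subset)
    define h where "h x = indicator D x * f x" for x
    have hm: "h \<in> borel_measurable borel"
      using borel_measurable_continuous_on_indicator[OF Dm fD] by (simp add: h_def[abs_def])
    obtain F where F: "\<And>x. x \<in> D \<Longrightarrow> \<bar>f x\<bar> \<le> F" "0 < F"
      using compact_imp_bounded[OF compact_continuous_image[OF fD D(1)]] unfolding bounded_pos by auto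
    have hF: "\<bar>h x\<bar> \<le> F" for x using F by (auto simp: h_def indicator_def)
    have hop: "h x \<le> 2 * trunc_op (\<tau> j) (w j) x + inverse (real (Suc j))" if "x \<in> D" for x j
      using op[OF that, of j] that by (simp add: h_def)
    \<comment> \<open>The slope \<open>2 / e\<close> takes the cutoff from 1 on \<open>S\<close> to
      0 at distance \<open>e / 2\<close>, the boundary distance of \<open>D\<close>.\<close>
    define \<zeta> where "\<zeta> x = max 0 (1 - 2 / e * infdist x S)" for x
    have \<zeta>m: "\<zeta> \<in> borel_measurable borel"
      unfolding \<zeta>_def by (intro borel_measurable_continuous_onI continuous_intros)
    have \<zeta>01: "0 \<le> \<zeta> x" "\<zeta> x \<le> 1" for x using e by (auto simp: \<zeta>_def infdist_nonneg)
    have \<zeta>D: "\<zeta> x = 0" if "x \<notin> D" for x using that e by (simp add: \<zeta>_def D_def field_simps)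
    have \<zeta>S: "\<zeta> x = 1" if "x \<in> S" for x using that by (simp add: \<zeta>_def)
    have \<zeta>lip: "\<bar>\<zeta> x - \<zeta> y\<bar> \<le> 2 / e * norm (x - y)" for x y
    proof -
      have "\<bar>\<zeta> x - \<zeta> y\<bar> \<le> \<bar>2 / e * infdist x S - 2 / e * infdist y S\<bar>" unfolding \<zeta>_def by linarith
      also have "\<dots> = 2 / e * \<bar>infdist x S - infdist y S\<bar>"
        unfolding right_diff_distrib[symmetric] abs_mult using e(1) by simp
      also have "\<dots> \<le> 2 / e * norm (x - y)"
        using infdist_triangle_abs[of x S y] e by (intro mult_left_mono) (auto simp: dist_norm)
      finally show ?thesis .
    qed
    note wl = weak_limit[where v=v and w=w and \<tau>=\<tau> and D=D and f=h and \<zeta>=\<zeta> and M=M and F=F and L="2 / e", OF vm vM w \<tau> Dm compact_imp_bounded[OF D(1)] hm hF hop \<zeta>m \<zeta>01 \<zeta>D \<zeta>lip]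
    have int: "integrable lborel (\<lambda>z. indicator (S \<times> S) z * \<bar>v (fst z) - v (snd z)\<bar> powr p * kap z)"
    proof (rule Bochner_Integration.integrable_bound[OF wl(1)])
      have [measurable]: "S \<times> S \<in> sets borel" using S by (intro borel_closed closed_Times compact_imp_closed)
      show "(\<lambda>z. indicator (S \<times> S) z * \<bar>v (fst z) - v (snd z)\<bar> powr p * kap z) \<in> borel_measurable lborel" by measurable
      have "norm (indicator (S \<times> S) z * \<bar>v (fst z) - v (snd z)\<bar> powr p * kap z) \<le>
          norm ((\<bar>v (fst z) - v (snd z)\<bar> powr p * (max (\<zeta> (fst z)) (\<zeta> (snd z))) powr p) * kap z)" for z
        by (cases "z \<in> S \<times> S") (auto simp: \<zeta>S)
      then show "AE z in lborel. norm (indicator (S \<times> S) z * \<bar>v (fst z) - v (snd z)\<bar> powr p * kap z) \<le>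
          norm ((\<bar>v (fst z) - v (snd z)\<bar> powr p * (max (\<zeta> (fst z)) (\<zeta> (snd z))) powr p) * kap z)" by simp
    qed
    show ?thesis
      unfolding weak_inequality_def
    proof (intro exI[of _ v] exI[of _ D] conjI vm AE int allI impI)
      show "D \<subseteq> \<Omega>" using D A by blast
      fix \<phi> :: "'n heis \<Rightarrow> real" and C L
      assume asm: "\<phi> \<in> borel_measurable borel \<and> (\<forall>x. 0 \<le> \<phi> x) \<and> (\<forall>x. \<phi> x \<le> C) \<and> (\<forall>x. \<phi> x \<noteq> 0 \<longrightarrow> x \<in> S) \<and>
         (\<forall>x y. \<bar>\<phi> x - \<phi> y\<bar> \<le> L * norm (x - y))"
      show "(\<integral>x. \<phi> x * (indicator D x * f x) \<partial>lborel) \<le> (\<integral>z. weak_density v \<phi> z \<partial>lborel)"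
        unfolding h_def[symmetric]
      proof (rule wl(2)[of \<phi> C L])
        show "\<phi> \<in> borel_measurable borel" using asm by blast
        show "0 \<le> \<phi> x" "\<phi> x \<le> C" for x using asm by blast+
        show "\<zeta> x = 1" if "\<phi> x \<noteq> 0" for x using asm that by (intro \<zeta>S) blast
        show "\<bar>\<phi> x - \<phi> y\<bar> \<le> L * norm (x - y)" for x y using asm by blast
      qed
    qed (rule SD)
  qed note main = this
  show ?thesis
    unfolding weak_supersolution_def
  proof (intro conjI ballI impI)
    show "u \<in> Lweighted (p - 1) (s * p)"
      by (rule Linfty_imp_Lweighted[OF u]) (use p sp_pos in auto)
    show "u \<in> Wsp_loc s p \<Omega>"
      unfolding Wsp_loc_def
    proof (intro CollectI allI impI)
      fix U assume U: "open U \<and> compact (closure U) \<and> closure U \<subseteq> \<Omega>"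
      have [measurable]: "U \<in> sets borel" using U by simp
      have Ul: "U \<in> sets lebesgue" by simp
      have "u \<in> Lp_on p (closure U)"
        using Linfty_imp_Lweighted[OF u, of p 1] p U by (auto simp: Lweighted_def)
      then have "(\<integral>\<^sup>+x\<in>closure U. ennreal (\<bar>u x\<bar> powr p) \<partial>lebesgue) < \<infinity>" by (simp add: Lp_on_def)
      moreover have "(\<integral>\<^sup>+x\<in>U. ennreal (\<bar>u x\<bar> powr p) \<partial>lebesgue) \<le> (\<integral>\<^sup>+x\<in>closure U. ennreal (\<bar>u x\<bar> powr p) \<partial>lebesgue)"
        using closure_subset[of U] by (intro nn_integral_mono) (auto simp: indicator_def)
      moreover have "set_borel_measurable lebesgue U u"
        unfolding set_borel_measurable_def using um Ul by (intro borel_measurable_scaleR borel_measurable_indicator)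
      ultimately have Lp: "u \<in> Lp_on p U" by (auto simp: Lp_on_def intro: order_le_less_trans)
      define W where "W a b \<xi> \<eta> = ennreal (\<bar>a - b\<bar> powr p / hnorm ((- \<eta>) \<diamondop> \<xi>) powr (hom_dim TYPE('n) + s * p))"
        for a b and \<xi> \<eta> :: "'n heis"
      have "(\<integral>\<^sup>+\<xi>\<in>U. (\<integral>\<^sup>+\<eta>\<in>U. W (u \<xi>) (u \<eta>) \<xi> \<eta> \<partial>lebesgue) \<partial>lebesgue) < \<infinity>"
      proof (cases "U = {}")
        case False
        then obtain v where v [measurable]: "v \<in> borel_measurable borel" and AE: "AE z in lebesgue. u z = v z"
          and int: "integrable lborel (\<lambda>z. indicator (closure U \<times> closure U) z * \<bar>v (fst z) - v (snd z)\<bar> powr p * kap z)"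
          using main[of "closure U"] U by auto
        define E where "E \<xi> \<eta> = W (v \<xi>) (v \<eta>) \<xi> \<eta> * indicator U \<eta>" for \<xi> \<eta>
        have "(\<integral>\<^sup>+\<xi>\<in>U. (\<integral>\<^sup>+\<eta>\<in>U. W (u \<xi>) (u \<eta>) \<xi> \<eta> \<partial>lebesgue) \<partial>lebesgue)
          = (\<integral>\<^sup>+\<xi>\<in>U. (\<integral>\<^sup>+\<eta>. E \<xi> \<eta> \<partial>lborel) \<partial>lborel)"
        proof -
          have inner: "(\<integral>\<^sup>+\<eta>\<in>U. W (v \<xi>) (u \<eta>) \<xi> \<eta> \<partial>lebesgue) = (\<integral>\<^sup>+\<eta>. E \<xi> \<eta> \<partial>lborel)" for \<xi>
          proof -
            have "(\<integral>\<^sup>+\<eta>\<in>U. W (v \<xi>) (u \<eta>) \<xi> \<eta> \<partial>lebesgue) = (\<integral>\<^sup>+\<eta>. E \<xi> \<eta> \<partial>lebesgue)"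
            proof (rule nn_integral_cong_AE)
              show "AE \<eta> in lebesgue. W (v \<xi>) (u \<eta>) \<xi> \<eta> * indicator U \<eta> = E \<xi> \<eta>"
                using AE by eventually_elim (simp add: E_def)
            qed
            also have "\<dots> = (\<integral>\<^sup>+\<eta>. E \<xi> \<eta> \<partial>lborel)" by (rule nn_integral_completion)
            finally show ?thesis .
          qed
          have "(\<integral>\<^sup>+\<xi>\<in>U. (\<integral>\<^sup>+\<eta>\<in>U. W (u \<xi>) (u \<eta>) \<xi> \<eta> \<partial>lebesgue) \<partial>lebesgue)
            = (\<integral>\<^sup>+\<xi>\<in>U. (\<integral>\<^sup>+\<eta>. E \<xi> \<eta> \<partial>lborel) \<partial>lebesgue)"
          proof (rule nn_integral_cong_AE)
            show "AE \<xi> in lebesgue. (\<integral>\<^sup>+\<eta>\<in>U. W (u \<xi>) (u \<eta>) \<xi> \<eta> \<partial>lebesgue) * indicator U \<xi> =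
              (\<integral>\<^sup>+\<eta>. E \<xi> \<eta> \<partial>lborel) * indicator U \<xi>"
              using AE
            proof eventually_elim
              case (elim \<xi>)
              then show ?case by (simp only: inner)
            qed
          qed
          also have "\<dots> = (\<integral>\<^sup>+\<xi>\<in>U. (\<integral>\<^sup>+\<eta>. E \<xi> \<eta> \<partial>lborel) \<partial>lborel)" by (rule nn_integral_completion)
          finally show ?thesis .
        qed
        also have "\<dots> = (\<integral>\<^sup>+z. E (fst z) (snd z) * indicator U (fst z) \<partial>lborel)"
          unfolding E_def W_def by (subst nn_integral_lborel_pair) (auto simp: nn_integral_multc)
        \<comment> \<open>Lower ellipticity: the kernel of the fractional seminorm is at most
          \<open>1 / lam\<close> times \<open>kap\<close>.\<close>
        also have "\<dots> \<le> (\<integral>\<^sup>+z. ennreal (1 / lam * (indicator (closure U \<times> closure U) z * \<bar>v (fst z) - v (snd z)\<bar> powr p * kap z)) \<partial>lborel)"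
        proof (intro nn_integral_mono)
          fix z :: "'n heis \<times> 'n heis"
          obtain x y where z: "z = (x, y)" by (cases z)
          show "E (fst z) (snd z) * indicator U (fst z) \<le> ennreal (1 / lam * (indicator (closure U \<times> closure U) z * \<bar>v (fst z) - v (snd z)\<bar> powr p * kap z))"
          proof (cases "x \<in> U \<and> y \<in> U")
            case True
            then have cl: "x \<in> closure U" "y \<in> closure U" using closure_subset by auto
            define d where "d = hnorm ((- y) \<diamondop> x)"
            have "d powr (- hom_dim TYPE('n) - s * p) = 1 / d powr (hom_dim TYPE('n) + s * p)"
              using powr_minus_divide[of d "hom_dim TYPE('n) + s * p"] by simp
            moreover have "lam * d powr (- hom_dim TYPE('n) - s * p) \<le> kap (x, y)"
              using k_ge[of "(- y) \<diamondop> x"] by (simp add: kap_def gdiff_def d_def)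
            ultimately have "1 / d powr (hom_dim TYPE('n) + s * p) \<le> 1 / lam * kap (x, y)"
              using lam by (simp add: field_simps)
            from mult_left_mono[OF this powr_ge_zero[of "\<bar>v x - v y\<bar>" p]]
            show ?thesis using True cl by (simp add: z E_def W_def d_def mult.commute mult.left_commute ennreal_leI)
          qed (auto simp: z E_def indicator_def)
        qed
        also have "\<dots> < \<infinity>"
          using integrable_mult_right[OF int, of "1 / lam"] lam
          by (subst nn_integral_eq_integral) (auto intro!: AE_I2 mult_nonneg_nonneg)
        finally show ?thesis .
      qed simp
      then show "u \<in> Wsp_on s p U" using Lp by (simp add: Wsp_on_def W_def)
    qed
    fix \<phi> assume \<phi>: "\<phi> \<in> test_functions \<Omega>" and \<phi>0: "\<forall>\<xi>. 0 \<le> \<phi> \<xi>"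
    obtain S B L where S: "compact S" "S \<subseteq> \<Omega>" "\<And>x. \<phi> x \<noteq> 0 \<Longrightarrow> x \<in> S" and cont: "continuous_on UNIV \<phi>"
      and B: "\<And>x. \<bar>\<phi> x\<bar> \<le> B" and L: "\<And>x y. \<bar>\<phi> x - \<phi> y\<bar> \<le> L * norm (x - y)"
      using test_function_props[OF \<phi>] by metis
    show "(LINT \<xi>:\<Omega>|lebesgue. f \<xi> * \<phi> \<xi>) \<le> weak_form p K u \<phi>"
    proof (cases "S = {}")
      case True
      then have "\<phi> = (\<lambda>_. 0)" using S(3) by (intro ext) blast
      then show ?thesis by (simp add: weak_form_def set_lebesgue_integral_def case_prod_beta')
    next
      case False
      have \<phi>m [measurable]: "\<phi> \<in> borel_measurable borel" using cont by (rule borel_measurable_continuous_onI)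
      from main[OF S(1,2) False] obtain v D where v [measurable]: "v \<in> borel_measurable borel"
        and AE: "AE z in lebesgue. u z = v z" and D: "D \<subseteq> \<Omega>" "S \<subseteq> D"
        and test: "weak_inequality S (\<lambda>x. indicator D x * f x) v"
        by (elim exE conjE) 
      define G where "G z = weak_density v \<phi> z" for z
      have Gm [measurable]: "G \<in> borel_measurable borel" unfolding G_def weak_density_def by measurable
      have "\<phi> x \<le> B" for x using B[of x] by simp
      then have le: "(\<integral>x. \<phi> x * (indicator D x * f x) \<partial>lborel) \<le> (\<integral>z. G z \<partial>lborel)"
        unfolding G_def using test \<phi>m \<phi>0 S(3) L unfolding weak_inequality_def by blast
      have Gl: "G \<in> borel_measurable lebesgue" by (intro measurable_completion) simp
      \<comment> \<open>Off the diagonal \<open>kap\<close> is \<open>K\<close>; on it both sides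
        vanish with the increments, whatever value \<open>K\<close> takes there.\<close>
      have eq: "AE z in lebesgue. G z = (case z of (\<xi>, \<eta>) \<Rightarrow> signed_pow p (u \<xi> - u \<eta>) * (\<phi> \<xi> - \<phi> \<eta>) * K \<xi> \<eta>)"
        using AE_lebesgue_pair[OF AE]
      proof eventually_elim
        case (elim z)
        obtain x y where z: "z = (x, y)" by (cases z)
        show ?case
        proof (cases "x = y")
          case False
          then show ?thesis using elim K_eq[OF False] by (simp add: z G_def weak_density_def kap_def gdiff_def)
        qed (simp add: z G_def weak_density_def)
      qed
      have wf: "weak_form p K u \<phi> = (\<integral>z. G z \<partial>lborel)"
      proof -
        have "weak_form p K u \<phi> = (\<integral>z. G z \<partial>lebesgue)"
          unfolding weak_form_def
          by (rule integral_cong_AE[OF borel_measurable_lebesgue_AE[OF Gl eq] Gl])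
            (use eq in \<open>auto elim: eventually_mono\<close>)
        also have "\<dots> = (\<integral>z. G z \<partial>lborel)" by (rule integral_completion) simp
        finally show ?thesis .
      qed
      have "(LINT \<xi>:\<Omega>|lebesgue. f \<xi> * \<phi> \<xi>) = (\<integral>x. \<phi> x * (indicator D x * f x) \<partial>lebesgue)"
        unfolding set_lebesgue_integral_def
      proof (intro Bochner_Integration.integral_cong refl)
        fix x
        show "indicator \<Omega> x *\<^sub>R (f x * \<phi> x) = \<phi> x * (indicator D x * f x)"
        proof (cases "\<phi> x = 0")
          case False
          then have "x \<in> S" by (rule S(3))
          then have "x \<in> D" "x \<in> \<Omega>" using S(2) D by blast+
          then show ?thesis by simp
        qed simp
      qed
      also have "\<dots> = (\<integral>x. \<phi> x * (indicator D x * f x) \<partial>lborel)"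
      proof (rule integral_completion)
        have eqS: "\<phi> x * (indicator D x * f x) = \<phi> x * (indicator S x *\<^sub>R f x)" for x
          using S(3)[of x] D by (cases "\<phi> x = 0") auto
        have "(\<lambda>x. indicator S x *\<^sub>R f x) \<in> borel_measurable borel"
          using S(1) continuous_on_subset[OF f S(2)]
          by (intro borel_measurable_continuous_on_indicator) (auto intro: borel_closed compact_imp_closed)
        then show "(\<lambda>x. \<phi> x * (indicator D x * f x)) \<in> borel_measurable lborel"
          unfolding eqS by measurable
      qed
      finally show ?thesis using le wf by simp
    qed
  qed
qed

end

text \<open>The function spaces see only absolute values and absolute increments, while the weak
  form is odd in \<open>u\<close> and the right-hand side odd in \<open>f\<close>.\<close>

lemma weak_supersolution_uminus:
  assumes "weak_supersolution s p K (\<lambda>x. - f x) \<Omega> (\<lambda>x. - u x)"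
  shows "weak_subsolution s p K f \<Omega> u"
proof -
  have "u \<in> Lp_on q U \<longleftrightarrow> (\<lambda>x. - u x) \<in> Lp_on q U" for q U
  proof -
    have "(\<lambda>x. indicat_real U x *\<^sub>R - u x) = (\<lambda>x. - (indicat_real U x *\<^sub>R u x))" by simp
    then have "set_borel_measurable lebesgue U (\<lambda>x. - u x) \<longleftrightarrow> set_borel_measurable lebesgue U u"
      unfolding set_borel_measurable_def by (simp only: borel_measurable_uminus_eq)
    then show ?thesis by (simp add: Lp_on_def)
  qed note Lp = this
  have "u \<in> Lweighted (p - 1) (s * p)"
    using assms Lp by (simp add: weak_supersolution_def Lweighted_def)
  moreover have "u \<in> Wsp_on s p U \<longleftrightarrow> (\<lambda>x. - u x) \<in> Wsp_on s p U" for U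
  proof -
    have "\<bar>- u x - - u y\<bar> = \<bar>u x - u y\<bar>" for x y by simp
    then show ?thesis unfolding Wsp_on_def mem_Collect_eq using Lp[of p U] by simp
  qed
  then have "u \<in> Wsp_loc s p \<Omega>"
    using assms unfolding weak_supersolution_def Wsp_loc_def by blast
  moreover have "weak_form p K u \<phi> \<le> (LINT \<xi>:\<Omega>|lebesgue. f \<xi> * \<phi> \<xi>)"
    if "\<phi> \<in> test_functions \<Omega>" "\<forall>\<xi>. 0 \<le> \<phi> \<xi>" for \<phi>
  proof -
    have "(case z of (\<xi>, \<eta>) \<Rightarrow> signed_pow p (- u \<xi> - - u \<eta>) * (\<phi> \<xi> - \<phi> \<eta>) * K \<xi> \<eta>) =
        - (case z of (\<xi>, \<eta>) \<Rightarrow> signed_pow p (u \<xi> - u \<eta>) * (\<phi> \<xi> - \<phi> \<eta>) * K \<xi> \<eta>)" for z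
      using signed_pow_minus[of p "u (fst z) - u (snd z)"] by (cases z) simp
    then have "(\<lambda>(\<xi>, \<eta>). signed_pow p (- u \<xi> - - u \<eta>) * (\<phi> \<xi> - \<phi> \<eta>) * K \<xi> \<eta>) =
        (\<lambda>z. - (case z of (\<xi>, \<eta>) \<Rightarrow> signed_pow p (u \<xi> - u \<eta>) * (\<phi> \<xi> - \<phi> \<eta>) * K \<xi> \<eta>))" by (rule ext)
    then have "weak_form p K (\<lambda>x. - u x) \<phi> = - weak_form p K u \<phi>"
      unfolding weak_form_def by (simp only: Bochner_Integration.integral_minus)
    moreover have "(LINT \<xi>:\<Omega>|lebesgue. - f \<xi> * \<phi> \<xi>) = - (LINT \<xi>:\<Omega>|lebesgue. f \<xi> * \<phi> \<xi>)"
      by (simp add: set_lebesgue_integral_def)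
    moreover have "(LINT \<xi>:\<Omega>|lebesgue. - f \<xi> * \<phi> \<xi>) \<le> weak_form p K (\<lambda>x. - u x) \<phi>"
      using assms that unfolding weak_supersolution_def by blast
    ultimately show ?thesis by linarith
  qed
  ultimately show ?thesis by (simp add: weak_subsolution_def)
qed

theorem theorem1p10:
  fixes s p lam Lam :: real
    and \<Omega> :: "'n::finite heis set"
    and K :: "'n heis \<Rightarrow> 'n heis \<Rightarrow> real"
    and f u :: "'n heis \<Rightarrow> real"
  assumes "0 < s" "s < 1" "1 < p" "p > 2 / (2 - s)"
    and "0 < lam" "lam \<le> Lam"
    and "open \<Omega>" "continuous_on \<Omega> f"
    and "nonlocal_kernel s p lam Lam K"
    and "u \<in> Linfty"
  shows "(viscosity_subsolution s p K f \<Omega> (\<lambda>\<xi>. ereal (u \<xi>)) \<longrightarrow> weak_subsolution s p K f \<Omega> u) \<and>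
         (viscosity_supersolution s p K f \<Omega> (\<lambda>\<xi>. ereal (u \<xi>)) \<longrightarrow> weak_supersolution s p K f \<Omega> u) \<and>
         (viscosity_solution s p K f \<Omega> (\<lambda>\<xi>. ereal (u \<xi>)) \<longrightarrow> weak_solution s p K f \<Omega> u)"
proof -
  interpret heis_kernel s p lam Lam K
    using assms by unfold_locales
  have super: "weak_supersolution s p K f \<Omega> u" if "viscosity_supersolution s p K f \<Omega> (\<lambda>\<xi>. ereal (u \<xi>))"
    using that viscosity_supersolution_touched_below[OF that \<open>u \<in> Linfty\<close>] assms
    by (intro touched_imp_weak_supersolution) (auto simp: viscosity_supersolution_def)
  have sub: "weak_subsolution s p K f \<Omega> u" if vis: "viscosity_subsolution s p K f \<Omega> (\<lambda>\<xi>. ereal (u \<xi>))"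
  proof -
    have neg: "(\<lambda>x. - u x) \<in> Linfty" using \<open>u \<in> Linfty\<close> by (auto simp: Linfty_def)
    have "weak_supersolution s p K (\<lambda>x. - f x) \<Omega> (\<lambda>x. - u x)"
    proof (rule touched_imp_weak_supersolution[OF assms(7) _ neg])
      show "continuous_on \<Omega> (\<lambda>x. - f x)" using assms(8) by (rule continuous_on_minus)
      have "usc_on \<Omega> (\<lambda>\<xi>. ereal (u \<xi>))" using vis by (simp add: viscosity_subsolution_def)
      moreover have "{x \<in> \<Omega>. a < ereal (- u x)} = {x \<in> \<Omega>. ereal (u x) < - a}" for a
        by (cases a) auto
      ultimately show "lsc_on \<Omega> (\<lambda>z. ereal (- u z))"
        unfolding usc_on_def lsc_on_def by simp
      fix A v M
      assume A: "A \<subseteq> \<Omega>" and v: "v \<in> borel_measurable borel" "\<And>z. \<bar>v z\<bar> \<le> M"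
        and AE: "AE z in lebesgue. - u z = v z" and eq: "\<And>z. z \<in> A \<Longrightarrow> v z = - u z"
      \<comment> \<open>The subsolution lemma is applied to \<open>- v\<close>, which represents
        \<open>u\<close> itself; its conclusion concerns the negative of that, namely
        \<open>v\<close>.\<close>
      have "touched_below A (\<lambda>z. - f z) (\<lambda>z. - (- v z))"
        by (rule viscosity_subsolution_touched_below[where M=M, OF vis \<open>u \<in> Linfty\<close> A])
          (use v AE eq in \<open>auto elim: eventually_mono\<close>)
      then show "touched_below A (\<lambda>x. - f x) v" by simp
    qed
    then show ?thesis by (rule weak_supersolution_uminus)
  qed
  show ?thesis using super sub by (auto simp: viscosity_solution_def weak_solution_def)
qed

end
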